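(* Let $\mu,\nu\in\mathbb{C}$ and let $S_{\mu,\nu}(\zeta)$ be a Lommel function on an arbitrary branch. Then the entire function $S_{\mu,\nu}(\mathrm{e}^z)$ has finite order of growth if and only if $\mu+\nu$ or $\mu-\nu$ equals $2p+1$ for some non-negative integer $p$. In that case $S_{\mu,\nu}(\mathrm{e}^z)=\zeta^{\mu-1}\sum_{k=0}^p\frac{(-1)^kc_k}{\zeta^{2k}}$ with $\zeta=\mathrm{e}^z$, where $c_0=1$, $c_k=\prod_{m=1}^k[(\mu-2m+1)^2-\nu^2]$.
   Context: $J_\nu,Y_\nu$ are the Bessel functions of the first and second kinds; $\psi=\Gamma'/\Gamma$; $(a)_k=a(a+1)\cdots(a+k-1)$; principal branch $-\pi<\arg\zeta<\pi$ for powers and logarithms. The Lommel function $S_{\mu,\nu}(\zeta)$ is the following (multivalued) particular solution of $\zeta^2y''+\zeta y'+(\zeta^2-\nu^2)y=\zeta^{\mu+1}$. (i) If neither $\mu+\nu$ nor $\mu-\nu$ is an odd negative integer: $s_{\mu,\nu}(\zeta)=\sum_{m\ge0}(-1)^m\zeta^{\mu+1+2m}/\prod_{k=0}^{m}[(\mu+2k+1)^2-\nu^2]$ and $S_{\mu,\nu}=s_{\mu,\nu}+K\big[J_\nu\sin\frac{(\mu-\nu)\pi}{2}-Y_\nu\cos\frac{(\mu-\nu)\pi}{2}\big]$, $K=2^{\mu-1}\Gamma(\frac{\mu-\nu+1}{2})\Gamma(\frac{\mu+\nu+1}{2})$. (ii) If $\mu=\nu-2p-1$ with $p$ a non-negative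 integer and $\nu\notin\{1,\dots,p\}$: $S_{\nu-2p-1,\nu}(\zeta)=\sum_{m=0}^{p-1}\frac{(-1)^m\zeta^{\nu-2p+2m}}{2^{2m+2}(-p)_{m+1}(\nu-p)_{m+1}}+\frac{(-1)^pS_{\nu-1,\nu}(\zeta)}{2^{2p}p!(1-\nu)_p}$, where: if $-\nu\notin\{0,1,2,\dots\}$, $S_{\nu-1,\nu}=\Gamma(\nu)\big[2^{\nu-1}J_\nu\log\zeta-2^{\nu-2}\pi Y_\nu-\frac{\zeta^\nu}{4}\sum_{m\ge0}\frac{(-1)^m(\zeta/2)^{2m}A(m)}{m!\Gamma(\nu+m+1)}\big]$, $A(m)=2\log2+\psi(\nu+m+1)+\psi(m+1)$; if $\nu=0$, $S_{-1,0}=\frac12\sum_{m\ge0}\frac{(-1)^m(\zeta/2)^{2m}}{(m!)^2}\{[\log\frac{\zeta}{2}-\psi(m+1)]^2-\frac12\psi'(m+1)+\frac{\pi^2}{4}\}$; if $\nu=-n$ ($n\ge1$ integer), $S_{-n-1,-n}=\frac{(-1)^n\zeta^n}{n!}\frac{d^n}{d(\zeta^2)^n}S_{-1,0}$. (iii) If $\mu+\nu$ is an odd negative integer and (ii) does not apply, $S_{\mu,\nu}:=S_{\mu,-\nu}$. $S_{\mu,\nu}(\mathrm{e}^z)$ denotes the entire function of $z$ obtained by analytic continuation of the chosen branch along $\zeta=\mathrm{e}^z$. The order of an entire $f$ is $\limsup_{r\to\infty}\frac{\log\log M(r,f)}{\log r}$, $M(r,f)=\max_{|z|\le r}|f(z)|$.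 *)

theory Defs
  imports "HOL-Analysis.Analysis"
begin

text \<open>All functions of \<zeta> are written as functions of z with \<zeta> = exp z, so that
  \<zeta>^a = exp (a z) and log \<zeta> = z; (\<zeta>/2)^a = exp (a (z - ln 2)), log(\<zeta>/2) = z - ln 2.
  The result is the entire function obtained by continuation along \<zeta> = e^z; other
  branches are the translates z + 2 \<pi> i k.\<close>

definition ln2c :: complex where "ln2c = of_real (ln 2)"

definition besselJ_exp :: "complex \<Rightarrow> complex \<Rightarrow> complex" where
  "besselJ_exp \<nu> z = (\<Sum>m. (-1)^m * exp ((\<nu> + 2 * of_nat m) * (z - ln2c))
        * rGamma (of_nat m + 1) * rGamma (\<nu> + of_nat m + 1))"

text \<open>Y_n(e^z) for integer n >= 0 (DLMF 10.8.1).\<close>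
definition besselY_nat_exp :: "nat \<Rightarrow> complex \<Rightarrow> complex" where
  "besselY_nat_exp n z =
     - exp (- of_nat n * (z - ln2c)) / of_real pi *
         (\<Sum>k<n. of_nat (fact (n - k - 1)) / of_nat (fact k) * exp (2 * of_nat k * (z - ln2c)))
     + 2 / of_real pi * (z - ln2c) * besselJ_exp (of_nat n) z
     - exp (of_nat n * (z - ln2c)) / of_real pi *
         (\<Sum>k. (Digamma (of_nat k + 1) + Digamma (of_nat (n + k) + 1)) * (-1)^k
                * exp (2 * of_nat k * (z - ln2c)) / (of_nat (fact k) * of_nat (fact (n + k))))"

definition besselY_exp :: "complex \<Rightarrow> complex \<Rightarrow> complex" where
  "besselY_exp \<nu> z =
     (if \<nu> \<in> \<int> then
        (let m = \<lfloor>Re \<nu>\<rfloor> in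
          if m \<ge> 0 then besselY_nat_exp (nat m) z
          else (-1) ^ nat (- m) * besselY_nat_exp (nat (- m)) z)
      else (besselJ_exp \<nu> z * cos (\<nu> * of_real pi) - besselJ_exp (- \<nu>) z) / sin (\<nu> * of_real pi))"

definition odd_neg_int :: "complex \<Rightarrow> bool" where
  "odd_neg_int x \<longleftrightarrow> (\<exists>p::nat. x = - (2 * of_nat p + 1))"

definition lommel_i :: "complex \<Rightarrow> complex \<Rightarrow> complex \<Rightarrow> complex" where
  "lommel_i \<mu> \<nu> z =
     (\<Sum>m. (-1)^m * exp ((\<mu> + 1 + 2 * of_nat m) * z)
            / (\<Prod>k\<in>{0..m}. (\<mu> + 2 * of_nat k + 1)^2 - \<nu>^2))
     + (2::complex) powr (\<mu> - 1) * Gamma ((\<mu> - \<nu> + 1) / 2) * Gamma ((\<mu> + \<nu> + 1) / 2)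
       * (besselJ_exp \<nu> z * sin ((\<mu> - \<nu>) * of_real pi / 2)
          - besselY_exp \<nu> z * cos ((\<mu> - \<nu>) * of_real pi / 2))"

definition lommel_m1_0 :: "complex \<Rightarrow> complex" where
  "lommel_m1_0 z = 1/2 * (\<Sum>m. (-1)^m * exp (2 * of_nat m * (z - ln2c)) / (of_nat (fact m))^2
       * ((z - ln2c - Digamma (of_nat m + 1))^2 - 1/2 * Polygamma 1 (of_nat m + 1)
          + (of_real pi)^2 / 4))"

text \<open>d/d(\<zeta>^2) expressed in the variable z (\<zeta>^2 = e^{2z}).\<close>
definition d_dzeta2 :: "(complex \<Rightarrow> complex) \<Rightarrow> complex \<Rightarrow> complex" where
  "d_dzeta2 f = (\<lambda>z. exp (- 2 * z) / 2 * deriv f z)"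

definition lommel_nu_m1 :: "complex \<Rightarrow> complex \<Rightarrow> complex" where
  "lommel_nu_m1 \<nu> z =
     (if \<not> (\<exists>n::nat. \<nu> = - of_nat n) then
        Gamma \<nu> * (2 powr (\<nu> - 1) * besselJ_exp \<nu> z * z
                   - 2 powr (\<nu> - 2) * of_real pi * besselY_exp \<nu> z
                   - exp (\<nu> * z) / 4 *
                     (\<Sum>m. (-1)^m * exp (2 * of_nat m * (z - ln2c))
                        * (2 * ln2c + Digamma (\<nu> + of_nat m + 1) + Digamma (of_nat m + 1))
                        / of_nat (fact m) * rGamma (\<nu> + of_nat m + 1)))
      else (let n = (THE n::nat. \<nu> = - of_nat n) in
        (-1)^n * exp (of_nat n * z) / of_nat (fact n) * (d_dzeta2 ^^ n) lommel_m1_0 z))"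

definition lommel_ii :: "complex \<Rightarrow> nat \<Rightarrow> complex \<Rightarrow> complex" where
  "lommel_ii \<nu> p z =
     (\<Sum>m<p. (-1)^m * exp ((\<nu> - 2 * of_nat p + 2 * of_nat m) * z)
        / (2^(2*m+2) * pochhammer (- of_nat p) (m+1) * pochhammer (\<nu> - of_nat p) (m+1)))
     + (-1)^p * lommel_nu_m1 \<nu> z / (2^(2*p) * of_nat (fact p) * pochhammer (1 - \<nu>) p)"

definition case_ii :: "complex \<Rightarrow> complex \<Rightarrow> nat \<Rightarrow> bool" where
  "case_ii \<mu> \<nu> p \<longleftrightarrow> \<mu> = \<nu> - 2 * of_nat p - 1 \<and> \<nu> \<notin> {of_nat j | j. 1 \<le> j \<and> j \<le> p}"

definition lommelS_exp :: "complex \<Rightarrow> complex \<Rightarrow> complex \<Rightarrow> complex" where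
  "lommelS_exp \<mu> \<nu> z =
     (if \<not> odd_neg_int (\<mu> + \<nu>) \<and> \<not> odd_neg_int (\<mu> - \<nu>) then lommel_i \<mu> \<nu> z
      else if \<exists>p. case_ii \<mu> \<nu> p then lommel_ii \<nu> (THE p. case_ii \<mu> \<nu> p) z
      else lommel_ii (- \<nu>) (THE p. case_ii \<mu> (- \<nu>) p) z)"

text \<open>Maximum modulus and order of an entire function.  M is replaced by max M e
  inside ln ln to avoid junk values for bounded functions (order 0 then, as usual);
  this does not affect the limsup when M is unbounded.\<close>
definition max_modulus :: "(complex \<Rightarrow> complex) \<Rightarrow> real \<Rightarrow> real" where
  "max_modulus f r = Sup ((\<lambda>z. norm (f z)) ` cball 0 r)"

definition entire_order :: "(complex \<Rightarrow> complex) \<Rightarrow> ereal" where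
  "entire_order f = Limsup at_top (\<lambda>r::real. ereal (ln (ln (max (max_modulus f r) (exp 1))) / ln r))"

end

theory Submission
  imports Defs "HOL-Complex_Analysis.Complex_Analysis" "HOL-Real_Asymp.Real_Asymp"
begin

text \<open>
  With \<open>\<zeta> = e\<^sup>z\<close>, every branch of the Lommel function is an entire solution \<open>f\<close> of
  \<open>f'' + (e\<^sup>2\<^sup>z - \<nu>\<^sup>2) f = e\<^bsup>(\<mu>+1)z\<^esup>\<close>. This equation is invariant under
  \<open>z \<mapsto> z + \<pi>i\<close> up to the factor \<open>e\<^bsup>(\<mu>+1)\<pi>i\<^esup>\<close> on the right.
  If \<open>g\<close> is a solution of finite growth that is multiplied by \<open>e\<^bsup>a\<pi>i\<^esup>\<close> under the shift, the
  coefficients \<open>A\<^sub>n\<close> of \<open>g = \<Sum> A\<^sub>n e\<^bsup>(a+2n)z\<^esup>\<close> satisfy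
  \<open>((a + 2n)\<^sup>2 - \<nu>\<^sup>2) A\<^sub>n + A\<^sub>n\<^sub>-\<^sub>1 = 0\<close>, apart from the inhomogeneity at \<open>n = 0\<close>. Finite
  growth makes \<open>A\<^sub>n\<close> decay faster for \<open>n \<rightarrow> \<infinity>\<close> than the recurrence allows unless \<open>A\<^sub>n\<close>
  vanishes; hence the homogeneous equation has no nonzero solution of finite growth, every
  solution of finite growth is itself multiplied by \<open>e\<^bsup>(\<mu>+1)\<pi>i\<^esup>\<close> under the shift, and
  its coefficients vanish for \<open>n \<ge> 0\<close> while \<open>A\<^sub>-\<^sub>1 \<noteq> 0\<close>. For \<open>n \<rightarrow> -\<infinity>\<close> the recurrence is
  unbounded unless it terminates, that is \<open>(\<mu> + 1 + 2n)\<^sup>2 = \<nu>\<^sup>2\<close> for some \<open>n < 0\<close>, which says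
  that \<open>\<mu> + \<nu>\<close> or \<open>\<mu> - \<nu>\<close> is a positive odd integer.
\<close>

section \<open>Exponential series\<close>

text \<open>Finite order enters as a bound \<open>exp (K * (1 + |z|) ^ N)\<close>. Integration over
  a period on the line Re z = x gives |A_n| <= exp (K' (1 + x)^N - 2 n x) for every x >= 0, with
  constants independent of n and x. Upwards the recurrence yields |A_m| <= (B + 2k)^(2k) |A_(m+k)|;
  the choice x = 2 ln (B + 2k) makes the bound decay like the inverse square of that product, up to
  the exponential of a power of ln k. Downwards x = 0 is enough, since a nonzero coefficient would
  grow geometrically.

  The obstacle is that a solution need not be multiplied by a constant under the shift. The
  homogeneous solutions form a space of dimension 2, so the span of g and its shift contains an
  eigenvector, with a multiplier about which nothing is known; hence the recurrence is treated for
  arbitrary a. The function f(z + \<pi>i) - e^((\<mu>+1)\<pi>i) f(z) then solves the homogeneous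
  equation.

  For the closed form the equation is not enough, since it does not single out S among its
  solutions: every defining formula has to be evaluated at the level of coefficients.\<close>

definition entire_coeffs :: "(nat \<Rightarrow> complex) \<Rightarrow> bool" where
  "entire_coeffs a \<longleftrightarrow> (\<forall>w. summable (\<lambda>m. a m * w ^ m))"

text \<open>A Frobenius series \<zeta>^s P(\<zeta>^2) in the variable z;
  \<open>entire_coeffs\<close> says that P is entire, so it can be evaluated at every \<zeta>^2 =
  e^(2z) and differentiated termwise.\<close>

definition exp_series :: "complex \<Rightarrow> (nat \<Rightarrow> complex) \<Rightarrow> complex \<Rightarrow> complex" where
  "exp_series s a z = (\<Sum>m. a m * exp ((s + 2 * of_nat m) * z))"

lemma exp_series_term:
  fixes a :: "nat \<Rightarrow> complex"
  shows "a m * exp ((s + 2 * of_nat m) * z) = exp (s * z) * (a m * exp (2 * z) ^ m)"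
proof -
  have "exp ((s + 2 * of_nat m) * z) = exp (s * z + of_nat m * (2 * z))"
    by (simp add: algebra_simps)
  also have "\<dots> = exp (s * z) * exp (2 * z) ^ m"
    by (simp only: exp_add exp_of_nat_mult)
  finally show ?thesis by simp
qed

lemma summable_exp_series:
  "entire_coeffs a \<Longrightarrow> summable (\<lambda>m. a m * exp ((s + 2 * of_nat m) * z))"
  unfolding exp_series_term by (intro summable_mult) (simp add: entire_coeffs_def)

lemma exp_series_eq:
  "entire_coeffs a \<Longrightarrow> exp_series s a z = exp (s * z) * (\<Sum>m. a m * exp (2 * z) ^ m)"
  unfolding exp_series_def exp_series_term by (intro suminf_mult) (simp add: entire_coeffs_def)

lemma entire_coeffs_add:
  "entire_coeffs a \<Longrightarrow> entire_coeffs b \<Longrightarrow> entire_coeffs (\<lambda>m. a m + b m)"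
  unfolding entire_coeffs_def by (auto simp: ring_distribs intro: summable_add)

lemma entire_coeffs_cmult: "entire_coeffs a \<Longrightarrow> entire_coeffs (\<lambda>m. c * a m)"
  unfolding entire_coeffs_def by (auto simp: mult.assoc intro: summable_mult)

lemma entire_coeffs_0 [simp]: "entire_coeffs (\<lambda>m. 0)"
  by (simp add: entire_coeffs_def)

lemma entire_coeffs_of_nat_mult: "entire_coeffs a \<Longrightarrow> entire_coeffs (\<lambda>m. of_nat m * a m)"
proof -
  assume a: "entire_coeffs a"
  have "summable (\<lambda>m. of_nat m * a m * w ^ m)" for w
  proof -
    have "summable (\<lambda>m. diffs a m * w ^ m)"
      using a unfolding entire_coeffs_def by (intro termdiff_converges_all) auto
    hence "summable (\<lambda>m. w * (diffs a m * w ^ m))" by (rule summable_mult)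
    hence "summable (\<lambda>m. of_nat (Suc m) * a (Suc m) * w ^ Suc m)"
      by (simp add: diffs_def algebra_simps)
    thus ?thesis by (subst (asm) summable_Suc_iff)
  qed
  thus ?thesis by (simp add: entire_coeffs_def)
qed

lemma entire_coeffs_affine_mult:
  assumes "entire_coeffs a"
  shows "entire_coeffs (\<lambda>m. (s + 2 * of_nat m) * a m)"
proof -
  have "entire_coeffs (\<lambda>m. s * a m + 2 * (of_nat m * a m))"
    by (intro entire_coeffs_add entire_coeffs_cmult entire_coeffs_of_nat_mult assms)
  thus ?thesis by (simp add: algebra_simps)
qed

lemma entire_coeffs_shift:
  assumes "entire_coeffs a"
  shows "entire_coeffs (\<lambda>m. if m = 0 then 0 else a (m - 1))"
  unfolding entire_coeffs_def
proof
  fix w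
  have "summable (\<lambda>m. w * (a m * w ^ m))"
    using assms by (intro summable_mult) (auto simp: entire_coeffs_def)
  hence "summable (\<lambda>m. (if Suc m = 0 then 0 else a (Suc m - 1)) * w ^ Suc m)"
    by (simp add: algebra_simps)
  thus "summable (\<lambda>m. (if m = 0 then 0 else a (m - 1)) * w ^ m)"
    by (subst (asm) summable_Suc_iff)
qed

lemma exp_series_add:
  "entire_coeffs a \<Longrightarrow> entire_coeffs b \<Longrightarrow>
    exp_series s a z + exp_series s b z = exp_series s (\<lambda>m. a m + b m) z"
  unfolding exp_series_def using suminf_add [OF summable_exp_series summable_exp_series, of a b s z s z]
  by (simp add: distrib_right)

lemma exp_series_cmult:
  "entire_coeffs a \<Longrightarrow> c * exp_series s a z = exp_series s (\<lambda>m. c * a m) z"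
  unfolding exp_series_def by (subst suminf_mult [symmetric]) (auto intro: summable_exp_series simp: mult.assoc)

lemma exp_series_shift:
  assumes "entire_coeffs a"
  shows "exp (2 * z) * exp_series s a z = exp_series s (\<lambda>m. if m = 0 then 0 else a (m - 1)) z"
proof -
  have "exp_series s (\<lambda>m. if m = 0 then 0 else a (m - 1)) z
      = (\<Sum>m. a m * exp ((s + 2 * of_nat (Suc m)) * z))"
    using suminf_split_head [OF summable_exp_series [OF entire_coeffs_shift [OF assms], of s z]]
    unfolding exp_series_def by simp
  also have "\<dots> = (\<Sum>m. exp (2 * z) * (a m * exp ((s + 2 * of_nat m) * z)))"
    by (intro suminf_cong) (simp add: exp_add [symmetric] algebra_simps)
  also have "\<dots> = exp (2 * z) * exp_series s a z"
    unfolding exp_series_def by (rule suminf_mult [OF summable_exp_series [OF assms]])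
  finally show ?thesis by simp
qed

lemma exp_series_single:
  "exp_series s (\<lambda>m. if m = j then d else 0) z = d * exp ((s + 2 * of_nat j) * z)"
proof -
  have "(\<lambda>m. (if m = j then d else 0) * exp ((s + 2 * of_nat m) * z)) =
     (\<lambda>m. if m = j then d * exp ((s + 2 * of_nat m) * z) else 0)" by auto
  thus ?thesis
    using sums_unique [OF sums_single [of j "\<lambda>m. d * exp ((s + 2 * of_nat m) * z)"]]
    unfolding exp_series_def by simp
qed

lemma has_field_derivative_exp_series:
  assumes "entire_coeffs a"
  shows "(exp_series s a has_field_derivative exp_series s (\<lambda>m. (s + 2 * of_nat m) * a m) z) (at z)"
proof -
  define P where "P = (\<lambda>w. \<Sum>m. a m * w ^ m)"
  define Q where "Q = (\<lambda>w. \<Sum>m. diffs a m * w ^ m)"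
  have sum: "summable (\<lambda>m. a m * w ^ m)" for w using assms by (simp add: entire_coeffs_def)
  have P: "(P has_field_derivative Q w) (at w)" for w
    unfolding P_def Q_def by (rule termdiffs_strong_converges_everywhere [OF sum])
  have sd: "summable (\<lambda>m. diffs a m * w ^ m)" for w
    by (rule termdiff_converges_all [OF sum])
  have Q: "w * Q w = (\<Sum>m. of_nat m * a m * w ^ m)" for w
  proof -
    have "w * Q w = (\<Sum>m. w * (diffs a m * w ^ m))"
      unfolding Q_def by (rule suminf_mult [OF sd, symmetric])
    also have "\<dots> = (\<Sum>m. of_nat (Suc m) * a (Suc m) * w ^ Suc m)"
      by (simp add: diffs_def algebra_simps)
    also have "\<dots> = (\<Sum>m. of_nat m * a m * w ^ m)"
      using entire_coeffs_of_nat_mult [OF assms] unfolding entire_coeffs_def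
      by (subst suminf_split_head) auto
    finally show ?thesis .
  qed
  have e: "exp_series s a = (\<lambda>z. exp (s * z) * P (exp (2 * z)))"
    by (rule ext) (simp add: exp_series_eq assms P_def)
  have "((\<lambda>z. exp (s * z) * P (exp (2 * z))) has_field_derivative
      (s * (exp (s * z) * P (exp (2 * z))) + 2 * (exp (s * z) * (exp (2 * z) * Q (exp (2 * z)))))) (at z)"
    by (auto intro!: derivative_eq_intros DERIV_chain2 [OF P] simp: algebra_simps)
  also have "(s * (exp (s * z) * P (exp (2 * z))) + 2 * (exp (s * z) * (exp (2 * z) * Q (exp (2 * z)))))
     = s * exp_series s a z + 2 * exp_series s (\<lambda>m. of_nat m * a m) z"
    unfolding Q by (simp add: exp_series_eq assms entire_coeffs_of_nat_mult P_def)
  also have "\<dots> = exp_series s (\<lambda>m. (s + 2 * of_nat m) * a m) z"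
    by (simp add: exp_series_cmult exp_series_add assms entire_coeffs_of_nat_mult entire_coeffs_cmult
       entire_coeffs_add distrib_right mult.assoc)
  finally show ?thesis by (simp add: e)
qed

text \<open>The parameter \<open>q\<close> is 1 in the variable \<open>z\<close> and 4 in the variable \<open>z - ln 2\<close>.\<close>
definition bessel_sol :: "complex \<Rightarrow> complex \<Rightarrow> (complex \<Rightarrow> complex) \<Rightarrow> (complex \<Rightarrow> complex) \<Rightarrow> bool" where
  "bessel_sol q \<nu> f g \<longleftrightarrow> (\<exists>f1 f2. (\<forall>z. (f has_field_derivative f1 z) (at z)) \<and>
      (\<forall>z. (f1 has_field_derivative f2 z) (at z)) \<and>
      (\<forall>z. f2 z + (q * exp (2 * z) - \<nu>\<^sup>2) * f z = g z))"

lemma bessel_solI: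
  assumes "\<And>z. (f has_field_derivative f1 z) (at z)" "\<And>z. (f1 has_field_derivative f2 z) (at z)"
    and "\<And>z. f2 z + (q * exp (2 * z) - \<nu>\<^sup>2) * f z = g z"
  shows "bessel_sol q \<nu> f g"
  using assms unfolding bessel_sol_def by blast

lemma bessel_solE:
  assumes "bessel_sol q \<nu> f g"
  obtains f1 f2 where "\<And>z. (f has_field_derivative f1 z) (at z)"
    "\<And>z. (f1 has_field_derivative f2 z) (at z)"
    "\<And>z. f2 z + (q * exp (2 * z) - \<nu>\<^sup>2) * f z = g z"
  using assms unfolding bessel_sol_def by blast

lemma bessel_sol_cong: "bessel_sol q \<nu> f g \<Longrightarrow> (\<And>z. g z = g' z) \<Longrightarrow> bessel_sol q \<nu> f g'"
  by (simp add: bessel_sol_def)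

lemma bessel_sol_add:
  assumes "bessel_sol q \<nu> f g" "bessel_sol q \<nu> f' g'"
  shows "bessel_sol q \<nu> (\<lambda>z. f z + f' z) (\<lambda>z. g z + g' z)"
proof -
  obtain f1 f2 f1' f2' where *:
    "\<And>z. (f has_field_derivative f1 z) (at z)" "\<And>z. (f1 has_field_derivative f2 z) (at z)"
    "\<And>z. f2 z + (q * exp (2 * z) - \<nu>\<^sup>2) * f z = g z"
    "\<And>z. (f' has_field_derivative f1' z) (at z)" "\<And>z. (f1' has_field_derivative f2' z) (at z)"
    "\<And>z. f2' z + (q * exp (2 * z) - \<nu>\<^sup>2) * f' z = g' z"
    using assms unfolding bessel_sol_def by metis
  show ?thesis
    by (rule bessel_solI [of _ "\<lambda>z. f1 z + f1' z" "\<lambda>z. f2 z + f2' z"])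
       (rule DERIV_add * | simp add: *(3,6) [symmetric] algebra_simps)+
qed

lemma bessel_sol_cmult:
  assumes "bessel_sol q \<nu> f g"
  shows "bessel_sol q \<nu> (\<lambda>z. c * f z) (\<lambda>z. c * g z)"
proof -
  obtain f1 f2 where *:
    "\<And>z. (f has_field_derivative f1 z) (at z)" "\<And>z. (f1 has_field_derivative f2 z) (at z)"
    "\<And>z. f2 z + (q * exp (2 * z) - \<nu>\<^sup>2) * f z = g z"
    using assms unfolding bessel_sol_def by metis
  show ?thesis
    by (rule bessel_solI [of _ "\<lambda>z. c * f1 z" "\<lambda>z. c * f2 z"])
       (auto intro!: DERIV_cmult *(1,2) simp: *(3) [symmetric] algebra_simps)
qed

lemma bessel_sol_shift:
  assumes "bessel_sol q \<nu> f g"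
  shows "bessel_sol (q * exp (2 * c)) \<nu> (\<lambda>z. f (z + c)) (\<lambda>z. g (z + c))"
proof -
  obtain f1 f2 where *:
    "\<And>z. (f has_field_derivative f1 z) (at z)" "\<And>z. (f1 has_field_derivative f2 z) (at z)"
    "\<And>z. f2 z + (q * exp (2 * z) - \<nu>\<^sup>2) * f z = g z"
    using assms unfolding bessel_sol_def by metis
  show ?thesis
    by (rule bessel_solI [of _ "\<lambda>z. f1 (z + c)" "\<lambda>z. f2 (z + c)"])
       (rule DERIV_shift [THEN iffD1] * | simp add: *(3) [symmetric] algebra_simps exp_add)+
qed

lemma exp_ln2c: "exp (2 * ln2c) = 4" "exp (ln2c) = 2"
proof -
  show *: "exp (ln2c) = 2" unfolding ln2c_def by (simp add: exp_of_real)
  have "exp (2 * ln2c) = exp ln2c ^ 2" by (simp add: exp_double)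
  thus "exp (2 * ln2c) = 4" by (simp add: *)
qed

lemma bessel_sol_unscale:
  assumes "bessel_sol 4 \<nu> f g"
  shows "bessel_sol 1 \<nu> (\<lambda>z. f (z - ln2c)) (\<lambda>z. g (z - ln2c))"
  using bessel_sol_shift [OF assms, of "- ln2c"] by (simp add: exp_minus exp_ln2c)

text \<open>Coefficient of e^((s + 2m) z) in f'' + (q e^(2z) - \<nu>^2) f for f =
  \<open>exp_series s a\<close>. Multiplication by e^(2z) moves coefficients up by one index, so
  index 0 receives nothing from it.\<close>

definition ode_coeff :: "complex \<Rightarrow> complex \<Rightarrow> complex \<Rightarrow> (nat \<Rightarrow> complex) \<Rightarrow> nat \<Rightarrow> complex" where
  "ode_coeff q \<nu> s a m = ((s + 2 * of_nat m)\<^sup>2 - \<nu>\<^sup>2) * a m + q * (if m = 0 then 0 else a (m - 1))"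

lemma exp_series_ode:
  assumes "entire_coeffs a"
  shows "exp_series s (\<lambda>m. (s + 2 * of_nat m) * ((s + 2 * of_nat m) * a m)) z
     + (q * exp (2 * z) - \<nu>\<^sup>2) * exp_series s a z = exp_series s (ode_coeff q \<nu> s a) z"
    and "entire_coeffs (ode_coeff q \<nu> s a)"
proof -
  have eq: "ode_coeff q \<nu> s a = (\<lambda>m. ((s + 2 * of_nat m) * ((s + 2 * of_nat m) * a m) +
      q * (if m = 0 then 0 else a (m - 1))) + (- \<nu>\<^sup>2) * a m)"
    by (auto simp: ode_coeff_def fun_eq_iff algebra_simps power2_eq_square)
  show "entire_coeffs (ode_coeff q \<nu> s a)" unfolding eq
    by (intro entire_coeffs_add entire_coeffs_cmult entire_coeffs_affine_mult entire_coeffs_shift assms)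
  have "(q * exp (2 * z) - \<nu>\<^sup>2) * exp_series s a z =
     q * (exp (2 * z) * exp_series s a z) + (- \<nu>\<^sup>2) * exp_series s a z"
    by (simp add: algebra_simps)
  also have "\<dots> = exp_series s (\<lambda>m. q * (if m = 0 then 0 else a (m - 1))) z +
     exp_series s (\<lambda>m. (- \<nu>\<^sup>2) * a m) z"
    by (simp only: exp_series_shift [OF assms] exp_series_cmult assms entire_coeffs_shift)
  finally show "exp_series s (\<lambda>m. (s + 2 * of_nat m) * ((s + 2 * of_nat m) * a m)) z
     + (q * exp (2 * z) - \<nu>\<^sup>2) * exp_series s a z = exp_series s (ode_coeff q \<nu> s a) z"
    unfolding eq
    by (simp only: exp_series_add [symmetric] entire_coeffs_add entire_coeffs_cmult
        entire_coeffs_affine_mult entire_coeffs_shift assms add.assoc)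
qed

text \<open>Frobenius' method with logarithms, z being log \<zeta>. Apply the operator to z^2 A + z
  B + C and compare powers of z: the product rule feeds 4A' into the coefficient of z and 2A + 2B'
  into the one free of z. The squared logarithm is there for \<open>lommel_m1_0\<close>.\<close>

lemma bessel_sol_log_series:
  assumes a: "entire_coeffs a" and b: "entire_coeffs b" and c: "entire_coeffs c"
    and 1: "\<And>m. ode_coeff q \<nu> s a m = 0"
    and 2: "\<And>m. 4 * ((s + 2 * of_nat m) * a m) + ode_coeff q \<nu> s b m = 0"
    and 3: "\<And>m. 2 * a m + 2 * ((s + 2 * of_nat m) * b m) + ode_coeff q \<nu> s c m = (if m = j then d else 0)"
  shows "bessel_sol q \<nu> (\<lambda>z. z\<^sup>2 * exp_series s a z + z * exp_series s b z + exp_series s c z)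
     (\<lambda>z. d * exp ((s + 2 * of_nat j) * z))"
proof -
  define D where "D = (\<lambda>a m. (s + 2 * of_nat m) * a m :: complex)"
  have D: "entire_coeffs a \<Longrightarrow> entire_coeffs (D a)" for a
    unfolding D_def by (rule entire_coeffs_affine_mult)
  have der: "entire_coeffs a \<Longrightarrow> (exp_series s a has_field_derivative exp_series s (D a) z) (at z)" for a z
    unfolding D_def by (rule has_field_derivative_exp_series)
  note der' = der [THEN DERIV_chain2]
  let ?E = "exp_series s"
  have ode: "entire_coeffs a \<Longrightarrow> ?E (D (D a)) z + (q * exp (2 * z) - \<nu>\<^sup>2) * ?E a z
      = ?E (ode_coeff q \<nu> s a) z" for a z
    using exp_series_ode(1) [of a s z q \<nu>] by (simp add: D_def)
  have r1: "?E (ode_coeff q \<nu> s a) z = 0" for z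
    using 1 by (simp add: exp_series_def)
  have r2: "4 * ?E (D a) z + ?E (ode_coeff q \<nu> s b) z = 0" for z
  proof -
    have "4 * ?E (D a) z + ?E (ode_coeff q \<nu> s b) z = ?E (\<lambda>m. 4 * D a m + ode_coeff q \<nu> s b m) z"
      by (simp add: exp_series_cmult exp_series_add D a b exp_series_ode entire_coeffs_cmult)
    thus ?thesis using 2 by (simp add: D_def exp_series_def)
  qed
  have r3: "2 * ?E a z + 2 * ?E (D b) z + ?E (ode_coeff q \<nu> s c) z = d * exp ((s + 2 * of_nat j) * z)" for z
  proof -
    have "2 * ?E a z + 2 * ?E (D b) z + ?E (ode_coeff q \<nu> s c) z
       = ?E (\<lambda>m. 2 * a m + 2 * D b m + ode_coeff q \<nu> s c m) z"
      by (simp add: exp_series_cmult exp_series_add D a b c exp_series_ode entire_coeffs_cmult entire_coeffs_add)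
    thus ?thesis using 3 by (simp add: D_def exp_series_single)
  qed
  let ?f1 = "\<lambda>z. 2 * (z * ?E a z) + z\<^sup>2 * ?E (D a) z + ?E b z + z * ?E (D b) z + ?E (D c) z"
  let ?f2 = "\<lambda>z. 2 * ?E a z + 4 * (z * ?E (D a) z) + z\<^sup>2 * ?E (D (D a)) z + 2 * ?E (D b) z
     + z * ?E (D (D b)) z + ?E (D (D c)) z"
  show ?thesis
  proof (rule bessel_solI [of _ ?f1 ?f2])
    fix z
    show "((\<lambda>z. z\<^sup>2 * ?E a z + z * ?E b z + ?E c z) has_field_derivative ?f1 z) (at z)"
      by (rule derivative_eq_intros der' a b c refl D | simp add: algebra_simps power2_eq_square)+
    show "(?f1 has_field_derivative ?f2 z) (at z)"
      by (rule derivative_eq_intros der' a b c refl D | simp add: algebra_simps power2_eq_square)+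
    have "?f2 z + (q * exp (2 * z) - \<nu>\<^sup>2) * (z\<^sup>2 * ?E a z + z * ?E b z + ?E c z)
      = z\<^sup>2 * (?E (D (D a)) z + (q * exp (2 * z) - \<nu>\<^sup>2) * ?E a z)
        + z * (4 * ?E (D a) z + (?E (D (D b)) z + (q * exp (2 * z) - \<nu>\<^sup>2) * ?E b z))
        + (2 * ?E a z + 2 * ?E (D b) z + (?E (D (D c)) z + (q * exp (2 * z) - \<nu>\<^sup>2) * ?E c z))"
      by (simp add: algebra_simps)
    also have "\<dots> = d * exp ((s + 2 * of_nat j) * z)"
      by (simp only: ode a b c r1 r2 r3) simp
    finally show "?f2 z + (q * exp (2 * z) - \<nu>\<^sup>2) * (z\<^sup>2 * ?E a z + z * ?E b z + ?E c z)
      = d * exp ((s + 2 * of_nat j) * z)" .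
  qed
qed

section \<open>Bessel functions\<close>

text \<open>The ratio test without division, so that coefficients may vanish, as those of finite
  sums do.\<close>

lemma entire_coeffs_ratio:
  fixes a :: "nat \<Rightarrow> complex"
  assumes "\<And>m. m \<ge> N \<Longrightarrow> norm (a (Suc m)) * (of_nat m + 1) \<le> norm (a m)"
  shows "entire_coeffs a"
  unfolding entire_coeffs_def
proof
  fix w :: complex
  obtain M :: nat where M: "of_nat M \<ge> 2 * norm w" using real_arch_simple by blast
  show "summable (\<lambda>m. a m * w ^ m)"
  proof (rule summable_ratio_test [of "1/2" "max M N"])
    fix m assume m: "max M N \<le> m"
    have 1: "2 * norm w \<le> of_nat m + 1" using m M by linarith
    have "norm (a (Suc m)) * (2 * norm w) \<le> norm (a (Suc m)) * (of_nat m + 1)"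
      by (rule mult_left_mono [OF 1]) simp
    also have "\<dots> \<le> norm (a m)" using assms m by simp
    finally have "norm (a (Suc m)) * (2 * norm w) * norm (w ^ m) \<le> norm (a m) * norm (w ^ m)"
      by (rule mult_right_mono) simp
    thus "norm (a (Suc m) * w ^ Suc m) \<le> 1 / 2 * norm (a m * w ^ m)"
      by (simp add: norm_mult)
  qed simp
qed

text \<open>The factor is absorbed by termwise differentiation: \<open>(m + 1) * a m\<close> again
  belongs to an entire function. This admits the digamma factors of the logarithmic
  solutions.\<close>

lemma entire_coeffs_mult_linear:
  assumes "entire_coeffs a" and b: "\<And>m. norm (b m) \<le> C * (of_nat m + 1)"
  shows "entire_coeffs (\<lambda>m. b m * a m)"
  unfolding entire_coeffs_def
proof
  fix w :: complex
  define c where "c = (\<lambda>m. of_nat m * a m + a m)"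
  have c: "entire_coeffs c"
    unfolding c_def by (intro entire_coeffs_add entire_coeffs_of_nat_mult assms)
  have "summable (\<lambda>m. norm (c m * w ^ m))"
  proof (rule powser_insidea)
    \<comment> \<open>Convergence at the larger radius |w| + 1 yields absolute convergence at
      w.\<close>
    show "summable (\<lambda>m. c m * of_real (norm w + 1) ^ m)"
      using c unfolding entire_coeffs_def by blast
  qed (simp del: of_real_add)
  hence s: "summable (\<lambda>m. C * norm (c m * w ^ m))" by (rule summable_mult)
  show "summable (\<lambda>m. b m * a m * w ^ m)"
  proof (rule summable_comparison_test' [OF s, of 0])
    fix m :: nat
    have "norm (c m) = (of_nat m + 1) * norm (a m)"
    proof -
      have "c m = of_real (of_nat m + 1) * a m" by (simp add: c_def algebra_simps)
      thus ?thesis by (simp only: norm_mult norm_of_real)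
    qed
    moreover have "norm (b m) * norm (a m * w ^ m) \<le> (C * (of_nat m + 1)) * norm (a m * w ^ m)"
      by (rule mult_right_mono [OF b]) simp
    ultimately show "norm (b m * a m * w ^ m) \<le> C * norm (c m * w ^ m)"
      by (simp add: norm_mult mult_ac)
  qed
qed

lemma linear_bound_of_bounded_diff:
  fixes b :: "nat \<Rightarrow> complex"
  assumes "\<And>m. norm (b (Suc m) - b m) \<le> C"
  shows "\<exists>C. \<forall>m. norm (b m) \<le> C * (of_nat m + 1)"
proof (intro exI allI)
  have C: "C \<ge> 0" using assms [of 0] norm_ge_zero order_trans by blast
  fix m
  show "norm (b m) \<le> (C + norm (b 0)) * (of_nat m + 1)"
  proof (induction m)
    case (Suc m)
    have "norm (b (Suc m)) \<le> norm (b m) + norm (b (Suc m) - b m)"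
      using norm_triangle_ineq [of "b m" "b (Suc m) - b m"] by simp
    also have "\<dots> \<le> (C + norm (b 0)) * (of_nat m + 1) + (C + norm (b 0))"
      using Suc assms [of m] norm_ge_zero [of "b 0"] by linarith
    finally show ?case by (simp add: algebra_simps)
  qed (use C in simp)
qed

lemma bounded_inverse_shift: "\<exists>C. \<forall>m. norm (1 / (s + of_nat m) :: complex) \<le> C"
proof -
  have "filterlim (\<lambda>m. s + of_nat m :: complex) at_infinity sequentially"
    by (intro tendsto_add_filterlim_at_infinity [OF tendsto_const] tendsto_of_nat)
  hence "(\<lambda>m. 1 / (s + of_nat m) :: complex) \<longlonglongrightarrow> 0"
    by (intro tendsto_divide_0 [OF tendsto_const])
  hence "Bseq (\<lambda>m. 1 / (s + of_nat m) :: complex)"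
    by (intro convergent_imp_Bseq convergentI)
  thus ?thesis by (auto simp: Bseq_def)
qed

text \<open>The increments 1/(s + m) are bounded, hence the growth is at most linear: crude, but
  harmless against the factorial decay of the coefficients.\<close>

lemma Digamma_linear_bound:
  fixes s :: complex
  assumes "\<And>m::nat. s + of_nat m \<noteq> 0"
  shows "\<exists>C. \<forall>m. norm (Digamma (s + of_nat m)) \<le> C * (of_nat m + 1)"
proof -
  obtain C where C: "\<And>m. norm (1 / (s + of_nat m)) \<le> C" using bounded_inverse_shift [of s] by blast
  have "Digamma (s + of_nat (Suc m)) - Digamma (s + of_nat m) = 1 / (s + of_nat m)" for m
    using Digamma_plus1 [OF assms, of m] by (simp add: add_ac)
  thus ?thesis using C by (intro linear_bound_of_bounded_diff [of _ C]) simp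
qed

lemma Trigamma_linear_bound:
  fixes s :: complex
  assumes "\<And>m::nat. s + of_nat m \<noteq> 0"
  shows "\<exists>C. \<forall>m. norm (Polygamma 1 (s + of_nat m)) \<le> C * (of_nat m + 1)"
proof -
  obtain C where C: "\<And>m. norm (1 / (s + of_nat m)) \<le> C" using bounded_inverse_shift [of s] by blast
  have e: "Polygamma 1 (s + of_nat (Suc m)) - Polygamma 1 (s + of_nat m) = - ((1 / (s + of_nat m)) ^ 2)" for m
    using Polygamma_plus1 [OF assms, of 1 m] by (simp add: add_ac power2_eq_square)
  have "norm (Polygamma 1 (s + of_nat (Suc m)) - Polygamma 1 (s + of_nat m)) \<le> C ^ 2" for m
    unfolding e by (simp only: norm_minus_cancel norm_power) (rule power_mono [OF C norm_ge_zero])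
  thus ?thesis by (rule linear_bound_of_bounded_diff)
qed

text \<open>Coefficients of J in powers of \<zeta>/2 = e^(z - ln 2), whence q = 4 in its equation.
  The reciprocal Gamma function is entire, so no \<nu> is excluded.\<close>

definition bessel_coeff :: "complex \<Rightarrow> nat \<Rightarrow> complex" where
  "bessel_coeff \<nu> m = (-1) ^ m * rGamma (of_nat m + 1) * rGamma (\<nu> + of_nat m + 1)"

lemma bessel_coeff_Suc:
  "of_nat (Suc m) * (\<nu> + of_nat (Suc m)) * bessel_coeff \<nu> (Suc m) = - bessel_coeff \<nu> m"
proof -
  have 1: "rGamma (of_nat m + 1 :: complex) = of_nat (Suc m) * rGamma (of_nat (Suc m) + 1)"
    using rGamma_plus1 [of "of_nat m + 1 :: complex"] by (simp add: add_ac)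
  have 2: "rGamma (\<nu> + of_nat m + 1) = (\<nu> + of_nat (Suc m)) * rGamma (\<nu> + of_nat (Suc m) + 1)"
    using rGamma_plus1 [of "\<nu> + of_nat m + 1"] by (simp add: add_ac)
  show ?thesis unfolding bessel_coeff_def 1 2 by (simp del: of_nat_Suc)
qed

text \<open>From index |\<nu>| on, the factor \<nu> + m + 1 of the recurrence has modulus at least
  1, and the other factor m + 1 is what the ratio criterion asks for.\<close>

lemma entire_bessel_coeff: "entire_coeffs (bessel_coeff \<nu>)"
proof (rule entire_coeffs_ratio)
  fix m assume m: "m \<ge> nat \<lceil>norm \<nu>\<rceil>"
  have "norm \<nu> \<le> of_nat m" using m by linarith
  moreover have "of_nat (Suc m) \<le> norm (\<nu> + of_nat (Suc m)) + norm \<nu>"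
    using norm_triangle_ineq4 [of "\<nu> + of_nat (Suc m)" \<nu>] by (simp del: of_nat_Suc)
  ultimately have 1: "1 \<le> norm (\<nu> + of_nat (Suc m))" by simp
  have "norm (bessel_coeff \<nu> (Suc m)) * (of_nat m + 1) * 1
      \<le> norm (bessel_coeff \<nu> (Suc m)) * (of_nat m + 1) * norm (\<nu> + of_nat (Suc m))"
    by (rule mult_left_mono [OF 1]) simp
  also have "\<dots> = norm (of_nat (Suc m) * (\<nu> + of_nat (Suc m)) * bessel_coeff \<nu> (Suc m))"
    unfolding norm_mult norm_of_nat by simp
  also have "\<dots> = norm (bessel_coeff \<nu> m)" unfolding bessel_coeff_Suc by simp
  finally show "norm (bessel_coeff \<nu> (Suc m)) * (of_nat m + 1) \<le> norm (bessel_coeff \<nu> m)" by simp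
qed

lemma besselJ_exp_eq: "besselJ_exp \<nu> z = exp_series \<nu> (bessel_coeff \<nu>) (z - ln2c)"
  unfolding besselJ_exp_def exp_series_def bessel_coeff_def by (simp add: mult_ac)

lemma ode_coeff_bessel: "ode_coeff 4 \<nu> \<nu> (bessel_coeff \<nu>) m = 0"
proof (cases m)
  case (Suc k)
  have "(\<nu> + 2 * of_nat m)\<^sup>2 - \<nu>\<^sup>2 = 4 * (of_nat m * (\<nu> + of_nat m))"
    by (simp add: power2_eq_square algebra_simps)
  hence "ode_coeff 4 \<nu> \<nu> (bessel_coeff \<nu>) m =
      4 * (of_nat (Suc k) * (\<nu> + of_nat (Suc k)) * bessel_coeff \<nu> (Suc k) + bessel_coeff \<nu> k)"
    unfolding ode_coeff_def Suc by (simp add: algebra_simps)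
  thus ?thesis by (simp only: bessel_coeff_Suc) simp
qed (simp add: ode_coeff_def)

lemma ode_coeff_0 [simp]: "ode_coeff q \<nu> s (\<lambda>m. 0) = (\<lambda>m. 0)"
  by (simp add: ode_coeff_def fun_eq_iff)

lemma exp_series_0 [simp]: "exp_series s (\<lambda>m. 0) z = 0"
  by (simp add: exp_series_def)

lemma bessel_sol_besselJ: "bessel_sol 1 \<nu> (besselJ_exp \<nu>) (\<lambda>z. 0)"
proof -
  have "bessel_sol 4 \<nu> (exp_series \<nu> (bessel_coeff \<nu>)) (\<lambda>z. 0)"
    using bessel_sol_log_series [of "\<lambda>m. 0" "\<lambda>m. 0" "bessel_coeff \<nu>" 4 \<nu> \<nu> 0 0]
    by (simp add: entire_bessel_coeff ode_coeff_bessel)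
  from bessel_sol_unscale [OF this] show ?thesis by (simp add: besselJ_exp_eq [abs_def])
qed

lemma bessel_sol_minus: "bessel_sol q (- \<nu>) f g = bessel_sol q \<nu> f g"
  by (simp add: bessel_sol_def)

text \<open>Origin: perturb the Frobenius exponent and differentiate e^((\<nu> + 2t + 2m) w) /
  (\<Gamma>(t + m + 1) \<Gamma>(\<nu> + t + m + 1)) in t at t = 0. The exponential contributes 2w,
  the Gamma factors contribute minus the two digamma values.\<close>

definition log_coeff :: "complex \<Rightarrow> nat \<Rightarrow> complex" where
  "log_coeff \<nu> m = - (Digamma (of_nat m + 1) + Digamma (\<nu> + of_nat m + 1)) * bessel_coeff \<nu> m"

text \<open>The Frobenius solution with a logarithm; for a natural number \<open>\<nu>\<close> it is \<open>\<pi> Y\<^sub>\<nu>\<close>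
  up to the polar part of \<open>Y\<^sub>\<nu>\<close>.\<close>
definition bessel_log :: "complex \<Rightarrow> complex \<Rightarrow> complex" where
  "bessel_log \<nu> w = w * exp_series \<nu> (\<lambda>m. 2 * bessel_coeff \<nu> m) w + exp_series \<nu> (log_coeff \<nu>) w"

lemma entire_log_coeff:
  assumes "\<And>m::nat. \<nu> + 1 + of_nat m \<noteq> 0"
  shows "entire_coeffs (log_coeff \<nu>)"
proof -
  have "(1::complex) + of_nat m \<noteq> 0" for m
    by (metis of_nat_Suc of_nat_neq_0)
  then obtain C where C: "\<And>m. norm (Digamma (1 + of_nat m :: complex)) \<le> C * (of_nat m + 1)"
    using Digamma_linear_bound [of 1] by blast
  obtain D where D: "\<And>m. norm (Digamma (\<nu> + 1 + of_nat m)) \<le> D * (of_nat m + 1)"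
    using Digamma_linear_bound assms by blast
  have "norm (- (Digamma (of_nat m + 1) + Digamma (\<nu> + of_nat m + 1))) \<le> (C + D) * (of_nat m + 1)" for m
    using norm_triangle_le [OF add_mono [OF C [of m] D [of m]]]
    by (simp only: norm_minus_cancel) (simp add: algebra_simps)
  thus ?thesis unfolding log_coeff_def [abs_def]
    by (rule entire_coeffs_mult_linear [OF entire_bessel_coeff])
qed

text \<open>In the series perturbed by t only the leading term survives the operator, as 4t(\<nu> +
  t) e^((\<nu> + 2t) w) / (\<Gamma>(t + 1) \<Gamma>(\<nu> + t + 1)). Its derivative at t = 0 is the
  right-hand side.\<close>

lemma bessel_sol_log:
  assumes "\<And>m::nat. \<nu> + 1 + of_nat m \<noteq> 0"
  shows "bessel_sol 4 \<nu> (bessel_log \<nu>) (\<lambda>w. 4 * rGamma \<nu> * exp (\<nu> * w))"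
proof -
  have "bessel_sol 4 \<nu> (\<lambda>w. w\<^sup>2 * exp_series \<nu> (\<lambda>m. 0) w + w * exp_series \<nu> (\<lambda>m. 2 * bessel_coeff \<nu> m) w
     + exp_series \<nu> (log_coeff \<nu>) w) (\<lambda>w. 4 * rGamma \<nu> * exp ((\<nu> + 2 * of_nat 0) * w))"
  proof (rule bessel_sol_log_series)
    fix m
    have "ode_coeff 4 \<nu> \<nu> (\<lambda>m. 2 * bessel_coeff \<nu> m) m = 2 * ode_coeff 4 \<nu> \<nu> (bessel_coeff \<nu>) m"
      by (simp add: ode_coeff_def)
    thus "4 * ((\<nu> + 2 * of_nat m) * 0) + ode_coeff 4 \<nu> \<nu> (\<lambda>m. 2 * bessel_coeff \<nu> m) m = 0"
      by (simp add: ode_coeff_bessel)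
    show "2 * 0 + 2 * ((\<nu> + 2 * of_nat m) * (2 * bessel_coeff \<nu> m)) + ode_coeff 4 \<nu> \<nu> (log_coeff \<nu>) m
       = (if m = 0 then 4 * rGamma \<nu> else 0)"
    proof (cases m)
      case 0
      thus ?thesis using rGamma_plus1 [of \<nu>] by (simp add: ode_coeff_def bessel_coeff_def)
    next
      case (Suc k)
      define M :: complex where "M = of_nat (Suc k)"
      define B where "B = bessel_coeff \<nu> (Suc k)"
      define dl where "dl = (\<lambda>m. Digamma (of_nat m + 1) + Digamma (\<nu> + of_nat m + 1))"
      have M: "M \<noteq> 0" unfolding M_def by (simp del: of_nat_Suc)
      have \<nu>M: "\<nu> + M \<noteq> 0" using assms [of k] by (simp add: M_def add_ac)
      have bk: "bessel_coeff \<nu> k = - (M * (\<nu> + M) * B)"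
        using bessel_coeff_Suc [of k \<nu>] by (simp add: M_def B_def del: of_nat_Suc)
      have d: "dl (Suc k) = dl k + 1 / M + 1 / (\<nu> + M)"
        using Digamma_plus1 [OF M] Digamma_plus1 [OF \<nu>M]
        unfolding dl_def by (simp add: M_def add_ac)
      have "2 * 0 + 2 * ((\<nu> + 2 * of_nat m) * (2 * bessel_coeff \<nu> m)) + ode_coeff 4 \<nu> \<nu> (log_coeff \<nu>) m
         = 4 * (\<nu> + 2 * M) * B + (((\<nu> + 2 * M)\<^sup>2 - \<nu>\<^sup>2) * (- dl (Suc k) * B) + 4 * (- dl k * bessel_coeff \<nu> k))"
        unfolding ode_coeff_def log_coeff_def Suc by (simp add: dl_def M_def B_def algebra_simps)
      \<comment> \<open>The digamma values at index k cancel through the recurrence; their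
        increments leave M(\<nu> + M)(1/M + 1/(\<nu> + M)), which equals \<nu> + 2M.\<close>
      also have "\<dots> = 4 * B * (\<nu> + 2 * M - M * (\<nu> + M) * (1 / M + 1 / (\<nu> + M)))"
        unfolding bk d by (simp add: algebra_simps power2_eq_square)
      also have "M * (\<nu> + M) * (1 / M + 1 / (\<nu> + M)) = (\<nu> + M) * (M * (1 / M)) + M * ((\<nu> + M) * (1 / (\<nu> + M)))"
        by (simp only: distrib_left mult_ac distrib_right add_ac)
      also have "\<dots> = \<nu> + 2 * M"
        using M \<nu>M by (simp only: nonzero_mult_div_cancel_left times_divide_eq_right mult_1_right divide_self) simp
      finally show ?thesis using Suc by simp
    qed
  qed (simp_all add: entire_log_coeff assms entire_coeffs_cmult entire_bessel_coeff)
  thus ?thesis by (simp add: bessel_log_def [abs_def])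
qed

definition polar_coeff :: "nat \<Rightarrow> nat \<Rightarrow> complex" where
  "polar_coeff n k = (if k < n then of_nat (fact (n - k - 1)) / of_nat (fact k) else 0)"

definition bessel_polar :: "nat \<Rightarrow> complex \<Rightarrow> complex" where
  "bessel_polar n = exp_series (- of_nat n) (polar_coeff n)"

lemma entire_polar_coeff: "entire_coeffs (polar_coeff n)"
  by (rule entire_coeffs_ratio [of n]) (simp add: polar_coeff_def)

lemma rGamma_of_nat_Suc: "rGamma (of_nat m + 1 :: complex) = 1 / fact m"
  using Gamma_fact [of m, where ?'a = complex] by (simp add: rGamma_inverse_Gamma add_ac inverse_eq_divide)

text \<open>Cutting the series off at index n leaves a residue at the exponent -n + 2n = n, the same
  one as for \<open>bessel_log\<close>, so the difference of both solves the homogeneous equation.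
  For n = 0 both sides vanish, as \<open>rGamma 0 = 0\<close>.\<close>

lemma bessel_sol_polar:
  "bessel_sol 4 (of_nat n) (bessel_polar n) (\<lambda>w. 4 * rGamma (of_nat n) * exp (of_nat n * w))"
proof -
  have "bessel_sol 4 (of_nat n) (\<lambda>w. w\<^sup>2 * exp_series (- of_nat n) (\<lambda>m. 0) w + w * exp_series (- of_nat n) (\<lambda>m. 0) w
     + exp_series (- of_nat n) (polar_coeff n) w)
     (\<lambda>w. 4 * rGamma (of_nat n) * exp ((- of_nat n + 2 * of_nat n) * w))"
  proof (rule bessel_sol_log_series)
    fix m
    have "ode_coeff 4 (of_nat n) (- of_nat n) (polar_coeff n) m = (if m = n then 4 * rGamma (of_nat n) else 0)"
    proof (cases m)
      case 0
      thus ?thesis by (auto simp: ode_coeff_def polar_coeff_def)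
    next
      case (Suc k)
      consider "m > n" | "m = n" | "m < n" by linarith
      thus ?thesis
      proof cases
        case 2
        thus ?thesis using Suc rGamma_of_nat_Suc [of k] by (auto simp: ode_coeff_def polar_coeff_def add_ac)
      next
        case 3
        then obtain l where l: "n = Suc (m + l)" using less_imp_Suc_add by blast
        show ?thesis using Suc l
          by (simp add: ode_coeff_def polar_coeff_def field_simps power2_eq_square del: of_nat_Suc of_nat_add)
             (simp add: field_simps power2_eq_square)
      qed (use Suc in \<open>simp add: ode_coeff_def polar_coeff_def\<close>)
    qed
    thus "2 * 0 + 2 * ((- of_nat n + 2 * of_nat m) * 0) + ode_coeff 4 (of_nat n) (- of_nat n) (polar_coeff n) m
       = (if m = n then 4 * rGamma (of_nat n) else 0)" by simp
  qed (simp_all add: entire_polar_coeff)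
  thus ?thesis by (simp add: bessel_polar_def)
qed

lemma besselY_nat_exp_eq:
  "besselY_nat_exp n z = (bessel_log (of_nat n) (z - ln2c) - bessel_polar n (z - ln2c)) / of_real pi"
proof -
  define w where "w = z - ln2c"
  have e: "exp (2 * of_nat k * w) = exp (2 * w) ^ k" for k
    by (simp add: exp_of_nat_mult [symmetric] mult_ac)
  have p: "bessel_polar n w = exp (- of_nat n * w) *
     (\<Sum>k<n. of_nat (fact (n - k - 1)) / of_nat (fact k) * exp (2 * of_nat k * w))"
    unfolding bessel_polar_def exp_series_eq [OF entire_polar_coeff] e
    by (subst suminf_finite [of "{..<n}"]) (auto simp: polar_coeff_def intro!: sum.cong)
  have "(1 + of_nat n :: complex) + of_nat m \<noteq> 0" for m
    by (metis of_nat_Suc of_nat_add of_nat_neq_0 add_Suc)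
  hence l: "entire_coeffs (log_coeff (of_nat n))" by (intro entire_log_coeff) (simp add: add_ac)
  have f: "rGamma (of_nat n + of_nat m + 1 :: complex) = 1 / fact (n + m)" for m
    using rGamma_of_nat_Suc [of "n + m"] by simp
  have "exp_series (of_nat n) (log_coeff (of_nat n)) w = exp (of_nat n * w) *
     (\<Sum>k. - ((Digamma (of_nat k + 1) + Digamma (of_nat (n + k) + 1)) * (-1)^k
                * exp (2 * of_nat k * w) / (of_nat (fact k) * of_nat (fact (n + k)))))"
    unfolding exp_series_eq [OF l] e log_coeff_def bessel_coeff_def rGamma_of_nat_Suc f
    by (intro arg_cong2 [of _ _ _ _ "(*)"] suminf_cong refl) (simp add: field_simps)
  also have "\<dots> = - (exp (of_nat n * w) *
     (\<Sum>k. ((Digamma (of_nat k + 1) + Digamma (of_nat (n + k) + 1)) * (-1)^k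
                * exp (2 * of_nat k * w) / (of_nat (fact k) * of_nat (fact (n + k))))))"
  proof -
    have "summable (\<lambda>k. log_coeff (of_nat n) k * exp (2 * w) ^ k)"
      using l by (simp add: entire_coeffs_def)
    hence "summable (\<lambda>k. - (log_coeff (of_nat n) k * exp (2 * w) ^ k))" by (rule summable_minus)
    also have "(\<lambda>k. - (log_coeff (of_nat n) k * exp (2 * w) ^ k)) = (\<lambda>k. (Digamma (of_nat k + 1) + Digamma (of_nat (n + k) + 1)) * (-1)^k
                * exp (2 * of_nat k * w) / (of_nat (fact k) * of_nat (fact (n + k))))"
      unfolding e log_coeff_def bessel_coeff_def rGamma_of_nat_Suc f by (simp add: fun_eq_iff field_simps)
    finally have "summable (\<lambda>k. (Digamma (of_nat k + 1) + Digamma (of_nat (n + k) + 1)) * (-1)^k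
                * exp (2 * of_nat k * w) / (of_nat (fact k) * of_nat (fact (n + k))))" .
    thus ?thesis by (subst suminf_minus) auto
  qed
  finally have q: "exp_series (of_nat n) (log_coeff (of_nat n)) w = \<dots>" .
  show ?thesis
    unfolding besselY_nat_exp_def bessel_log_def w_def [symmetric] q p
    by (simp add: besselJ_exp_eq w_def [symmetric] exp_series_cmult [OF entire_bessel_coeff, symmetric] field_simps)
qed

lemma bessel_sol_besselY_nat: "bessel_sol 1 (of_nat n) (besselY_nat_exp n) (\<lambda>z. 0)"
proof -
  have "(1 + of_nat n :: complex) + of_nat m \<noteq> 0" for m
    by (metis of_nat_Suc of_nat_add of_nat_neq_0 add_Suc)
  hence "bessel_sol 4 (of_nat n) (bessel_log (of_nat n)) (\<lambda>w. 4 * rGamma (of_nat n) * exp (of_nat n * w))"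
    by (intro bessel_sol_log) (simp add: add_ac)
  from bessel_sol_cmult [OF bessel_sol_unscale [OF bessel_sol_add [OF this bessel_sol_cmult [OF bessel_sol_polar, where c = "-1"]]],
     of "1 / of_real pi"]
  show ?thesis by (simp add: besselY_nat_exp_eq [abs_def])
qed

lemma bessel_sol_besselY: "bessel_sol 1 \<nu> (besselY_exp \<nu>) (\<lambda>z. 0)"
proof (cases "\<nu> \<in> \<int>")
  case True
  then obtain i where i: "\<nu> = of_int i" by (auto elim: Ints_cases)
  show ?thesis
  proof (cases "i \<ge> 0")
    case True
    then obtain n where "i = int n" using nonneg_int_cases by blast
    thus ?thesis using bessel_sol_besselY_nat [of n] by (simp add: besselY_exp_def [abs_def] i)
  next
    case False
    then obtain n where n: "i = - int n" using nonpos_int_cases [of i] by force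
    have fl: "\<lfloor>- real n\<rfloor> = - int n" by (metis floor_of_int of_int_minus of_int_of_nat_eq)
    show ?thesis
      using bessel_sol_cmult [OF bessel_sol_besselY_nat [of n], of "(-1) ^ n"] False
      by (simp add: besselY_exp_def [abs_def] i n bessel_sol_minus fl Let_def)
  qed
next
  case False
  let ?c = "sin (\<nu> * of_real pi)"
  have "bessel_sol 1 \<nu> (\<lambda>z. (cos (\<nu> * of_real pi) / ?c) * besselJ_exp \<nu> z + (- 1 / ?c) * besselJ_exp (- \<nu>) z)
      (\<lambda>z. (cos (\<nu> * of_real pi) / ?c) * 0 + (- 1 / ?c) * 0)"
    using bessel_sol_besselJ [of "- \<nu>"]
    by (intro bessel_sol_add bessel_sol_cmult bessel_sol_besselJ) (simp add: bessel_sol_minus)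
  also have "(\<lambda>z. (cos (\<nu> * of_real pi) / ?c) * besselJ_exp \<nu> z + (- 1 / ?c) * besselJ_exp (- \<nu>) z)
     = besselY_exp \<nu>"
    using False by (simp add: besselY_exp_def fun_eq_iff diff_divide_distrib mult.commute)
  finally show ?thesis by simp
qed

section \<open>Lommel functions\<close>

definition lommel_coeff :: "complex \<Rightarrow> complex \<Rightarrow> nat \<Rightarrow> complex" where
  "lommel_coeff \<mu> \<nu> m = (-1) ^ m / (\<Prod>k\<in>{0..m}. (\<mu> + 2 * of_nat k + 1)^2 - \<nu>^2)"

lemma lommel_factor:
  "(\<mu> + 2 * of_nat k + 1)^2 - \<nu>^2 = (\<mu> + \<nu> + 2 * of_nat k + 1) * (\<mu> - \<nu> + 2 * of_nat k + 1 :: complex)"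
  by (simp add: power2_eq_square algebra_simps)

lemma not_odd_neg_int: "\<not> odd_neg_int x \<Longrightarrow> x + 2 * of_nat k + 1 \<noteq> 0"
  unfolding odd_neg_int_def by (metis add.assoc add_eq_0_iff2)

lemma lommel_factor_nonzero:
  "\<not> odd_neg_int (\<mu> + \<nu>) \<Longrightarrow> \<not> odd_neg_int (\<mu> - \<nu>) \<Longrightarrow> (\<mu> + 2 * of_nat k + 1)^2 - \<nu>^2 \<noteq> 0"
  unfolding lommel_factor using not_odd_neg_int by simp

text \<open>For large m one of the two linear factors in \<open>lommel_factor\<close> has modulus at
  least m + 1, which suffices for the ratio criterion; the other one only has to stay at least
  1.\<close>

lemma entire_lommel_coeff:
  assumes "\<not> odd_neg_int (\<mu> + \<nu>)" "\<not> odd_neg_int (\<mu> - \<nu>)"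
  shows "entire_coeffs (lommel_coeff \<mu> \<nu>)"
proof (rule entire_coeffs_ratio)
  fix m assume m: "m \<ge> nat \<lceil>norm (\<mu> + \<nu>) + norm (\<mu> - \<nu>)\<rceil>"
  have m': "norm (\<mu> + \<nu>) + norm (\<mu> - \<nu>) \<le> of_nat m" using m by linarith
  have *: "of_nat m + 1 \<le> norm (x + 2 * of_nat (Suc m) + 1)" if "norm x \<le> of_nat m" for x :: complex
  proof -
    have "norm (of_nat (2 * m + 3) :: complex) \<le> norm (x + 2 * of_nat (Suc m) + 1) + norm x"
      using norm_triangle_ineq4 [of "x + 2 * of_nat (Suc m) + 1" x] by (simp add: add_ac)
    thus ?thesis using that by (simp only: norm_of_nat)
  qed
  have f: "of_nat m + 1 \<le> norm ((\<mu> + 2 * of_nat (Suc m) + 1)^2 - \<nu>^2)"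
  proof -
    have "(of_nat m + 1) * 1 \<le> norm (\<mu> + \<nu> + 2 * of_nat (Suc m) + 1) * norm (\<mu> - \<nu> + 2 * of_nat (Suc m) + 1)"
    proof (rule mult_mono)
      show "of_nat m + 1 \<le> norm (\<mu> + \<nu> + 2 * of_nat (Suc m) + 1)"
        by (rule *) (use m' norm_ge_zero [of "\<mu> - \<nu>"] in linarith)
      have "of_nat m + 1 \<le> norm (\<mu> - \<nu> + 2 * of_nat (Suc m) + 1)"
        by (rule *) (use m' norm_ge_zero [of "\<mu> + \<nu>"] in linarith)
      thus "1 \<le> norm (\<mu> - \<nu> + 2 * of_nat (Suc m) + 1)" by linarith
    qed auto
    thus ?thesis unfolding lommel_factor norm_mult by simp
  qed
  have "norm (lommel_coeff \<mu> \<nu> (Suc m)) * (of_nat m + 1) \<le>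
     norm (lommel_coeff \<mu> \<nu> (Suc m)) * norm ((\<mu> + 2 * of_nat (Suc m) + 1)^2 - \<nu>^2)"
    by (rule mult_left_mono [OF f]) simp
  also have "\<dots> = norm (lommel_coeff \<mu> \<nu> m)"
    using lommel_factor_nonzero [OF assms, of "Suc m"]
    by (simp add: lommel_coeff_def norm_divide norm_mult norm_power del: of_nat_Suc)
  finally show "norm (lommel_coeff \<mu> \<nu> (Suc m)) * (of_nat m + 1) \<le> norm (lommel_coeff \<mu> \<nu> m)" .
qed

lemma bessel_sol_lommel_i:
  assumes "\<not> odd_neg_int (\<mu> + \<nu>)" "\<not> odd_neg_int (\<mu> - \<nu>)"
  shows "bessel_sol 1 \<nu> (lommel_i \<mu> \<nu>) (\<lambda>z. exp ((\<mu> + 1) * z))"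
proof -
  have "bessel_sol 1 \<nu> (\<lambda>w. w\<^sup>2 * exp_series (\<mu> + 1) (\<lambda>m. 0) w + w * exp_series (\<mu> + 1) (\<lambda>m. 0) w
     + exp_series (\<mu> + 1) (lommel_coeff \<mu> \<nu>) w) (\<lambda>w. 1 * exp ((\<mu> + 1 + 2 * of_nat 0) * w))"
  proof (rule bessel_sol_log_series)
    fix m
    have "ode_coeff 1 \<nu> (\<mu> + 1) (lommel_coeff \<mu> \<nu>) m = (if m = 0 then 1 else 0)"
    proof (cases m)
      case 0
      thus ?thesis using lommel_factor_nonzero [OF assms, of 0]
        by (simp add: ode_coeff_def lommel_coeff_def add_ac)
    next
      case (Suc k)
      have "((\<mu> + 1 + 2 * of_nat (Suc k))\<^sup>2 - \<nu>\<^sup>2) = (\<mu> + 2 * of_nat (Suc k) + 1)^2 - \<nu>^2"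
        by (simp add: add_ac)
      thus ?thesis using lommel_factor_nonzero [OF assms, of "Suc k"]
        by (simp add: ode_coeff_def lommel_coeff_def Suc del: of_nat_Suc)
    qed
    thus "2 * 0 + 2 * ((\<mu> + 1 + 2 * of_nat m) * 0) + ode_coeff 1 \<nu> (\<mu> + 1) (lommel_coeff \<mu> \<nu>) m = (if m = 0 then 1 else 0)"
      by simp
  qed (simp_all add: entire_lommel_coeff assms)
  hence 1: "bessel_sol 1 \<nu> (exp_series (\<mu> + 1) (lommel_coeff \<mu> \<nu>)) (\<lambda>z. exp ((\<mu> + 1) * z))"
    by simp
  define K where "K = (2::complex) powr (\<mu> - 1) * Gamma ((\<mu> - \<nu> + 1) / 2) * Gamma ((\<mu> + \<nu> + 1) / 2)"
  define a b where "a = K * sin ((\<mu> - \<nu>) * of_real pi / 2)" and "b = - K * cos ((\<mu> - \<nu>) * of_real pi / 2)"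
  have "bessel_sol 1 \<nu> (\<lambda>z. exp_series (\<mu> + 1) (lommel_coeff \<mu> \<nu>) z + (a * besselJ_exp \<nu> z + b * besselY_exp \<nu> z))
     (\<lambda>z. exp ((\<mu> + 1) * z) + (a * 0 + b * 0))"
    by (intro bessel_sol_add bessel_sol_cmult 1 bessel_sol_besselJ bessel_sol_besselY)
  also have "(\<lambda>z. exp_series (\<mu> + 1) (lommel_coeff \<mu> \<nu>) z + (a * besselJ_exp \<nu> z + b * besselY_exp \<nu> z)) = lommel_i \<mu> \<nu>"
  proof
    fix z
    have "exp_series (\<mu> + 1) (lommel_coeff \<mu> \<nu>) z = (\<Sum>m. (-1)^m * exp ((\<mu> + 1 + 2 * of_nat m) * z)
            / (\<Prod>k\<in>{0..m}. (\<mu> + 2 * of_nat k + 1)^2 - \<nu>^2))"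
      by (simp add: exp_series_def lommel_coeff_def)
    thus "exp_series (\<mu> + 1) (lommel_coeff \<mu> \<nu>) z + (a * besselJ_exp \<nu> z + b * besselY_exp \<nu> z) = lommel_i \<mu> \<nu> z"
      unfolding lommel_i_def K_def [symmetric] a_def b_def by (simp add: algebra_simps)
  qed
  finally show ?thesis by simp
qed

section \<open>The exceptional case \<mu> = \<nu> - 2p - 1\<close>

lemma complex_powr_2: "(2::complex) powr a = exp (a * ln2c)"
proof -
  have "Ln (2::complex) = of_real (ln 2)" using Ln_of_real [of 2] by simp
  thus ?thesis by (simp add: powr_def ln2c_def)
qed

text \<open>Passing from \<zeta> to \<zeta>/2 turns log \<zeta> into log(\<zeta>/2) and absorbs the
  2 log 2 in A(m). The resulting form shows both the equation and, for positive integers \<nu>, the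
  cancellation of the logarithm against that of Y.\<close>

lemma lommel_nu_m1_eq:
  assumes "\<And>n::nat. \<nu> \<noteq> - of_nat n"
  shows "lommel_nu_m1 \<nu> z = Gamma \<nu> * 2 powr (\<nu> - 2) * (bessel_log \<nu> (z - ln2c) - of_real pi * besselY_exp \<nu> z)"
proof -
  define w where "w = z - ln2c"
  have "\<nu> + 1 + of_nat m \<noteq> 0" for m
    using assms [of "Suc m"] by (metis add.assoc add_eq_0_iff2 of_nat_Suc)
  hence l: "entire_coeffs (log_coeff \<nu>)" by (rule entire_log_coeff)
  \<comment> \<open>Since \<zeta> = 2 e^w, the prefactor \<zeta>^\<nu>/4 carries the same constant
    2^(\<nu>-2) as the term with Y.\<close>
  have z: "exp (\<nu> * z) = 4 * 2 powr (\<nu> - 2) * exp (\<nu> * w)"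
  proof -
    have "(\<nu> * z) = 2 * ln2c + ((\<nu> - 2) * ln2c + \<nu> * w)" by (simp add: w_def algebra_simps)
    thus ?thesis by (simp only: exp_add exp_ln2c complex_powr_2) simp
  qed
  have p: "(2::complex) powr (\<nu> - 1) = 2 * 2 powr (\<nu> - 2)"
  proof -
    have "(\<nu> - 1) * ln2c = ln2c + (\<nu> - 2) * ln2c" by (simp add: algebra_simps)
    thus ?thesis by (simp only: exp_add exp_ln2c complex_powr_2)
  qed
  have e: "exp (2 * of_nat k * w) = exp (2 * w) ^ k" for k
    by (simp add: exp_of_nat_mult [symmetric] mult_ac)
  define c where "c = (\<lambda>m. 2 * ln2c * bessel_coeff \<nu> m + (-1) * log_coeff \<nu> m)"
  have c: "entire_coeffs c" unfolding c_def
    by (intro entire_coeffs_add entire_coeffs_cmult l entire_bessel_coeff)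
  have "exp (\<nu> * w) * (\<Sum>m. (-1)^m * exp (2 * of_nat m * w)
                        * (2 * ln2c + Digamma (\<nu> + of_nat m + 1) + Digamma (of_nat m + 1))
                        / of_nat (fact m) * rGamma (\<nu> + of_nat m + 1)) = exp_series \<nu> c w"
    unfolding exp_series_eq [OF c] unfolding e c_def log_coeff_def bessel_coeff_def rGamma_of_nat_Suc
    by (rule arg_cong2 [where f = "(*)", OF refl], rule suminf_cong) (simp add: field_simps)
  also have "\<dots> = 2 * ln2c * exp_series \<nu> (bessel_coeff \<nu>) w + (-1) * exp_series \<nu> (log_coeff \<nu>) w"
    unfolding c_def by (simp only: exp_series_add exp_series_cmult l entire_bessel_coeff entire_coeffs_cmult)
  finally have s: "(\<Sum>m. (-1)^m * exp (2 * of_nat m * w)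
                        * (2 * ln2c + Digamma (\<nu> + of_nat m + 1) + Digamma (of_nat m + 1))
                        / of_nat (fact m) * rGamma (\<nu> + of_nat m + 1))
      = (2 * ln2c * exp_series \<nu> (bessel_coeff \<nu>) w - exp_series \<nu> (log_coeff \<nu>) w) / exp (\<nu> * w)"
    by (simp add: field_simps)
  have zw: "z = w + ln2c" by (simp add: w_def)
  have "lommel_nu_m1 \<nu> z = Gamma \<nu> * (2 powr (\<nu> - 1) * exp_series \<nu> (bessel_coeff \<nu>) w * z
                   - 2 powr (\<nu> - 2) * of_real pi * besselY_exp \<nu> z
                   - exp (\<nu> * z) / 4 * ((2 * ln2c * exp_series \<nu> (bessel_coeff \<nu>) w - exp_series \<nu> (log_coeff \<nu>) w) / exp (\<nu> * w)))"
  proof -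
    have "(\<not> (\<exists>n::nat. \<nu> = - of_nat n)) = True" using assms by blast
    thus ?thesis unfolding lommel_nu_m1_def by (simp only: if_True w_def [symmetric] s besselJ_exp_eq)
  qed
  also have "\<dots> = Gamma \<nu> * 2 powr (\<nu> - 2) * (bessel_log \<nu> w - of_real pi * besselY_exp \<nu> z)"
  proof -
    have X: "exp (\<nu> * z) / 4 * (X / exp (\<nu> * w)) = 2 powr (\<nu> - 2) * X" for X
      by (simp add: z)
    show ?thesis unfolding X p bessel_log_def exp_series_cmult [OF entire_bessel_coeff, symmetric]
      by (simp add: zw algebra_simps)
  qed
  finally show ?thesis by (simp add: w_def)
qed

lemma bessel_sol_lommel_nu_m1_generic:
  assumes "\<And>n::nat. \<nu> \<noteq> - of_nat n"
  shows "bessel_sol 1 \<nu> (lommel_nu_m1 \<nu>) (\<lambda>z. exp (\<nu> * z))"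
proof -
  have "\<nu> + 1 + of_nat m \<noteq> 0" for m
    using assms [of "Suc m"] by (metis add.assoc add_eq_0_iff2 of_nat_Suc)
  hence 1: "bessel_sol 1 \<nu> (\<lambda>z. bessel_log \<nu> (z - ln2c)) (\<lambda>z. 4 * rGamma \<nu> * exp (\<nu> * (z - ln2c)))"
    by (intro bessel_sol_unscale bessel_sol_log)
  let ?K = "Gamma \<nu> * 2 powr (\<nu> - 2)"
  have "bessel_sol 1 \<nu> (\<lambda>z. ?K * (bessel_log \<nu> (z - ln2c) + (- of_real pi) * besselY_exp \<nu> z))
     (\<lambda>z. ?K * (4 * rGamma \<nu> * exp (\<nu> * (z - ln2c)) + (- of_real pi) * 0))"
    by (intro bessel_sol_add bessel_sol_cmult 1 bessel_sol_besselY)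
  moreover have "?K * (4 * rGamma \<nu> * exp (\<nu> * (z - ln2c)) + (- of_real pi) * 0) = exp (\<nu> * z)" for z
  proof -
    have "Gamma \<nu> \<noteq> 0" using assms by (auto simp: Gamma_eq_zero_iff elim!: nonpos_Ints_cases')
    hence "Gamma \<nu> * rGamma \<nu> = 1" by (simp add: rGamma_inverse_Gamma)
    moreover have "?K * (4 * rGamma \<nu> * exp (\<nu> * (z - ln2c)) + (- of_real pi) * 0) =
       (Gamma \<nu> * rGamma \<nu>) * 4 * exp ((\<nu> - 2) * ln2c) * exp (\<nu> * (z - ln2c))"
      by (simp add: complex_powr_2)
    ultimately have "?K * (4 * rGamma \<nu> * exp (\<nu> * (z - ln2c)) + (- of_real pi) * 0) =
       exp (2 * ln2c) * exp ((\<nu> - 2) * ln2c) * exp (\<nu> * (z - ln2c))"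
      by (simp only: exp_ln2c mult_1_left)
    also have "\<dots> = exp (\<nu> * z)" by (simp only: exp_add [symmetric]) (simp add: algebra_simps)
    finally show ?thesis .
  qed
  ultimately show ?thesis by (simp add: lommel_nu_m1_eq [OF assms, abs_def])
qed

text \<open>Up to the factor 1/4, (w - \<psi>)^2 - \<psi>'/2 comes from the second t-derivative at 0
  of e^(2(t + m) w) / \<Gamma>(t + m + 1)^2. The perturbed leading term leaves 4 t^2 e^(2tw) /
  \<Gamma>(t + 1)^2, whose second derivative 8 is normalised to 1 by 1/4 and the prefactor 1/2. The
  term with \<pi>^2/4 adds a multiple of the homogeneous solution J_0.\<close>

lemma bessel_sol_lommel_m1_0: "bessel_sol 1 0 lommel_m1_0 (\<lambda>z. 1)"
proof -
  define \<psi> where "\<psi> = (\<lambda>m::nat. Digamma (of_nat m + 1) :: complex)"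
  define tg where "tg = (\<lambda>m::nat. Polygamma 1 (of_nat m + 1) :: complex)"
  define a where "a = (\<lambda>m. 1/2 * bessel_coeff 0 m)"
  define b where "b = (\<lambda>m. (-2) * (\<psi> m * a m))"
  define c where "c = (\<lambda>m. \<psi> m * (\<psi> m * a m) + ((-1/2) * (tg m * a m) + (of_real pi)^2 / 4 * a m))"
  have nz: "(1::complex) + of_nat m \<noteq> 0" for m
    by (metis of_nat_Suc of_nat_neq_0)
  obtain C where "\<And>m. norm (Digamma (1 + of_nat m :: complex)) \<le> C * (of_nat m + 1)"
    using Digamma_linear_bound [OF nz] by blast
  hence C: "\<And>m. norm (\<psi> m) \<le> C * (of_nat m + 1)" by (simp add: \<psi>_def add_ac)
  obtain D where "\<And>m. norm (Polygamma 1 (1 + of_nat m :: complex)) \<le> D * (of_nat m + 1)"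
    using Trigamma_linear_bound [OF nz] by blast
  hence D: "\<And>m. norm (tg m) \<le> D * (of_nat m + 1)" by (simp add: tg_def add_ac)
  have a: "entire_coeffs a" unfolding a_def by (intro entire_coeffs_cmult entire_bessel_coeff)
  note mult = entire_coeffs_mult_linear [OF _ C] entire_coeffs_mult_linear [OF _ D]
  have b: "entire_coeffs b" unfolding b_def by (intro entire_coeffs_cmult mult a)
  have c: "entire_coeffs c" unfolding c_def by (intro entire_coeffs_add entire_coeffs_cmult mult a)
  have aS: "a k = - ((of_nat (Suc k))\<^sup>2 * a (Suc k))" for k
    using bessel_coeff_Suc [of k 0] by (simp add: a_def power2_eq_square del: of_nat_Suc)
  have \<psi>S: "\<psi> (Suc k) = \<psi> k + 1 / of_nat (Suc k)" for k
    using Digamma_plus1 [of "of_nat (Suc k) :: complex"] by (simp add: \<psi>_def add_ac del: of_nat_Suc) (simp add: add_ac)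
  have tgS: "tg (Suc k) = tg k - 1 / (of_nat (Suc k))\<^sup>2" for k
    using Polygamma_plus1 [of "of_nat (Suc k) :: complex" 1]
    by (simp add: tg_def add_ac power2_eq_square del: of_nat_Suc) (simp add: add_ac)
  have "bessel_sol 4 0 (\<lambda>z. z\<^sup>2 * exp_series 0 a z + z * exp_series 0 b z + exp_series 0 c z)
     (\<lambda>z. 1 * exp ((0 + 2 * of_nat 0) * z))"
  proof (rule bessel_sol_log_series [OF a b c])
    fix m
    have "ode_coeff 4 0 0 a m = 1/2 * ode_coeff 4 0 0 (bessel_coeff 0) m"
      by (simp add: ode_coeff_def a_def algebra_simps)
    thus "ode_coeff 4 0 0 a m = 0" by (simp add: ode_coeff_bessel)
    show "4 * ((0 + 2 * of_nat m) * a m) + ode_coeff 4 0 0 b m = 0"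
    proof (cases m)
      case (Suc k)
      define M :: complex where "M = of_nat (Suc k)"
      have M: "M \<noteq> 0" unfolding M_def by (simp del: of_nat_Suc)
      show ?thesis unfolding ode_coeff_def b_def Suc diff_Suc_1
        unfolding aS [of k] \<psi>S [of k]
        using M unfolding M_def [symmetric] by (simp add: M_def [symmetric] field_simps power2_eq_square del: of_nat_Suc)
    qed (simp add: ode_coeff_def)
    show "2 * a m + 2 * ((0 + 2 * of_nat m) * b m) + ode_coeff 4 0 0 c m = (if m = 0 then 1 else 0)"
    proof (cases m)
      case 0
      thus ?thesis by (simp add: ode_coeff_def a_def bessel_coeff_def)
    next
      case (Suc k)
      define M :: complex where "M = of_nat (Suc k)"
      have M: "M \<noteq> 0" unfolding M_def by (simp del: of_nat_Suc)
      show ?thesis unfolding ode_coeff_def b_def c_def Suc diff_Suc_1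
        unfolding aS [of k] \<psi>S [of k] tgS [of k]
        using M unfolding M_def [symmetric] by (simp add: M_def [symmetric] field_simps power2_eq_square del: of_nat_Suc)
    qed
  qed
  from bessel_sol_unscale [OF this]
  have "bessel_sol 1 0 (\<lambda>z. (z - ln2c)\<^sup>2 * exp_series 0 a (z - ln2c) + (z - ln2c) * exp_series 0 b (z - ln2c)
      + exp_series 0 c (z - ln2c)) (\<lambda>z. 1)" by simp
  also have "(\<lambda>z. (z - ln2c)\<^sup>2 * exp_series 0 a (z - ln2c) + (z - ln2c) * exp_series 0 b (z - ln2c)
      + exp_series 0 c (z - ln2c)) = lommel_m1_0"
  proof
    fix z
    define w where "w = z - ln2c"
    have "w\<^sup>2 * exp_series 0 a w + w * exp_series 0 b w + exp_series 0 c w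
      = exp_series 0 (\<lambda>m. w\<^sup>2 * a m + w * b m + c m) w"
      by (simp only: exp_series_cmult exp_series_add entire_coeffs_cmult entire_coeffs_add a b c)
    also have "\<dots> = 1/2 * exp_series 0 (\<lambda>m. 2 * (w\<^sup>2 * a m + w * b m + c m)) w"
    proof -
      have e: "entire_coeffs (\<lambda>m. w\<^sup>2 * a m + w * b m + c m)"
        by (intro entire_coeffs_add entire_coeffs_cmult a b c)
      show ?thesis unfolding exp_series_cmult [OF e, symmetric] by simp
    qed
    also have "\<dots> = lommel_m1_0 z"
      unfolding lommel_m1_0_def exp_series_def w_def [symmetric] a_def b_def c_def bessel_coeff_def \<psi>_def tg_def
      by (rule arg_cong2 [where f = "(*)", OF refl], rule suminf_cong, simp only: rGamma_of_nat_Suc add_0_left)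
        (simp add: field_simps power2_eq_square)
    finally show "(z - ln2c)\<^sup>2 * exp_series 0 a (z - ln2c) + (z - ln2c) * exp_series 0 b (z - ln2c)
      + exp_series 0 c (z - ln2c) = lommel_m1_0 z" by (simp only: w_def)
  qed
  finally show ?thesis .
qed

text \<open>With x = \<zeta>^2 the equation reads 4x u'' + 4(n + 1) u' + u = (-1)^n n! x^(-n-1),
  primes denoting d/dx. Differentiating it once in x gives the same equation for u' with n + 1 in
  place of n.\<close>

lemma d_dzeta2_iterate:
  "\<exists>u1 u2. (\<forall>z. ((d_dzeta2 ^^ n) lommel_m1_0 has_field_derivative u1 z) (at z)) \<and>
     (\<forall>z. (u1 has_field_derivative u2 z) (at z)) \<and>
     (\<forall>z. u2 z + 2 * of_nat n * u1 z + exp (2 * z) * (d_dzeta2 ^^ n) lommel_m1_0 z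
        = (-1) ^ n * fact n * exp (- 2 * of_nat n * z))"
proof (induction n)
  case 0
  show ?case using bessel_sol_lommel_m1_0 unfolding bessel_sol_def by simp
next
  case (Suc n)
  define u where "u = (d_dzeta2 ^^ n) lommel_m1_0"
  define k :: complex where "k = (-1) ^ n * fact n"
  define r where "r = (\<lambda>z. exp (- 2 * of_nat n * z) :: complex)"
  obtain u1 u2 where *: "\<And>z. (u has_field_derivative u1 z) (at z)"
    "\<And>z. (u1 has_field_derivative u2 z) (at z)"
    "\<And>z. u2 z + 2 * of_nat n * u1 z + exp (2 * z) * u z = k * r z"
    using Suc unfolding u_def k_def r_def by blast
  \<comment> \<open>The new function contains \<open>u1\<close>, so its second derivative needs a
    third derivative of \<open>u\<close>; it comes from differentiating the equation solved for
    \<open>u2\<close>.\<close>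
  define u3 where "u3 = (\<lambda>z. - 2 * of_nat n * k * r z - 2 * of_nat n * u2 z - 2 * exp (2 * z) * u z - exp (2 * z) * u1 z)"
  have u2: "u2 = (\<lambda>z. k * r z - 2 * of_nat n * u1 z - exp (2 * z) * u z)"
    using *(3) by (simp add: fun_eq_iff algebra_simps)
  have 3: "(u2 has_field_derivative u3 z) (at z)" for z
  proof -
    have "((\<lambda>z. k * r z - 2 * of_nat n * u1 z - exp (2 * z) * u z) has_field_derivative u3 z) (at z)"
      unfolding u3_def r_def
      by (rule derivative_eq_intros *(1,2) refl | simp add: algebra_simps)+
    thus ?thesis by (simp only: u2 [symmetric])
  qed
  define e where "e = (\<lambda>z::complex. exp (- 2 * z) / 2)"
  have de: "(e has_field_derivative - 2 * e z) (at z)" for z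
    unfolding e_def by (auto intro!: derivative_eq_intros)
  have v: "(d_dzeta2 ^^ Suc n) lommel_m1_0 = (\<lambda>z. e z * u1 z)"
    using DERIV_imp_deriv [OF *(1)] by (simp add: d_dzeta2_def u_def [symmetric] e_def fun_eq_iff)
  define v1 where "v1 = (\<lambda>z. e z * (u2 z - 2 * u1 z))"
  define v2 where "v2 = (\<lambda>z. e z * (u3 z - 4 * u2 z + 4 * u1 z))"
  have "((\<lambda>z. e z * u1 z) has_field_derivative v1 z) (at z)" for z
    unfolding v1_def by (rule derivative_eq_intros *(1,2) de refl | simp add: algebra_simps)+
  moreover have "(v1 has_field_derivative v2 z) (at z)" for z
    unfolding v1_def v2_def by (rule derivative_eq_intros *(1,2) 3 de refl | simp add: algebra_simps)+
  moreover have "v2 z + 2 * of_nat (Suc n) * v1 z + exp (2 * z) * (e z * u1 z)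
        = (-1) ^ Suc n * fact (Suc n) * exp (- 2 * of_nat (Suc n) * z)" for z
  proof -
    have "v2 z + 2 * of_nat (Suc n) * v1 z + exp (2 * z) * (e z * u1 z)
      = e z * (- 2 * of_nat n * (k * r z) - 2 * (u2 z + 2 * of_nat n * u1 z + exp (2 * z) * u z))"
      unfolding v1_def v2_def u3_def by (simp add: algebra_simps)
    also have "\<dots> = - (of_nat (Suc n) * k * (2 * e z * r z))" unfolding * by (simp add: algebra_simps)
    also have "2 * e z * r z = exp (- 2 * of_nat (Suc n) * z)"
      unfolding e_def r_def by (simp add: exp_add [symmetric] algebra_simps)
    finally show ?thesis by (simp add: k_def algebra_simps)
  qed
  ultimately show ?case unfolding v by blast
qed

text \<open>Multiplication by e^(nz) removes the first-order term 2n u' of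
  \<open>d_dzeta2_iterate\<close> and produces -n^2 in its place.\<close>

lemma bessel_sol_lommel_nu_m1_neg:
  "bessel_sol 1 (- of_nat n) (lommel_nu_m1 (- of_nat n)) (\<lambda>z. exp (- of_nat n * z))"
proof -
  define u where "u = (d_dzeta2 ^^ n) lommel_m1_0"
  obtain u1 u2 where *: "\<And>z. (u has_field_derivative u1 z) (at z)"
    "\<And>z. (u1 has_field_derivative u2 z) (at z)"
    "\<And>z. u2 z + 2 * of_nat n * u1 z + exp (2 * z) * u z = (-1) ^ n * fact n * exp (- 2 * of_nat n * z)"
    using d_dzeta2_iterate [of n] unfolding u_def by blast
  define c :: complex where "c = (-1) ^ n / fact n"
  define N :: complex where "N = of_nat n"
  have eq: "lommel_nu_m1 (- of_nat n) = (\<lambda>z. c * (exp (N * z) * u z))"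
    by (simp add: lommel_nu_m1_def Let_def u_def c_def N_def fun_eq_iff)
  show ?thesis unfolding eq
  proof (rule bessel_sol_cmult [where g = "\<lambda>z. (-1) ^ n * fact n * exp (- N * z)", THEN bessel_sol_cong])
    show "bessel_sol 1 (- of_nat n) (\<lambda>z. exp (N * z) * u z) (\<lambda>z. (-1) ^ n * fact n * exp (- N * z))"
    proof (rule bessel_solI [of _ "\<lambda>z. exp (N * z) * (N * u z + u1 z)"
          "\<lambda>z. exp (N * z) * (N\<^sup>2 * u z + 2 * N * u1 z + u2 z)"])
      fix z
      show "((\<lambda>z. exp (N * z) * u z) has_field_derivative exp (N * z) * (N * u z + u1 z)) (at z)"
        by (rule derivative_eq_intros * refl | simp add: algebra_simps)+
      show "((\<lambda>z. exp (N * z) * (N * u z + u1 z)) has_field_derivative exp (N * z) * (N\<^sup>2 * u z + 2 * N * u1 z + u2 z)) (at z)"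
        by (rule derivative_eq_intros * refl | simp add: algebra_simps power2_eq_square)+
      have "exp (N * z) * (N\<^sup>2 * u z + 2 * N * u1 z + u2 z) + (1 * exp (2 * z) - (- of_nat n)\<^sup>2) * (exp (N * z) * u z)
         = exp (N * z) * (u2 z + 2 * of_nat n * u1 z + exp (2 * z) * u z)"
        unfolding N_def by (simp add: algebra_simps)
      also have "\<dots> = (-1) ^ n * fact n * (exp (N * z) * exp (- 2 * N * z))"
        unfolding * by (simp add: N_def)
      also have "exp (N * z) * exp (- 2 * N * z) = exp (- N * z)"
        by (simp add: exp_add [symmetric] algebra_simps)
      finally show "exp (N * z) * (N\<^sup>2 * u z + 2 * N * u1 z + u2 z) + (1 * exp (2 * z) - (- of_nat n)\<^sup>2) * (exp (N * z) * u z)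
         = (-1) ^ n * fact n * exp (- N * z)" .
    qed
    fix z
    have "(-1) ^ n * (-1) ^ n = (1 :: complex)" by (simp add: power_mult_distrib [symmetric])
    thus "c * ((-1) ^ n * fact n * exp (- N * z)) = exp (- of_nat n * z)"
      by (simp add: c_def N_def)
  qed
qed

text \<open>This is S_{\<mu>+2,\<nu>} = \<zeta>^(\<mu>+1) - ((\<mu>+1)^2 - \<nu>^2) S_{\<mu>,\<nu>},
  solved for S_{\<mu>,\<nu>} at \<mu> = \<nu> - 2p - 3: the term m = 0 splits off and the others are
  those for p divided by the negated factor. If that factor is 0, both sides are 0 by the convention
  for division.\<close>

lemma lommel_ii_Suc:
  "lommel_ii \<nu> (Suc p) z = (exp ((\<nu> - 2 * of_nat p - 2) * z) - lommel_ii \<nu> p z) /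
     (4 * (of_nat p + 1) * (of_nat p + 1 - \<nu>))"
proof -
  define D where "D = 4 * (of_nat p + 1) * (of_nat p + 1 - \<nu>)"
  define t where "t = (\<lambda>p m. (-1)^m * exp ((\<nu> - 2 * of_nat p + 2 * of_nat m) * z)
        / (2^(2*m+2) * pochhammer (- of_nat p) (m+1) * pochhammer (\<nu> - of_nat p) (m+1)))"
  define b where "b = (\<lambda>p. (-1)^p * lommel_nu_m1 \<nu> z / (2^(2*p) * of_nat (fact p) * pochhammer (1 - \<nu>) p))"
  have ii: "lommel_ii \<nu> p z = (\<Sum>m<p. t p m) + b p" for p
    by (simp add: lommel_ii_def t_def b_def)
  have t0: "t (Suc p) 0 = exp ((\<nu> - 2 * of_nat p - 2) * z) / D"
  proof -
    have "(2 ^ 2 * (- of_nat (Suc p)) * (\<nu> - of_nat (Suc p))) = D" by (simp add: D_def algebra_simps)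
    thus ?thesis unfolding t_def by (simp add: algebra_simps)
  qed
  have tS: "t (Suc p) (Suc m) = - t p m / D" for m
  proof -
    have 1: "pochhammer (- of_nat (Suc p)) (Suc m + 1) = (- of_nat (Suc p)) * pochhammer (- of_nat p :: complex) (m + 1)"
      using pochhammer_rec [of "- of_nat (Suc p) :: complex" "Suc m"] by simp
    have 2: "pochhammer (\<nu> - of_nat (Suc p)) (Suc m + 1) = (\<nu> - of_nat (Suc p)) * pochhammer (\<nu> - of_nat p) (m + 1)"
      using pochhammer_rec [of "\<nu> - of_nat (Suc p)" "Suc m"] by simp
    have 3: "2^(2*Suc m+2) * pochhammer (- of_nat (Suc p)) (Suc m+1) * pochhammer (\<nu> - of_nat (Suc p)) (Suc m+1)
      = D * (2^(2*m+2) * pochhammer (- of_nat p) (m+1) * pochhammer (\<nu> - of_nat p) (m+1))"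
      unfolding 1 2 D_def by (simp add: algebra_simps)
    have 4: "\<nu> - 2 * of_nat (Suc p) + 2 * of_nat (Suc m) = \<nu> - 2 * of_nat p + 2 * of_nat m" by simp
    show ?thesis unfolding t_def 3 4 by simp
  qed
  have bS: "b (Suc p) = - b p / D"
  proof -
    have "2^(2*Suc p) * of_nat (fact (Suc p)) * pochhammer (1 - \<nu>) (Suc p)
      = D * (2^(2*p) * of_nat (fact p) * pochhammer (1 - \<nu>) p)"
      unfolding pochhammer_Suc D_def by (simp add: algebra_simps)
    thus ?thesis unfolding b_def by simp
  qed
  show ?thesis
    unfolding ii sum.lessThan_Suc_shift t0 tS bS D_def [symmetric]
    by (simp add: sum_negf sum_divide_distrib [symmetric] diff_divide_distrib add_divide_distrib)
qed

lemma bessel_sol_lommel_ii: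
  assumes base: "bessel_sol 1 \<nu> (lommel_nu_m1 \<nu>) (\<lambda>z. exp (\<nu> * z))"
    and "\<And>j. 1 \<le> j \<Longrightarrow> j \<le> p \<Longrightarrow> \<nu> \<noteq> of_nat j"
  shows "bessel_sol 1 \<nu> (lommel_ii \<nu> p) (\<lambda>z. exp ((\<nu> - 2 * of_nat p) * z))"
  using assms(2)
proof (induction p)
  case 0
  thus ?case using base by (simp add: lommel_ii_def)
next
  case (Suc p)
  define s where "s = \<nu> - 2 * of_nat p - 2"
  define D where "D = 4 * (of_nat p + 1) * (of_nat p + 1 - \<nu>)"
  have "\<nu> \<noteq> of_nat (Suc p)" by (rule Suc.prems) auto
  hence "of_nat (Suc p) - \<nu> \<noteq> 0" by (metis eq_iff_diff_eq_0)
  moreover have "of_nat (Suc p) \<noteq> (0::complex)" by (simp del: of_nat_Suc)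
  moreover have "D = 4 * of_nat (Suc p) * (of_nat (Suc p) - \<nu>)" by (simp add: D_def add_ac)
  ultimately have D: "D \<noteq> 0" by (simp del: of_nat_Suc)
  have sD: "s\<^sup>2 - \<nu>\<^sup>2 = D" unfolding s_def D_def by (simp add: algebra_simps power2_eq_square)
  \<comment> \<open>The pure exponential has the residue D e^(sz) plus e^((s + 2) z), and the latter
    is the right-hand side for p; subtracting the solution for p leaves D e^(sz).\<close>
  have e: "bessel_sol 1 \<nu> (\<lambda>z. exp (s * z)) (\<lambda>z. D * exp (s * z) + exp ((\<nu> - 2 * of_nat p) * z))"
  proof (rule bessel_solI [of _ "\<lambda>z. s * exp (s * z)" "\<lambda>z. s\<^sup>2 * exp (s * z)"])
    fix z
    have "exp ((\<nu> - 2 * of_nat p) * z) = exp (2 * z) * exp (s * z)"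
      by (simp add: s_def exp_add [symmetric] algebra_simps)
    thus "s\<^sup>2 * exp (s * z) + (1 * exp (2 * z) - \<nu>\<^sup>2) * exp (s * z) = D * exp (s * z) + exp ((\<nu> - 2 * of_nat p) * z)"
      unfolding sD [symmetric] by (simp add: algebra_simps)
  qed (rule derivative_eq_intros refl | simp add: power2_eq_square)+
  have IH: "bessel_sol 1 \<nu> (lommel_ii \<nu> p) (\<lambda>z. exp ((\<nu> - 2 * of_nat p) * z))"
    using Suc by simp
  have "bessel_sol 1 \<nu> (\<lambda>z. (1 / D) * (exp (s * z) + (-1) * lommel_ii \<nu> p z))
     (\<lambda>z. (1 / D) * ((D * exp (s * z) + exp ((\<nu> - 2 * of_nat p) * z)) + (-1) * exp ((\<nu> - 2 * of_nat p) * z)))"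
    by (intro bessel_sol_add bessel_sol_cmult e IH)
  moreover have "(\<lambda>z. (1 / D) * (exp (s * z) + (-1) * lommel_ii \<nu> p z)) = lommel_ii \<nu> (Suc p)"
    by (simp add: fun_eq_iff lommel_ii_Suc s_def D_def)
  moreover have "s = \<nu> - 2 * of_nat (Suc p)" by (simp add: s_def)
  ultimately show ?case using D by simp
qed

section \<open>The terminating sums\<close>

definition lommel_prod :: "complex \<Rightarrow> complex \<Rightarrow> nat \<Rightarrow> complex" where
  "lommel_prod \<mu> \<nu> j = (\<Prod>m\<in>{1..j}. (\<mu> - 2 * of_nat m + 1)^2 - \<nu>^2)"

definition lommel_sum :: "complex \<Rightarrow> complex \<Rightarrow> nat \<Rightarrow> complex \<Rightarrow> complex" where
  "lommel_sum \<mu> \<nu> p z = exp ((\<mu> - 1) * z) *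
     (\<Sum>j\<le>p. (-1)^j * lommel_prod \<mu> \<nu> j / exp (2 * of_nat j * z))"

lemma lommel_prod_Suc: "lommel_prod \<mu> \<nu> (Suc j) = lommel_prod \<mu> \<nu> j * ((\<mu> - 2 * of_nat (Suc j) + 1)^2 - \<nu>^2)"
  by (simp add: lommel_prod_def)

lemma lommel_prod_shift:
  "lommel_prod (\<mu> + 2) \<nu> (Suc j) = ((\<mu> + 1)^2 - \<nu>^2) * lommel_prod \<mu> \<nu> j"
proof (induction j)
  case (Suc j)
  show ?case unfolding lommel_prod_Suc [of "\<mu> + 2" _ "Suc j"] Suc lommel_prod_Suc [of \<mu> _ j]
    by (simp add: algebra_simps)
qed (simp add: lommel_prod_def algebra_simps)

lemma lommel_sum_eq:
  "lommel_sum \<mu> \<nu> p z = (\<Sum>j\<le>p. (-1)^j * lommel_prod \<mu> \<nu> j * exp ((\<mu> - 1 - 2 * of_nat j) * z))"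
proof -
  have "exp ((\<mu> - 1 - 2 * of_nat j) * z) = exp ((\<mu> - 1) * z) / exp (2 * of_nat j * z)" for j
    by (simp add: exp_diff [symmetric] algebra_simps)
  thus ?thesis unfolding lommel_sum_def sum_distrib_left by (simp add: mult_ac)
qed

text \<open>The same recurrence in \<mu> as in \<open>lommel_ii_Suc\<close>, so a closed form valid
  for p carries over to p + 1.\<close>

lemma lommel_sum_shift:
  "lommel_sum (\<mu> + 2) \<nu> (Suc q) z = exp ((\<mu> + 1) * z) - ((\<mu> + 1)^2 - \<nu>^2) * lommel_sum \<mu> \<nu> q z"
proof -
  have e: "\<mu> + 2 - 1 - 2 * of_nat (Suc j) = \<mu> - 1 - 2 * of_nat j" for j by simp
  define D where "D = (\<mu> + 1)^2 - \<nu>^2"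
  have "(\<Sum>j\<le>q. (-1) ^ Suc j * (D * lommel_prod \<mu> \<nu> j) * exp ((\<mu> - 1 - 2 * of_nat j) * z))
    = (\<Sum>j\<le>q. (- D) * ((-1) ^ j * lommel_prod \<mu> \<nu> j * exp ((\<mu> - 1 - 2 * of_nat j) * z)))"
    by (intro sum.cong refl) simp
  hence "(\<Sum>j\<le>q. (-1) ^ Suc j * (D * lommel_prod \<mu> \<nu> j) * exp ((\<mu> - 1 - 2 * of_nat j) * z))
    = (- D) * (\<Sum>j\<le>q. (-1) ^ j * lommel_prod \<mu> \<nu> j * exp ((\<mu> - 1 - 2 * of_nat j) * z))"
    by (simp only: sum_distrib_left)
  thus ?thesis
    unfolding lommel_sum_eq sum.atMost_Suc_shift lommel_prod_shift e D_def [symmetric]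
    by (simp add: lommel_prod_def add.commute)
qed

text \<open>The factor with m = p + 1 is (\<mu> - 2p - 1)^2 - \<nu>^2 = 0, so every later
  coefficient vanishes.\<close>

lemma lommel_sum_mono:
  assumes "\<mu> + \<nu> = 2 * of_nat p + 1 \<or> \<mu> - \<nu> = 2 * of_nat p + 1" "p \<le> q"
  shows "lommel_sum \<mu> \<nu> q z = lommel_sum \<mu> \<nu> p z"
proof -
  have "lommel_prod \<mu> \<nu> j = 0" if "j > p" for j
  proof -
    have "(\<mu> - 2 * of_nat (Suc p) + 1)^2 - \<nu>^2 = (\<mu> + \<nu> - 2 * of_nat p - 1) * (\<mu> - \<nu> - 2 * of_nat p - 1)"
      by (simp add: algebra_simps power2_eq_square)
    also have "\<dots> = 0" using assms(1) by auto
    finally show ?thesis using that unfolding lommel_prod_def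
      by (intro prod_zero) (auto intro!: bexI [of _ "Suc p"])
  qed
  thus ?thesis unfolding lommel_sum_def using assms(2)
    by (intro arg_cong2 [where f = "(*)"] refl sum.mono_neutral_right) auto
qed

text \<open>If \<mu> + \<nu> and \<mu> - \<nu> are both positive odd integers, two values of p
  qualify; the sums agree, since the longer one only adds zeros.\<close>

lemma lommel_sum_unique:
  assumes "\<mu> + \<nu> = 2 * of_nat p + 1 \<or> \<mu> - \<nu> = 2 * of_nat p + 1"
    and "\<mu> + \<nu> = 2 * of_nat q + 1 \<or> \<mu> - \<nu> = 2 * of_nat q + 1"
  shows "lommel_sum \<mu> \<nu> q z = lommel_sum \<mu> \<nu> p z"
  using lommel_sum_mono [OF assms(1), of q z] lommel_sum_mono [OF assms(2), of p z]
  by (metis nat_le_linear)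

lemma lommel_sum_minus: "lommel_sum \<mu> (- \<nu>) p z = lommel_sum \<mu> \<nu> p z"
  by (simp add: lommel_sum_def lommel_prod_def)

text \<open>Here Y is given by the integer formula and its logarithmic part cancels in
  \<open>lommel_nu_m1_eq\<close>. What remains is the polar part, a finite sum, read backwards to
  get descending powers.\<close>

lemma lommel_nu_m1_nat:
  "lommel_nu_m1 (of_nat (Suc N)) z = lommel_sum (of_nat N) (of_nat (Suc N)) N z"
proof -
  define w where "w = z - ln2c"
  define n where "n = Suc N"
  have nn: "of_nat n \<noteq> - (of_nat m :: complex)" for m
  proof
    assume "of_nat n = - (of_nat m :: complex)"
    hence "of_nat (n + m) = (0 :: complex)" by simp
    thus False unfolding of_nat_eq_0_iff by (simp add: n_def)
  qed
  have "of_nat n \<in> (\<int> :: complex set)" by simp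
  hence Y: "besselY_exp (of_nat n) z = besselY_nat_exp n z" by (simp add: besselY_exp_def)
  have G: "Gamma (of_nat n :: complex) = fact N"
    using Gamma_fact [of N, where ?'a = complex] by (simp add: n_def add_ac)
  have "lommel_nu_m1 (of_nat n) z = fact N * 2 powr (of_nat n - 2) * bessel_polar n w"
    unfolding lommel_nu_m1_eq [OF nn] G Y besselY_nat_exp_eq by (simp add: w_def)
  also have "bessel_polar n w = (\<Sum>k<n. of_nat (fact (n - k - 1)) / of_nat (fact k) * exp ((- of_nat n + 2 * of_nat k) * w))"
    unfolding bessel_polar_def exp_series_def
    by (subst suminf_finite [of "{..<n}"]) (auto simp: polar_coeff_def intro!: sum.cong)
  also have "\<dots> = (\<Sum>j<n. of_nat (fact j) / of_nat (fact (N - j)) * exp ((- of_nat n + 2 * of_nat (N - j)) * w))"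
    by (subst sum.nat_diff_reindex [symmetric]) (auto simp: n_def intro!: sum.cong)
  also have "fact N * 2 powr (of_nat n - 2) * \<dots> =
     (\<Sum>j<n. (-1)^j * lommel_prod (of_nat N) (of_nat n) j * exp ((of_nat N - 1 - 2 * of_nat j) * z))"
    unfolding sum_distrib_left
  proof (intro sum.cong refl)
    fix j assume "j \<in> {..<n}"
    hence j: "j \<le> N" by (simp add: n_def)
    \<comment> \<open>For \<mu> = N and \<nu> = N + 1 the next factor is (N - 2j - 1)^2 - (N + 1)^2
      = -4 (j + 1)(N - j), so the product becomes factorials.\<close>
    have P: "(-1)^j * lommel_prod (of_nat N) (of_nat n) j = 4 ^ j * fact N * of_nat (fact j) / of_nat (fact (N - j))"
      using j
    proof (induction j)
      case (Suc j)
      then obtain l where l: "N = Suc (j + l)" using less_imp_Suc_add [of j N] by auto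
      have "(-1)^Suc j * lommel_prod (of_nat N) (of_nat n) (Suc j)
        = ((-1)^j * lommel_prod (of_nat N) (of_nat n) j) * (4 * (of_nat j + 1) * (of_nat l + 1))"
        unfolding lommel_prod_Suc l n_def by (simp add: algebra_simps power2_eq_square)
      also have "\<dots> = 4 ^ Suc j * fact N * of_nat (fact (Suc j)) / of_nat (fact (N - Suc j))"
      proof -
        have nz: "of_nat l + 1 \<noteq> (0::complex)" by (metis add.commute of_nat_Suc of_nat_neq_0)
        have gen: "a / (L * F) * (4 * J * L) = a * (4 * J) / F" if "L \<noteq> 0" for a L F J :: complex
          using that by (cases "F = 0") (simp_all add: field_simps)
        have "(-1)^j * lommel_prod (of_nat N) (of_nat n) j = 4 ^ j * fact N * of_nat (fact j) / of_nat (fact (N - j))"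
          using Suc by simp
        also have "N - j = Suc l" using l by simp
        finally have h: "(-1)^j * lommel_prod (of_nat N) (of_nat n) j = 4 ^ j * fact N * fact j / ((of_nat l + 1) * fact l)"
          by (simp add: algebra_simps)
        have "N - Suc j = l" using l by simp
        thus ?thesis unfolding h gen [OF nz] by (simp add: algebra_simps)
      qed
      finally show ?case .
    qed (simp add: lommel_prod_def)
    have Nj: "of_nat (N - j) = (of_nat N - of_nat j :: complex)" using j by (simp add: of_nat_diff)
    have "2 powr (of_nat n - 2) * exp ((- of_nat n + 2 * of_nat (N - j)) * w) =
       exp ((of_nat n - 2) * ln2c + (- of_nat n + 2 * of_nat (N - j)) * w)"
      by (simp add: complex_powr_2 exp_add)
    also have "(of_nat n - 2) * ln2c + (- of_nat n + 2 * of_nat (N - j)) * w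
      = of_nat j * (2 * ln2c) + (of_nat N - 1 - 2 * of_nat j) * z"
      unfolding Nj w_def n_def by (simp add: algebra_simps)
    also have "exp \<dots> = 4 ^ j * exp ((of_nat N - 1 - 2 * of_nat j) * z)"
      unfolding exp_add exp_of_nat_mult exp_ln2c ..
    finally have E: "2 powr (of_nat n - 2) * exp ((- of_nat n + 2 * of_nat (N - j)) * w) = 4 ^ j * exp ((of_nat N - 1 - 2 * of_nat j) * z)" .
    have "fact N * 2 powr (of_nat n - 2) * (of_nat (fact j) / of_nat (fact (N - j)) * exp ((- of_nat n + 2 * of_nat (N - j)) * w))
       = fact N * (of_nat (fact j) / of_nat (fact (N - j))) * (2 powr (of_nat n - 2) * exp ((- of_nat n + 2 * of_nat (N - j)) * w))"
      by (simp only: mult_ac)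
    thus "fact N * 2 powr (of_nat n - 2) * (of_nat (fact j) / of_nat (fact (N - j)) * exp ((- of_nat n + 2 * of_nat (N - j)) * w))
       = (-1)^j * lommel_prod (of_nat N) (of_nat n) j * exp ((of_nat N - 1 - 2 * of_nat j) * z)"
      unfolding E P by simp
  qed
  also have "\<dots> = lommel_sum (of_nat N) (of_nat n) N z"
    unfolding lommel_sum_eq n_def lessThan_Suc_atMost ..
  finally show ?thesis by (simp only: n_def)
qed

text \<open>The order p + q + 1 stays fixed while the recurrence lowers \<mu> by 2: the pair (p + 1,
  q) is reached from (p, q + 1), so q must vary in the induction. The factor -4(p + 1)(q + 1)
  divided by is not 0.\<close>

lemma lommel_ii_closed:
  "lommel_ii (of_nat (p + q + 1)) p z = lommel_sum (of_nat (p + q + 1) - 2 * of_nat p - 1) (of_nat (p + q + 1)) q z"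
proof (induction p arbitrary: q)
  case 0
  show ?case using lommel_nu_m1_nat [of q z] by (simp add: lommel_ii_def)
next
  case (Suc p)
  define n where "n = Suc p + q + 1"
  define \<mu> where "\<mu> = of_nat n - 2 * of_nat p - (3 :: complex)"
  define D :: complex where "D = 4 * (of_nat p + 1) * (of_nat p + 1 - of_nat n)"
  have n': "n = p + Suc q + 1" by (simp add: n_def)
  have IH: "lommel_ii (of_nat n) p z = lommel_sum (\<mu> + 2) (of_nat n) (Suc q) z"
    using Suc.IH [of "Suc q"] unfolding n' [symmetric] by (simp add: \<mu>_def algebra_simps)
  have D: "D = - 4 * of_nat (p + 1) * of_nat (q + 1)" by (simp add: D_def n_def algebra_simps)
  have "D \<noteq> 0" unfolding D by (simp del: of_nat_add of_nat_Suc)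
  moreover have e1: "(\<mu> + 1)^2 - (of_nat n)^2 = D" by (simp add: D_def \<mu>_def algebra_simps power2_eq_square)
  moreover have e2: "of_nat n - 2 * of_nat p - 2 = \<mu> + 1" by (simp add: \<mu>_def)
  ultimately have "lommel_ii (of_nat n) (Suc p) z = lommel_sum \<mu> (of_nat n) q z"
    unfolding lommel_ii_Suc IH lommel_sum_shift D_def [symmetric] e1 e2 by simp
  moreover have "\<mu> = of_nat n - 2 * of_nat (Suc p) - 1" by (simp add: \<mu>_def)
  ultimately show ?case by (simp only: n_def)
qed

section \<open>Periodic entire functions\<close>

text \<open>Integral over one vertical period; applied to G e^(-2nz) with G of period \<pi>i it is
  \<pi>i times the coefficient of e^(2nz).\<close>

definition vint :: "complex \<Rightarrow> (complex \<Rightarrow> complex) \<Rightarrow> complex" where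
  "vint x H = contour_integral (linepath x (x + of_real pi * \<i>)) H"

lemma vint_primitive:
  assumes "\<And>z. (P has_field_derivative H z) (at z)"
  shows "vint x H = P (x + of_real pi * \<i>) - P x"
proof -
  have "(H has_contour_integral (P (pathfinish (linepath x (x + of_real pi * \<i>))) - P (pathstart (linepath x (x + of_real pi * \<i>)))))
     (linepath x (x + of_real pi * \<i>))"
    by (rule contour_integral_primitive [of UNIV]) (use assms in auto)
  thus ?thesis unfolding vint_def by (simp add: contour_integral_unique)
qed

lemma entire_primitive:
  assumes "H holomorphic_on UNIV"
  obtains P where "\<And>z. (P has_field_derivative H z) (at z)"
  using holomorphic_convex_primitive' [OF convex_UNIV open_UNIV assms] by (metis UNIV_I)

text \<open>Cauchy's theorem on a parallelogram in terms of a primitive: P(z + \<pi>i) - P(z) has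
  derivative 0 by periodicity.\<close>

lemma vint_shift:
  assumes "H holomorphic_on UNIV" and per: "\<And>z. H (z + of_real pi * \<i>) = H z"
  shows "vint x H = vint y H"
proof -
  obtain P where P: "\<And>z. (P has_field_derivative H z) (at z)" using entire_primitive assms by blast
  have "((\<lambda>x. P (x + of_real pi * \<i>) - P x) has_field_derivative 0) (at x)" for x
  proof -
    have "((\<lambda>x. P (x + of_real pi * \<i>)) has_field_derivative H (x + of_real pi * \<i>)) (at x)"
      by (rule DERIV_shift [THEN iffD1, OF P])
    from DERIV_diff [OF this P] show ?thesis by (simp add: per)
  qed
  hence "\<exists>c. \<forall>x\<in>UNIV. P (x + of_real pi * \<i>) - P x = c"
    by (intro has_field_derivative_zero_constant) auto
  hence "P (x + of_real pi * \<i>) - P x = P (y + of_real pi * \<i>) - P y" by auto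
  thus ?thesis by (simp add: vint_primitive [OF P])
qed

lemma vint_integrable: "H holomorphic_on UNIV \<Longrightarrow> H contour_integrable_on linepath a b"
  by (intro contour_integrable_continuous_linepath holomorphic_on_imp_continuous_on)
     (rule holomorphic_on_subset, auto)

lemma norm_vint_le:
  assumes "H holomorphic_on UNIV" and "\<And>y. 0 \<le> y \<Longrightarrow> y \<le> pi \<Longrightarrow> norm (H (x + of_real y * \<i>)) \<le> B"
  shows "norm (vint x H) \<le> pi * B"
proof -
  have B: "B \<ge> 0" by (rule order_trans [OF norm_ge_zero assms(2) [of 0]]) auto
  have "norm (vint x H) \<le> B * norm (x + of_real pi * \<i> - x)"
    unfolding vint_def
  proof (rule contour_integral_bound_linepath)
    show "H contour_integrable_on linepath x (x + of_real pi * \<i>)"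
      by (rule vint_integrable [OF assms(1)])
    fix z assume "z \<in> closed_segment x (x + of_real pi * \<i>)"
    then obtain u where u: "0 \<le> u" "u \<le> 1" "z = (1 - u) *\<^sub>R x + u *\<^sub>R (x + of_real pi * \<i>)"
      by (auto simp: closed_segment_def)
    have "z = x + of_real (u * pi) * \<i>" using u(3) by (simp add: scaleR_conv_of_real algebra_simps)
    thus "norm (H z) \<le> B" using assms(2) [of "u * pi"] u mult_right_mono [of u 1 pi] by simp
  qed (rule B)
  thus ?thesis by (simp add: norm_mult mult.commute)
qed

lemma vint_add:
  "H holomorphic_on UNIV \<Longrightarrow> G holomorphic_on UNIV \<Longrightarrow> vint x (\<lambda>z. H z + G z) = vint x H + vint x G"
  unfolding vint_def by (intro contour_integral_add vint_integrable)

lemma vint_cmult: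
  "H holomorphic_on UNIV \<Longrightarrow> vint x (\<lambda>z. c * H z) = c * vint x H"
  unfolding vint_def by (intro contour_integral_lmul vint_integrable)

lemma exp_pi_periodic: "exp (of_int n * 2 * (z + of_real pi * \<i>)) = exp (of_int n * 2 * z :: complex)"
proof -
  have "of_int n * 2 * (z + of_real pi * \<i>) = of_int n * 2 * z + 2 * of_int n * of_real pi * \<i>"
    by (simp add: algebra_simps)
  thus ?thesis by (simp add: exp_add exp_plus_2pin mult.commute mult.left_commute)
qed

lemma vint_exp:
  "vint x (\<lambda>z. exp (of_int n * 2 * z)) = (if n = 0 then of_real pi * \<i> else 0)"
proof (cases "n = 0")
  case True
  have "((\<lambda>z. z) has_field_derivative 1) (at z)" for z :: complex by (rule DERIV_ident)
  from vint_primitive [OF this] True show ?thesis by simp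
next
  case False
  have "((\<lambda>z. exp (of_int n * 2 * z) / (of_int n * 2)) has_field_derivative exp (of_int n * 2 * z)) (at z)" for z :: complex
    using False by (auto intro!: derivative_eq_intros)
  from vint_primitive [OF this] False show ?thesis by (simp only: exp_pi_periodic) simp
qed

lemma exp_decay_zero:
  assumes "\<And>n::nat. norm (c :: complex) \<le> C * q ^ n" "0 \<le> q" "q < 1"
  shows "c = 0"
proof -
  have "(\<lambda>n. C * q ^ n) \<longlonglongrightarrow> C * 0"
    by (intro tendsto_mult tendsto_const LIMSEQ_power_zero) (use assms in simp)
  hence "norm c \<le> C * 0" by (rule LIMSEQ_le_const) (use assms in auto)
  thus ?thesis by simp
qed

text \<open>Completeness of the exponentials, by dividing \<open>G - G z0\<close> by \<open>e\<^sup>2\<^sup>z - e\<^sup>2\<^sup>z\<^sup>0\<close>: the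
  coefficients of the quotient form geometric sequences in both directions, which
  the bounds obtained by moving the line of integration make vanish.\<close>
lemma periodic_eq_0:
  assumes G: "G holomorphic_on UNIV" and per: "\<And>z. G (z + of_real pi * \<i>) = G z"
    and zero: "\<And>n. vint 0 (\<lambda>z. G z * exp (of_int n * 2 * z)) = 0"
  shows "G z0 = 0"
proof -
  have perk: "G (z + of_int k * (of_real pi * \<i>)) = G z" for z k
  proof (induction k rule: int_induct [where k = 0])
    case (step1 i)
    have "z + of_int (i + 1) * (of_real pi * \<i>) = (z + of_int i * (of_real pi * \<i>)) + of_real pi * \<i>"
      by (simp add: algebra_simps)
    thus ?case using step1 per by metis
  next
    case (step2 i)
    have "z + of_int i * (of_real pi * \<i>) = (z + of_int (i - 1) * (of_real pi * \<i>)) + of_real pi * \<i>"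
      by (simp add: algebra_simps)
    thus ?case using step2 per by metis
  qed simp
  have Geq: "G u = G v" if uv: "exp (2 * u) = exp (2 * v)" for u v
  proof -
    obtain k where "2 * u = 2 * v + of_int (2 * k) * pi * \<i>" using uv unfolding exp_eq by blast
    hence "2 * u = 2 * (v + of_int k * (of_real pi * \<i>))" by (simp add: algebra_simps)
    hence "u = v + of_int k * (of_real pi * \<i>)" by (metis mult_left_cancel zero_neq_numeral)
    thus ?thesis using perk by simp
  qed
  \<comment> \<open>G as a function of w = e^(2z) on the punctured plane. By \<open>Geq\<close> the
    choice of the logarithm does not matter.\<close>
  define \<phi> where "\<phi> = (\<lambda>w. G (Ln w / 2))"
  have G': "G holomorphic_on S" for S using G holomorphic_on_subset by blast
  have GG: "(\<lambda>w. G (f w)) holomorphic_on S" if "f holomorphic_on S" for f S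
    using holomorphic_on_compose [OF that G'] by (simp add: o_def)
  have "\<phi> field_differentiable (at w)" if "w \<noteq> 0" for w
  proof -
    \<comment> \<open>A second logarithm, with its cut on the positive axis, gives differentiability
      across the negative axis.\<close>
    have *: "\<phi> u = G ((Ln (- u) + of_real pi * \<i>) / 2)" if "u \<noteq> 0" for u
    proof -
      have "2 * (X / 2) = X" for X :: complex by simp
      thus ?thesis unfolding \<phi>_def by (intro Geq) (use that in \<open>simp only: exp_add exp_Ln, simp\<close>)
    qed
    show ?thesis
    proof (cases "w \<in> \<real>\<^sub>\<le>\<^sub>0")
      case False
      have "\<phi> holomorphic_on - \<real>\<^sub>\<le>\<^sub>0" unfolding \<phi>_def
        by (rule GG) (auto intro!: holomorphic_intros)
      thus ?thesis
        by (rule holomorphic_on_imp_differentiable_at) (use False in \<open>auto simp: open_Compl closed_nonpos_Reals_complex\<close>)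
    next
      case True
      let ?S = "uminus -` (- \<real>\<^sub>\<le>\<^sub>0) :: complex set"
      have S: "open ?S"
        by (intro open_vimage continuous_intros open_Compl closed_nonpos_Reals_complex)
      have "(\<lambda>u. G ((Ln (- u) + of_real pi * \<i>) / 2)) holomorphic_on ?S"
        by (rule GG) (auto intro!: holomorphic_intros)
      hence "\<phi> holomorphic_on ?S"
        by (rule holomorphic_transform) (rule * [symmetric], auto)
      moreover have "w \<in> ?S" using True \<open>w \<noteq> 0\<close>
        by (auto simp: complex_nonpos_Reals_iff complex_eq_iff)
      ultimately show ?thesis by (intro holomorphic_on_imp_differentiable_at [OF _ S])
    qed
  qed
  hence \<phi>: "\<phi> holomorphic_on - {0}"
    by (auto simp: holomorphic_on_def intro: field_differentiable_at_within)
  define w0 where "w0 = exp (2 * z0)"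
  \<comment> \<open>The singularity of the difference quotient at w0 is removable, so the quotient
    is again periodic and entire in z.\<close>
  define \<psi> where "\<psi> = (\<lambda>w. if w = w0 then deriv \<phi> w0 else (\<phi> w - \<phi> w0) / (w - w0))"
  have \<psi>: "\<psi> holomorphic_on - {0}" unfolding \<psi>_def by (rule pole_lemma_open [OF \<phi>]) auto
  define q where "q = (\<lambda>z. \<psi> (exp (2 * z)))"
  have q: "q holomorphic_on UNIV"
  proof -
    have "(\<psi> \<circ> (\<lambda>z. exp (2 * z))) holomorphic_on UNIV"
      by (rule holomorphic_on_compose_gen [OF _ \<psi>]) (auto intro!: holomorphic_intros)
    thus ?thesis by (simp add: q_def o_def)
  qed
  have qper: "q (z + of_real pi * \<i>) = q z" for z
    using exp_pi_periodic [of 1 z] by (simp add: q_def)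
  have \<phi>e: "\<phi> (exp (2 * z)) = G z" for z
    unfolding \<phi>_def by (rule Geq) simp
  have eq: "G z + (- G z0) = (exp (2 * z) - w0) * q z" for z
    using \<phi>e [of z] \<phi>e [of z0] unfolding q_def \<psi>_def w0_def by auto
  define B where "B = (\<lambda>n. vint 0 (\<lambda>z. q z * exp (of_int n * 2 * z)))"
  have hq: "(\<lambda>z. q z * exp (of_int n * 2 * z)) holomorphic_on UNIV"
    and hG: "(\<lambda>z. G z * exp (of_int n * 2 * z)) holomorphic_on UNIV"
    and he: "(\<lambda>z. c * exp (of_int n * 2 * z)) holomorphic_on UNIV" "(\<lambda>z. exp (of_int n * 2 * z)) holomorphic_on UNIV"
    and hq': "(\<lambda>z. c * (q z * exp (of_int n * 2 * z))) holomorphic_on UNIV" for n c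
    by (intro holomorphic_intros q G)+
  \<comment> \<open>All coefficients of G vanish, so only the constant G z0 contributes, and only at
    n = 0.\<close>
  have rec: "B (n + 1) - w0 * B n = - G z0 * (if n = 0 then of_real pi * \<i> else 0)" for n
  proof -
    have "B (n + 1) + (- w0) * B n = vint 0 (\<lambda>z. q z * exp (of_int (n + 1) * 2 * z) + (- w0) * (q z * exp (of_int n * 2 * z)))"
      unfolding B_def by (simp only: vint_add vint_cmult hq hq')
    also have "(\<lambda>z. q z * exp (of_int (n + 1) * 2 * z) + (- w0) * (q z * exp (of_int n * 2 * z)))
      = (\<lambda>z. G z * exp (of_int n * 2 * z) + (- G z0) * exp (of_int n * 2 * z))"
    proof
      fix z :: complex
      have "exp (of_int (n + 1) * 2 * z) = exp (2 * z) * exp (of_int n * 2 * z)"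
        by (simp add: exp_add [symmetric] algebra_simps)
      hence "q z * exp (of_int (n + 1) * 2 * z) + (- w0) * (q z * exp (of_int n * 2 * z))
         = ((exp (2 * z) - w0) * q z) * exp (of_int n * 2 * z)" by (simp add: algebra_simps)
      thus "q z * exp (of_int (n + 1) * 2 * z) + (- w0) * (q z * exp (of_int n * 2 * z))
        = G z * exp (of_int n * 2 * z) + (- G z0) * exp (of_int n * 2 * z)"
        unfolding eq [symmetric] by (simp add: algebra_simps)
    qed
    also have "vint 0 \<dots> = - G z0 * (if n = 0 then of_real pi * \<i> else 0)"
      by (simp only: vint_add vint_cmult hG he zero vint_exp) simp
    finally show ?thesis by simp
  qed
  have w0: "w0 \<noteq> 0" "norm w0 = exp (2 * Re z0)" by (simp_all add: w0_def)
  \<comment> \<open>Each vertical line Re z = x gives one exponential bound for all n; the line is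
    chosen to suit the direction.\<close>
  have bound: "\<exists>C. \<forall>n. norm (B n) \<le> C * exp (2 * of_int n * x)" for x
  proof -
    have "compact (q ` (\<lambda>y. of_real x + of_real y * \<i>) ` {0..pi})"
      by (intro compact_continuous_image holomorphic_on_imp_continuous_on [OF holomorphic_on_subset [OF q]] continuous_intros) auto
    hence "bounded (q ` (\<lambda>y. of_real x + of_real y * \<i>) ` {0..pi})" by (rule compact_imp_bounded)
    then obtain M where "\<forall>u\<in>q ` (\<lambda>y. of_real x + of_real y * \<i>) ` {0..pi}. norm u \<le> M"
      unfolding bounded_iff by blast
    hence M: "norm (q (of_real x + of_real y * \<i>)) \<le> M" if "0 \<le> y" "y \<le> pi" for y
      using that by auto
    have "norm (B n) \<le> pi * (M * exp (2 * of_int n * x))" for n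
    proof -
      have "B n = vint (of_real x) (\<lambda>z. q z * exp (of_int n * 2 * z))"
        unfolding B_def by (rule vint_shift [OF hq]) (simp only: qper exp_pi_periodic)
      also have "norm \<dots> \<le> pi * (M * exp (2 * of_int n * x))"
      proof (rule norm_vint_le)
        fix y assume "0 \<le> y" "y \<le> pi"
        thus "norm (q (of_real x + of_real y * \<i>) * exp (of_int n * 2 * (of_real x + of_real y * \<i>)))
            \<le> M * exp (2 * of_int n * x)"
          using mult_right_mono [OF M [of y], of "exp (2 * of_int n * x)"] by (simp add: norm_mult mult_ac)
      qed (rule hq)
      finally show ?thesis .
    qed
    thus ?thesis by (metis mult.assoc)
  qed
  have B1: "B 1 = 0"
  proof -
    have g: "B (int n + 1) = w0 ^ n * B 1" for n
    proof (induction n)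
      case (Suc n)
      thus ?case using rec [of "int n + 1"] by (simp add: add_ac)
    qed simp
    \<comment> \<open>A line to the left of z0: for n > 0 the coefficients grow exactly like w0^n,
      but the bound is smaller by e^(-2n).\<close>
    obtain C where C: "\<And>n. norm (B n) \<le> C * exp (2 * of_int n * (Re z0 - 1))" using bound by blast
    have "norm (B 1) \<le> (C * exp (2 * (Re z0 - 1))) * exp (-2) ^ n" for n
    proof -
      have "exp (2 * Re z0) ^ n * norm (B 1) \<le> C * exp (2 * (real n + 1) * (Re z0 - 1))"
        using C [of "int n + 1"] unfolding g norm_mult norm_power w0 by (simp add: add_ac)
      also have "2 * (real n + 1) * (Re z0 - 1) = 2 * (Re z0 - 1) + (of_nat n * (2 * Re z0) + of_nat n * (-2))"
        by (simp add: algebra_simps)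
      also have "C * exp \<dots> = exp (2 * Re z0) ^ n * ((C * exp (2 * (Re z0 - 1))) * exp (-2) ^ n)"
        by (simp only: exp_add exp_of_nat_mult) simp
      finally show ?thesis by simp
    qed
    thus ?thesis by (rule exp_decay_zero) auto
  qed
  have B0: "B 0 = 0"
  proof -
    have g: "w0 ^ n * B (- int n) = B 0" for n
    proof (induction n)
      case (Suc n)
      have "B (- int n) = w0 * B (- int (Suc n))" using rec [of "- int (Suc n)"] by simp
      thus ?case using Suc by (simp add: mult_ac)
    qed simp
    \<comment> \<open>For n -> -\<infinity> the line lies to the right of z0.\<close>
    obtain C where C: "\<And>n. norm (B n) \<le> C * exp (2 * of_int n * (Re z0 + 1))" using bound by blast
    have "norm (B 0) \<le> C * exp (-2) ^ n" for n
    proof -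
      have "norm (B 0) \<le> exp (2 * Re z0) ^ n * (C * exp (2 * (- real n) * (Re z0 + 1)))"
        using mult_left_mono [OF C [of "- int n"], of "norm (w0 ^ n)"]
        unfolding g [of n, symmetric] norm_mult norm_power w0 by simp
      also have "2 * (- real n) * (Re z0 + 1) = of_nat n * (- (2 * Re z0)) + of_nat n * (-2)"
        by (simp add: algebra_simps)
      also have "exp (2 * Re z0) ^ n * (C * exp \<dots>) = C * exp (-2) ^ n * (exp (2 * Re z0) * exp (- (2 * Re z0))) ^ n"
        by (simp only: exp_add exp_of_nat_mult power_mult_distrib mult_ac)
      finally show ?thesis by (simp add: exp_add [symmetric])
    qed
    thus ?thesis by (rule exp_decay_zero) auto
  qed
  show ?thesis using rec [of 0] B0 B1 by simp
qed

section \<open>Finite growth\<close>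

text \<open>Finite order in a form that is stable under sums, products and translations. The base 1
  + |z| >= 1 makes the bound increase with N, so two functions can share their constants.\<close>

definition fin_growth :: "(complex \<Rightarrow> complex) \<Rightarrow> bool" where
  "fin_growth f \<longleftrightarrow> (\<exists>K\<ge>0. \<exists>N. \<forall>z. norm (f z) \<le> exp (K * (1 + norm z) ^ N))"

lemma fin_growthI:
  "K \<ge> 0 \<Longrightarrow> (\<And>z. norm (f z) \<le> exp (K * (1 + norm z) ^ N)) \<Longrightarrow> fin_growth f"
  unfolding fin_growth_def by blast

lemma fin_growthE:
  assumes "fin_growth f" "fin_growth g"
  obtains K N where "K \<ge> 0" "\<And>z. norm (f z) \<le> exp (K * (1 + norm z) ^ N)"
    "\<And>z. norm (g z) \<le> exp (K * (1 + norm z) ^ N)"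
proof -
  obtain K N K' N' where 1: "K \<ge> 0" "K' \<ge> 0" "\<And>z. norm (f z) \<le> exp (K * (1 + norm z) ^ N)"
     "\<And>z. norm (g z) \<le> exp (K' * (1 + norm z) ^ N')"
    using assms unfolding fin_growth_def by blast
  have "K * (1 + norm z) ^ N \<le> (K + K') * (1 + norm z) ^ (N + N')"
    "K' * (1 + norm z) ^ N' \<le> (K + K') * (1 + norm z) ^ (N + N')" for z :: complex
    using 1 by (auto intro!: mult_mono power_increasing)
  hence "norm (f z) \<le> exp ((K + K') * (1 + norm z) ^ (N + N'))"
    "norm (g z) \<le> exp ((K + K') * (1 + norm z) ^ (N + N'))" for z
    using 1(3,4) [of z] order_trans exp_le_cancel_iff by meson+
  thus thesis using 1(1,2) by (intro that [of "K + K'"]) auto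
qed

lemma fin_growth_mult:
  assumes "fin_growth f" "fin_growth g"
  shows "fin_growth (\<lambda>z. f z * g z)"
proof -
  obtain K N where 1: "K \<ge> 0" "\<And>z. norm (f z) \<le> exp (K * (1 + norm z) ^ N)"
    "\<And>z. norm (g z) \<le> exp (K * (1 + norm z) ^ N)"
    using fin_growthE [OF assms] by blast
  have "norm (f z * g z) \<le> exp ((2 * K) * (1 + norm z) ^ N)" for z
  proof -
    have "norm (f z * g z) \<le> exp (K * (1 + norm z) ^ N) * exp (K * (1 + norm z) ^ N)"
      unfolding norm_mult by (intro mult_mono 1) auto
    thus ?thesis by (simp add: exp_add [symmetric] mult.assoc)
  qed
  thus ?thesis using 1(1) by (intro fin_growthI [of "2 * K"]) auto
qed

lemma fin_growth_add:
  assumes "fin_growth f" "fin_growth g"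
  shows "fin_growth (\<lambda>z. f z + g z)"
proof -
  obtain K N where 1: "K \<ge> 0" "\<And>z. norm (f z) \<le> exp (K * (1 + norm z) ^ N)"
    "\<And>z. norm (g z) \<le> exp (K * (1 + norm z) ^ N)"
    using fin_growthE [OF assms] by blast
  have "norm (f z + g z) \<le> exp ((K + 1) * (1 + norm z) ^ N)" for z
  proof -
    have "norm (f z + g z) \<le> 2 * exp (K * (1 + norm z) ^ N)"
      using norm_triangle_ineq [of "f z" "g z"] 1(2,3) [of z] by linarith
    also have "\<dots> \<le> exp 1 * exp (K * (1 + norm z) ^ N)"
      using exp_ge_add_one_self [of 1] by (intro mult_right_mono) auto
    also have "\<dots> = exp (K * (1 + norm z) ^ N + 1)" by (simp add: exp_add)
    also have "\<dots> \<le> exp ((K + 1) * (1 + norm z) ^ N)"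
      by (simp add: distrib_right)
    finally show ?thesis .
  qed
  thus ?thesis using 1(1) by (intro fin_growthI [of "K + 1"]) auto
qed

lemma fin_growth_exp: "fin_growth (\<lambda>z. exp (a * z))"
proof -
  have "norm (exp (a * z)) \<le> exp (norm a * (1 + norm z) ^ 1)" for z
  proof -
    have "Re (a * z) \<le> norm a * norm z" using complex_Re_le_cmod [of "a * z"] by (simp add: norm_mult)
    also have "\<dots> \<le> norm a * (1 + norm z) ^ 1" by (simp add: mult_left_mono)
    finally show ?thesis by simp
  qed
  thus ?thesis by (intro fin_growthI [of "norm a" _ 1]) auto
qed

lemma fin_growth_const: "fin_growth (\<lambda>z. c)"
proof -
  have "norm c \<le> exp (norm c * (1 + norm z) ^ 0)" for z :: complex
    using order_trans [OF _ exp_ge_add_one_self [of "norm c"], of "norm c"] by simp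
  thus ?thesis by (intro fin_growthI [of "norm c" _ 0]) auto
qed

lemma fin_growth_shift:
  assumes "fin_growth f"
  shows "fin_growth (\<lambda>z. f (z + c))"
proof -
  obtain K N where 1: "K \<ge> 0" "\<And>z. norm (f z) \<le> exp (K * (1 + norm z) ^ N)"
    using assms unfolding fin_growth_def by blast
  have "norm (f (z + c)) \<le> exp (K * (1 + norm c) ^ N * (1 + norm z) ^ N)" for z
  proof -
    have "1 + norm (z + c) \<le> (1 + norm c) * (1 + norm z)"
      using norm_triangle_ineq [of z c] mult_nonneg_nonneg [OF norm_ge_zero norm_ge_zero, of c z]
      unfolding distrib_left distrib_right by linarith
    hence "K * (1 + norm (z + c)) ^ N \<le> K * ((1 + norm c) * (1 + norm z)) ^ N"
      using 1(1) by (intro mult_left_mono power_mono) auto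
    thus ?thesis using 1(2) [of "z + c"] by (simp add: power_mult_distrib mult.assoc order_trans [OF _ exp_le_cancel_iff [THEN iffD2]])
  qed
  thus ?thesis using 1(1) by (intro fin_growthI [of "K * (1 + norm c) ^ N"]) auto
qed

text \<open>Periodicity moves the path to Re z = x, where |z| <= x + \<pi> and the exponential has
  modulus e^(-2nx). One pair K, N serves all n and x: x = 0 gives a bound uniform in n, and x
  growing with n gives fast decay.\<close>

lemma fin_growth_vint_bound:
  assumes G: "G holomorphic_on UNIV" and per: "\<And>z. G (z + of_real pi * \<i>) = G z" and "fin_growth G"
  shows "\<exists>K N. \<forall>n x. x \<ge> 0 \<longrightarrow> norm (vint 0 (\<lambda>z. G z * exp (of_int (- n) * 2 * z))) \<le> exp (K * (1 + x) ^ N - 2 * of_int n * x)"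
proof -
  obtain K N where 1: "K \<ge> 0" "\<And>z. norm (G z) \<le> exp (K * (1 + norm z) ^ N)"
    using assms unfolding fin_growth_def by blast
  have "norm (vint 0 (\<lambda>z. G z * exp (of_int (- n) * 2 * z))) \<le> exp ((K * (1 + pi) ^ N + pi) * (1 + x) ^ N - 2 * of_int n * x)"
    if x: "x \<ge> 0" for n x
  proof -
    have hol: "(\<lambda>z. G z * exp (of_int (- n) * 2 * z)) holomorphic_on UNIV"
      by (intro holomorphic_intros G)
    have "vint 0 (\<lambda>z. G z * exp (of_int (- n) * 2 * z)) = vint (of_real x) (\<lambda>z. G z * exp (of_int (- n) * 2 * z))"
      by (rule vint_shift [OF hol]) (simp only: per exp_pi_periodic)
    also have "norm \<dots> \<le> pi * exp (K * (1 + pi) ^ N * (1 + x) ^ N - 2 * of_int n * x)"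
    proof (rule norm_vint_le [OF hol])
      fix y assume y: "0 \<le> y" "y \<le> pi"
      have "norm (of_real x + of_real y * \<i>) \<le> x + pi"
        using norm_triangle_ineq [of "of_real x :: complex" "of_real y * \<i>"] x y by (simp add: norm_mult)
      also have "1 + (x + pi) \<le> (1 + pi) * (1 + x)" using x by (simp add: algebra_simps)
      finally have "1 + norm (of_real x + of_real y * \<i>) \<le> (1 + pi) * (1 + x)" by simp
      hence "K * (1 + norm (of_real x + of_real y * \<i>)) ^ N \<le> K * ((1 + pi) * (1 + x)) ^ N"
        using 1(1) by (intro mult_left_mono power_mono) auto
      hence "exp (K * (1 + norm (of_real x + of_real y * \<i>)) ^ N) \<le> exp (K * (1 + pi) ^ N * (1 + x) ^ N)"
        by (simp add: power_mult_distrib mult.assoc)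
      with 1(2) have "norm (G (of_real x + of_real y * \<i>)) \<le> exp (K * (1 + pi) ^ N * (1 + x) ^ N)"
        by (rule order_trans)
      from mult_right_mono [OF this, of "exp (- (2 * of_int n * x))"]
      show "norm (G (of_real x + of_real y * \<i>) * exp (of_int (- n) * 2 * (of_real x + of_real y * \<i>)))
         \<le> exp (K * (1 + pi) ^ N * (1 + x) ^ N - 2 * of_int n * x)"
        by (simp add: norm_mult exp_add [symmetric] algebra_simps)
    qed
    also have "\<dots> \<le> exp pi * exp (K * (1 + pi) ^ N * (1 + x) ^ N - 2 * of_int n * x)"
      using exp_ge_add_one_self [of pi] by (intro mult_right_mono) (linarith, simp)
    also have "\<dots> = exp (pi * 1 + (K * (1 + pi) ^ N * (1 + x) ^ N - 2 * of_int n * x))"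
      by (simp add: exp_add)
    also have "\<dots> \<le> exp ((K * (1 + pi) ^ N + pi) * (1 + x) ^ N - 2 * of_int n * x)"
    proof -
      have "pi * 1 \<le> pi * (1 + x) ^ N" using x by (intro mult_left_mono one_le_power) auto
      thus ?thesis by (simp add: algebra_simps)
    qed
    finally show ?thesis .
  qed
  thus ?thesis by blast
qed

text \<open>The exponent that decides \<open>recurrence_growth_zero\<close>: there exp (x/2) = B +
  2k, so the last quotient is k. The product x exp (x/2) outgrows every power of x.\<close>

lemma growth_rate:
  "filterlim (\<lambda>x::real. K * (1 + x) ^ N - 2 * m * x - x * ((exp (x / 2) - B) / 2)) at_bot at_top"
proof -
  have "((\<lambda>x::real. (1 + x) ^ N / exp (x / 2)) \<longlongrightarrow> 0) at_top"
  proof -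
    have "((\<lambda>x::real. x ^ N / exp x) \<longlongrightarrow> 0) at_top" by (rule tendsto_power_div_exp_0)
    moreover have "filterlim (\<lambda>x::real. (1 + x) / 2) at_top at_top" by real_asymp
    ultimately have "((\<lambda>x::real. ((1 + x) / 2) ^ N / exp ((1 + x) / 2)) \<longlongrightarrow> 0) at_top"
      by (rule filterlim_compose)
    \<comment> \<open>The limit of y^N / exp y is taken at y = (1 + x)/2; the constants undo this
      scaling.\<close>
    hence "((\<lambda>x::real. 2 ^ N * exp (1/2) * (((1 + x) / 2) ^ N / exp ((1 + x) / 2))) \<longlongrightarrow> 2 ^ N * exp (1/2) * 0) at_top"
      by (intro tendsto_mult tendsto_const)
    also have "(\<lambda>x::real. 2 ^ N * exp (1/2) * (((1 + x) / 2) ^ N / exp ((1 + x) / 2))) = (\<lambda>x. (1 + x) ^ N / exp (x / 2))"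
    proof
      fix x :: real
      have 1: "((1 + x) / 2) ^ N = (1 + x) ^ N / 2 ^ N" by (rule power_divide)
      have 2: "exp ((1 + x) / 2) = exp (1 / 2) * exp (x / 2)" by (simp add: exp_add [symmetric] add_divide_distrib)
      show "2 ^ N * exp (1/2) * (((1 + x) / 2) ^ N / exp ((1 + x) / 2)) = (1 + x) ^ N / exp (x / 2)"
        unfolding 1 2 by simp
    qed
    finally show ?thesis by simp
  qed
  hence "eventually (\<lambda>x::real. (1 + x) ^ N / exp (x / 2) < 1) at_top"
    by (rule order_tendstoD) simp
  hence "eventually (\<lambda>x. K * (1 + x) ^ N - 2 * m * x - x * ((exp (x / 2) - B) / 2) \<le>
      \<bar>K\<bar> * exp (x / 2) - 2 * m * x - x * ((exp (x / 2) - B) / 2)) at_top"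
    using eventually_ge_at_top [of 0]
  proof eventually_elim
    case (elim x)
    have "K * (1 + x) ^ N \<le> \<bar>K\<bar> * (1 + x) ^ N" using elim by (intro mult_right_mono) auto
    also have "\<dots> \<le> \<bar>K\<bar> * exp (x / 2)" using elim by (intro mult_left_mono) auto
    finally show ?case by simp
  qed
  moreover have "filterlim (\<lambda>x::real. \<bar>K\<bar> * exp (x / 2) - 2 * m * x - x * ((exp (x / 2) - B) / 2)) at_bot at_top"
    by real_asymp
  ultimately show ?thesis by (rule filterlim_at_bot_mono [rotated])
qed

text \<open>Upwards the recurrence only permits decay like \<open>1 / (n!)\<^sup>2\<close>, which is slower than the
  decay that finite growth forces.\<close>
lemma recurrence_growth_zero:
  fixes A :: "int \<Rightarrow> complex"
  assumes rec: "\<And>n. n > m \<Longrightarrow> ((a + 2 * of_int n)\<^sup>2 - \<nu>\<^sup>2) * A n + A (n - 1) = 0"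
    and bound: "\<And>n x. x \<ge> 0 \<Longrightarrow> norm (A n) \<le> exp (K * (1 + x) ^ N - 2 * of_int n * x)"
  shows "A m = 0"
proof -
  \<comment> \<open>Chosen so that the k-th factor of the recurrence, counted from index m + 1, has
    modulus at most (B + 2k)^2.\<close>
  define B where "B = norm a + 2 * \<bar>of_int m\<bar> + 2 + norm \<nu>"
  have B: "B \<ge> 1" by (simp add: B_def add_increasing)
  define b where "b = (\<lambda>k::nat. A (m + int k))"
  have step: "norm (b k) \<le> (B + 2 * real k)\<^sup>2 * norm (b (Suc k))" for k
  proof -
    define s where "s = a + 2 * of_int (m + int (Suc k))"
    have s: "norm s \<le> norm a + 2 * \<bar>of_int m\<bar> + 2 + 2 * real k"
    proof -
      have "norm s \<le> norm a + norm (of_int (2 * (m + int (Suc k))) :: complex)"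
        using norm_triangle_ineq [of a "of_int (2 * (m + int (Suc k)))"] by (simp add: s_def)
      also have "(of_int (2 * (m + int (Suc k))) :: complex) = of_real (2 * (of_int m + 1 + real k))"
        by simp
      also have "norm \<dots> \<le> 2 * \<bar>of_int m\<bar> + 2 + 2 * real k"
        unfolding norm_of_real by (simp add: abs_if)
      finally show ?thesis by simp
    qed
    have "b k = - ((s\<^sup>2 - \<nu>\<^sup>2) * b (Suc k))"
      using rec [of "m + int (Suc k)"] unfolding b_def s_def
      by (simp add: add_eq_0_iff2)
    hence "norm (b k) = norm (s\<^sup>2 - \<nu>\<^sup>2) * norm (b (Suc k))" by (simp add: norm_mult)
    also have "norm (s\<^sup>2 - \<nu>\<^sup>2) \<le> (norm s)\<^sup>2 + (norm \<nu>)\<^sup>2"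
      using norm_triangle_ineq4 [of "s\<^sup>2" "\<nu>\<^sup>2"] by (simp add: norm_power)
    also have "\<dots> \<le> (norm s + norm \<nu>)\<^sup>2" by (simp add: power2_sum)
    also have "\<dots> \<le> (B + 2 * real k)\<^sup>2"
      using s by (intro power_mono) (auto simp: B_def)
    finally show ?thesis by (simp add: mult_right_mono)
  qed
  have prod: "norm (b 0) \<le> (B + 2 * real k) ^ (2 * k) * norm (b k)" for k
  proof (induction k)
    case (Suc k)
    have "norm (b 0) \<le> (B + 2 * real k) ^ (2 * k) * norm (b k)" by fact
    also have "\<dots> \<le> (B + 2 * real k) ^ (2 * k) * ((B + 2 * real k)\<^sup>2 * norm (b (Suc k)))"
      using B by (intro mult_left_mono step) auto
    also have "\<dots> = (B + 2 * real k) ^ (2 * Suc k) * norm (b (Suc k))"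
      by (simp add: power_add power2_eq_square)
    also have "\<dots> \<le> (B + 2 * real (Suc k)) ^ (2 * Suc k) * norm (b (Suc k))"
      using B by (intro mult_right_mono power_mono) auto
    finally show ?case .
  qed simp
  \<comment> \<open>This choice makes the product (B + 2k)^(2k) equal to e^(kx), while the bound for
    A (m + k) contains e^(-2kx); a net e^(-kx) remains.\<close>
  define x where "x = (\<lambda>k. 2 * ln (B + 2 * real k))"
  have "norm (b 0) \<le> exp (K * (1 + x k) ^ N - 2 * of_int m * x k - x k * ((exp (x k / 2) - B) / 2))" for k
  proof -
    have x: "x k \<ge> 0" using B by (simp add: x_def)
    have e: "exp (x k / 2) = B + 2 * real k" using B by (simp add: x_def)
    have p: "(B + 2 * real k) ^ (2 * k) = exp (real k * x k)"
    proof -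
      have "exp (real k * x k) = exp (x k / 2) ^ (2 * k)"
        by (simp add: exp_of_nat_mult [symmetric])
      thus ?thesis by (simp add: e)
    qed
    have "norm (b 0) \<le> exp (real k * x k) * norm (b k)" using prod [of k] by (simp add: p)
    also have "\<dots> \<le> exp (real k * x k) * exp (K * (1 + x k) ^ N - 2 * of_int (m + int k) * x k)"
      unfolding b_def by (intro mult_left_mono bound x) auto
    also have "\<dots> = exp (K * (1 + x k) ^ N - 2 * of_int m * x k - x k * ((exp (x k / 2) - B) / 2))"
      unfolding e by (simp add: exp_add [symmetric] algebra_simps)
    finally show ?thesis .
  qed
  moreover have "(\<lambda>k. exp (K * (1 + x k) ^ N - 2 * of_int m * x k - x k * ((exp (x k / 2) - B) / 2))) \<longlonglongrightarrow> 0"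
  proof -
    have "filterlim x at_top sequentially" unfolding x_def by real_asymp
    from filterlim_compose [OF exp_at_bot filterlim_compose [OF growth_rate this]] show ?thesis .
  qed
  ultimately have "norm (b 0) \<le> 0" by (intro LIMSEQ_le_const) auto
  thus ?thesis by (simp add: b_def)
qed

text \<open>Far below 0 the factor has modulus at least 2, so a nonzero coefficient there would at
  least double with every further step down, against the bound.\<close>

lemma recurrence_bounded_zero:
  fixes A :: "int \<Rightarrow> complex"
  assumes rec: "\<And>n. n < 0 \<Longrightarrow> ((a + 2 * of_int n)\<^sup>2 - \<nu>\<^sup>2) * A n + A (n - 1) = 0"
    and bound: "\<And>n. norm (A n) \<le> C"
  shows "\<exists>M<0. A M = 0"
proof -
  \<comment> \<open>For n <= -k this gives |a + 2n| >= |\<nu>| + 2, hence the lower bound 2 for the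
    factor.\<close>
  define k where "k = nat \<lceil>norm a + norm \<nu> + 2\<rceil>"
  define M where "M = - int k"
  have k: "norm a + norm \<nu> + 2 \<le> real k" unfolding k_def by linarith
  have big: "2 \<le> norm ((a + 2 * of_int n)\<^sup>2 - \<nu>\<^sup>2)" if n: "n \<le> M" for n
  proof -
    have "norm (of_int (2 * n) :: complex) \<le> norm (a + 2 * of_int n) + norm a"
      using norm_triangle_ineq4 [of "a + 2 * of_int n" a] by simp
    hence 1: "norm \<nu> + 2 \<le> norm (a + 2 * of_int n)"
      using k n unfolding norm_of_int M_def by linarith
    have "2 \<le> (norm \<nu> + 2)\<^sup>2 - (norm \<nu>)\<^sup>2" by (simp add: power2_sum)
    also have "\<dots> \<le> (norm (a + 2 * of_int n))\<^sup>2 - (norm \<nu>)\<^sup>2"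
      using power_mono [OF 1, of 2] by simp
    also have "\<dots> \<le> norm ((a + 2 * of_int n)\<^sup>2 - \<nu>\<^sup>2)"
      using norm_triangle_ineq2 [of "(a + 2 * of_int n)\<^sup>2" "\<nu>\<^sup>2"] by (simp add: norm_power)
    finally show ?thesis .
  qed
  have Mneg: "M < 0"
  proof -
    have "real k > 0" using k norm_ge_zero [of a] norm_ge_zero [of \<nu>] by linarith
    thus ?thesis by (simp add: M_def)
  qed
  have grow: "2 ^ j * norm (A M) \<le> norm (A (M - int j))" for j
  proof (induction j)
    case (Suc j)
    have "A (M - int j - 1) = - (((a + 2 * of_int (M - int j))\<^sup>2 - \<nu>\<^sup>2) * A (M - int j))"
      using rec [of "M - int j"] Mneg by (simp add: add_eq_0_iff)
    hence "norm (A (M - int j - 1)) = norm ((a + 2 * of_int (M - int j))\<^sup>2 - \<nu>\<^sup>2) * norm (A (M - int j))"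
      by (simp only: norm_minus_cancel norm_mult)
    also have "\<dots> \<ge> 2 * norm (A (M - int j))"
      by (intro mult_right_mono big) auto
    finally have "2 * norm (A (M - int j)) \<le> norm (A (M - int j - 1))" .
    thus ?case using Suc by (simp add: algebra_simps)
  qed simp
  have "norm (A M) \<le> C * (1 / 2) ^ j" for j
    using order_trans [OF grow bound, of j] by (simp add: field_simps)
  hence "A M = 0" by (rule exp_decay_zero) auto
  thus ?thesis using Mneg by blast
qed

section \<open>Solutions of finite growth\<close>

lemma bessel_sol_holomorphic: "bessel_sol q \<nu> f g \<Longrightarrow> f holomorphic_on S"
  by (erule bessel_solE) (meson field_differentiable_at_within field_differentiable_def holomorphic_on_def)

lemma bessel_sol_shift_pi:
  "bessel_sol 1 \<nu> f g \<Longrightarrow> bessel_sol 1 \<nu> (\<lambda>z. f (z + of_real pi * \<i>)) (\<lambda>z. g (z + of_real pi * \<i>))"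
  using bessel_sol_shift [of 1 \<nu> f g "of_real pi * \<i>"] exp_pi_periodic [of 1 0] by simp

lemma exp_mult_pi: "exp (a * (z + of_real pi * \<i>)) = exp (a * of_real pi * \<i>) * exp (a * z)"
  by (simp add: algebra_simps exp_add)

text \<open>A n is \<pi>i times the coefficient of e^((a + 2n) z) in f. The equation is integrated
  against e^(-(a + 2n) z) with two integrations by parts; the boundary terms cancel because the
  multipliers of f and of the exponential are inverse to each other.\<close>

lemma vint_recurrence:
  assumes sol: "bessel_sol 1 \<nu> f (\<lambda>z. c * exp (a * z))"
    and per: "\<And>z. f (z + of_real pi * \<i>) = exp (a * of_real pi * \<i>) * f z"
  defines "A \<equiv> \<lambda>n. vint 0 (\<lambda>z. f z * exp (- a * z) * exp (of_int (- n) * 2 * z))"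
  shows "((a + 2 * of_int n)\<^sup>2 - \<nu>\<^sup>2) * A n + A (n - 1) = c * (if n = 0 then of_real pi * \<i> else 0)"
proof -
  obtain f1 f2 where *:
    "\<And>z. (f has_field_derivative f1 z) (at z)" "\<And>z. (f1 has_field_derivative f2 z) (at z)"
    "\<And>z. f2 z + (1 * exp (2 * z) - \<nu>\<^sup>2) * f z = c * exp (a * z)"
    using sol by (rule bessel_solE) blast
  have f2: "f2 z = c * exp (a * z) - (exp (2 * z) - \<nu>\<^sup>2) * f z" for z
    using *(3) [of z] by (simp add: algebra_simps)
  have per1: "f1 (z + of_real pi * \<i>) = exp (a * of_real pi * \<i>) * f1 z" for z
  proof -
    have "((\<lambda>z. f (z + of_real pi * \<i>)) has_field_derivative f1 (z + of_real pi * \<i>)) (at z)"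
      by (rule DERIV_shift [THEN iffD1, OF *(1)])
    moreover have "((\<lambda>z. f (z + of_real pi * \<i>)) has_field_derivative exp (a * of_real pi * \<i>) * f1 z) (at z)"
      unfolding per by (rule DERIV_cmult [OF *(1)])
    ultimately show ?thesis by (rule DERIV_unique)
  qed
  define s where "s = a + 2 * of_int n"
  define E where "E = (\<lambda>z. exp (- a * z) * exp (of_int (- n) * 2 * z) :: complex)"
  have dE: "(E has_field_derivative - s * E z) (at z)" for z
    unfolding E_def s_def by (auto intro!: derivative_eq_intros simp: algebra_simps)
  have perE: "E (z + of_real pi * \<i>) = exp (- a * of_real pi * \<i>) * E z" for z
    unfolding E_def by (subst exp_pi_periodic, subst exp_mult_pi) (simp only: mult.assoc)
  \<comment> \<open>As E' = -s E, the derivative of R is (f'' - s^2 f) E: the first-order terms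
    cancel, and R collects the boundary terms.\<close>
  define R where "R = (\<lambda>z. (f1 z + s * f z) * E z)"
  define h where "h = (\<lambda>n z. f z * exp (- a * z) * exp (of_int (- n) * 2 * z))"
  have dR: "(R has_field_derivative ((- s\<^sup>2 + \<nu>\<^sup>2) * h n z + (-1) * h (n - 1) z) + c * exp (of_int (- n) * 2 * z)) (at z)" for z
  proof -
    have "(R has_field_derivative (f2 z + s * f1 z) * E z + (- s * E z) * (f1 z + s * f z)) (at z)"
      unfolding R_def by (intro DERIV_mult DERIV_add DERIV_cmult * dE)
    moreover have "(f2 z + s * f1 z) * E z + (- s * E z) * (f1 z + s * f z) = (f2 z - s\<^sup>2 * f z) * E z"
      by (simp add: algebra_simps power2_eq_square)
    moreover have "\<dots> = (- s\<^sup>2 + \<nu>\<^sup>2) * (f z * E z) + (-1) * (f z * (exp (2 * z) * E z)) + c * (exp (a * z) * E z)"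
      unfolding f2 by (simp add: algebra_simps)
    moreover have "f z * E z = h n z" by (simp add: h_def E_def)
    moreover have "exp (2 * z) * E z = exp (- a * z) * exp (of_int (- (n - 1)) * 2 * z)"
      unfolding E_def by (simp add: exp_add [symmetric] algebra_simps)
    moreover have "exp (a * z) * E z = exp (of_int (- n) * 2 * z)"
      unfolding E_def by (simp add: exp_add [symmetric] algebra_simps)
    ultimately show ?thesis by (simp only: h_def mult.assoc)
  qed
  have A: "A n = vint 0 (h n)" for n by (simp add: A_def h_def)
  have hol: "h n holomorphic_on UNIV" for n
    unfolding h_def by (intro holomorphic_intros bessel_sol_holomorphic [OF sol])
  have "vint 0 (\<lambda>z. ((- s\<^sup>2 + \<nu>\<^sup>2) * h n z + (-1) * h (n - 1) z) + c * exp (of_int (- n) * 2 * z)) =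
     R (0 + of_real pi * \<i>) - R 0"
    by (rule vint_primitive [OF dR])
  also have "R (0 + of_real pi * \<i>) = R 0"
  proof -
    have "exp (a * of_real pi * \<i>) * exp (- a * of_real pi * \<i>) = 1"
      by (simp add: exp_add [symmetric])
    thus ?thesis unfolding R_def per per1 perE by (simp add: algebra_simps)
  qed
  finally have v: "vint 0 (\<lambda>z. ((- s\<^sup>2 + \<nu>\<^sup>2) * h n z + (-1) * h (n - 1) z) + c * exp (of_int (- n) * 2 * z)) = 0"
    by simp
  have "vint 0 (\<lambda>z. ((- s\<^sup>2 + \<nu>\<^sup>2) * h n z + (-1) * h (n - 1) z) + c * exp (of_int (- n) * 2 * z))
     = vint 0 (\<lambda>z. (- s\<^sup>2 + \<nu>\<^sup>2) * h n z + (-1) * h (n - 1) z) + vint 0 (\<lambda>z. c * exp (of_int (- n) * 2 * z))"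
    by (intro vint_add holomorphic_intros hol)
  also have "vint 0 (\<lambda>z. (- s\<^sup>2 + \<nu>\<^sup>2) * h n z + (-1) * h (n - 1) z) =
     vint 0 (\<lambda>z. (- s\<^sup>2 + \<nu>\<^sup>2) * h n z) + vint 0 (\<lambda>z. (-1) * h (n - 1) z)"
    by (intro vint_add holomorphic_intros hol)
  also have "vint 0 (\<lambda>z. (- s\<^sup>2 + \<nu>\<^sup>2) * h n z) = (- s\<^sup>2 + \<nu>\<^sup>2) * A n"
    unfolding A by (rule vint_cmult [OF hol])
  also have "vint 0 (\<lambda>z. (-1) * h (n - 1) z) = (-1) * A (n - 1)"
    unfolding A by (rule vint_cmult [OF hol])
  also have "vint 0 (\<lambda>z. c * exp (of_int (- n) * 2 * z)) = c * (if n = 0 then of_real pi * \<i> else 0)"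
    by (subst vint_cmult) (auto intro!: holomorphic_intros simp: vint_exp simp del: of_int_minus)
  finally show ?thesis using v unfolding s_def by (simp add: algebra_simps)
qed

lemma twisted_periodic:
  assumes "\<And>z. f (z + of_real pi * \<i>) = exp (a * of_real pi * \<i>) * f z"
  shows "f (z + of_real pi * \<i>) * exp (- a * (z + of_real pi * \<i>)) = f z * exp (- a * z)"
proof -
  have "exp (a * of_real pi * \<i>) * exp (- a * of_real pi * \<i>) = 1"
    by (simp add: exp_add [symmetric])
  thus ?thesis unfolding assms exp_mult_pi by (simp add: algebra_simps)
qed

text \<open>Write l = e^(a\<pi>i). Without a source the recurrence holds at every n, so
  \<open>recurrence_growth_zero\<close> can start at any index and removes all coefficients;
  completeness of the exponentials finishes. Another logarithm of l would only renumber the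
  coefficients.\<close>

lemma homogeneous_eigen_zero:
  assumes sol: "bessel_sol 1 \<nu> g (\<lambda>z. 0)" and fg: "fin_growth g"
    and per: "\<And>z. g (z + of_real pi * \<i>) = l * g z"
  shows "g z = 0"
proof (cases "l = 0")
  case True
  thus ?thesis using per [of "z - of_real pi * \<i>"] by simp
next
  case False
  define a where "a = Ln l / (of_real pi * \<i>)"
  have "a * of_real pi * \<i> = Ln l" by (simp only: a_def mult.assoc) simp
  hence "exp (a * of_real pi * \<i>) = exp (Ln l)" by (rule arg_cong)
  also have "\<dots> = l" using False by simp
  finally have "exp (a * of_real pi * \<i>) = l" .
  hence per': "g (z + of_real pi * \<i>) = exp (a * of_real pi * \<i>) * g z" for z by (simp add: per)
  define A where "A = (\<lambda>n. vint 0 (\<lambda>z. g z * exp (- a * z) * exp (of_int (- n) * 2 * z)))"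
  have rec: "((a + 2 * of_int n)\<^sup>2 - \<nu>\<^sup>2) * A n + A (n - 1) = 0" for n
    using vint_recurrence [of \<nu> g 0 a n, OF _ per'] sol unfolding A_def by simp
  have tw: "g (z + of_real pi * \<i>) * exp (- a * (z + of_real pi * \<i>)) = g z * exp (- a * z)" for z
    by (rule twisted_periodic) (rule per')
  have hol: "(\<lambda>z. g z * exp (- a * z)) holomorphic_on UNIV"
    by (intro holomorphic_intros bessel_sol_holomorphic [OF sol])
  obtain K N where "\<And>n x. x \<ge> 0 \<Longrightarrow> norm (A n) \<le> exp (K * (1 + x) ^ N - 2 * of_int n * x)"
    unfolding A_def
    using fin_growth_vint_bound [OF hol tw fin_growth_mult [OF fg fin_growth_exp]] by blast
  hence A: "A n = 0" for n by (intro recurrence_growth_zero [of n a \<nu> A K N] rec)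
  have "vint 0 (\<lambda>z. g z * exp (- a * z) * exp (of_int n * 2 * z)) = 0" for n
    using A [of "- n"] by (simp add: A_def)
  hence "g z * exp (- a * z) = 0"
    by (rule periodic_eq_0 [OF hol tw])
  thus ?thesis by simp
qed

text \<open>Uniqueness for the initial value problem by Taylor coefficients: g'' = p g and Leibniz'
  rule express each higher derivative at 0 through lower ones.\<close>

lemma homogeneous_unique:
  assumes sol: "bessel_sol 1 \<nu> g (\<lambda>z. 0)" and "g 0 = 0" "deriv g 0 = 0"
  shows "g z = 0"
proof -
  have hol: "g holomorphic_on UNIV" by (rule bessel_sol_holomorphic [OF sol])
  define p where "p = (\<lambda>z. \<nu>\<^sup>2 - exp (2 * z))"
  have "deriv (deriv g) = (\<lambda>z. p z * g z)"
  proof -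
    obtain f1 f2 where *:
      "\<And>z. (g has_field_derivative f1 z) (at z)" "\<And>z. (f1 has_field_derivative f2 z) (at z)"
      "\<And>z. f2 z + (1 * exp (2 * z) - \<nu>\<^sup>2) * g z = 0"
      using sol by (rule bessel_solE) blast
    have 1: "deriv g = f1" using *(1) by (auto simp: fun_eq_iff DERIV_imp_deriv)
    have 2: "deriv f1 = f2" using *(2) by (auto simp: fun_eq_iff DERIV_imp_deriv)
    show ?thesis unfolding 1 2 using *(3) by (simp add: fun_eq_iff p_def algebra_simps)
  qed
  hence S: "(deriv ^^ Suc (Suc n)) g = (deriv ^^ n) (\<lambda>z. p z * g z)" for n
    by (simp add: funpow_Suc_right del: funpow.simps)
  have "(deriv ^^ n) g 0 = 0" for n
  proof (induction n rule: less_induct)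
    case (less n)
    consider "n = 0" | "n = 1" | m where "n = Suc (Suc m)" by (metis One_nat_def not0_implies_Suc)
    thus ?case
    proof cases
      case 3
      have "(deriv ^^ n) g 0 = (\<Sum>i = 0..m. of_nat (m choose i) * (deriv ^^ i) p 0 * (deriv ^^ (m - i)) g 0)"
        unfolding 3 S by (rule higher_deriv_mult [OF _ hol open_UNIV UNIV_I]) (auto simp: p_def intro!: holomorphic_intros)
      also have "\<dots> = 0" using less 3 by (intro sum.neutral) auto
      finally show ?thesis .
    qed (use assms in auto)
  qed
  thus ?thesis
    by (intro holomorphic_fun_eq_0_on_connected [OF hol open_UNIV connected_UNIV, of 0 z]) auto
qed

text \<open>A shift-invariant space of functions of dimension at most 2 contains an eigenvector.\<close>
lemma homogeneous_fin_growth_zero: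
  assumes sol: "bessel_sol 1 \<nu> g (\<lambda>z. 0)" and fg: "fin_growth g"
  shows "g z = 0"
proof (rule ccontr)
  assume "g z \<noteq> 0"
  let ?p = "of_real pi * \<i> :: complex"
  define T where "T = (\<lambda>f z. f (z + ?p) :: complex)"
  have Tsol: "bessel_sol 1 \<nu> (T f) (\<lambda>z. 0)" if "bessel_sol 1 \<nu> f (\<lambda>z. 0)" for f
    using bessel_sol_shift_pi [OF that] by (simp add: T_def)
  have Tfg: "fin_growth (T f)" if "fin_growth f" for f
    using fin_growth_shift [OF that] by (simp add: T_def)
  \<comment> \<open>A linear relation between initial data at 0 extends to the solutions; this
    replaces any explicit basis.\<close>
  have comb: "f0 z = c * f1 z + d * f2 z"
    if "bessel_sol 1 \<nu> f0 (\<lambda>z. 0)" "bessel_sol 1 \<nu> f1 (\<lambda>z. 0)" "bessel_sol 1 \<nu> f2 (\<lambda>z. 0)"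
      "f0 0 = c * f1 0 + d * f2 0" "deriv f0 0 = c * deriv f1 0 + d * deriv f2 0" for f0 f1 f2 c d z
  proof -
    have h: "f field_differentiable (at 0)" if "bessel_sol 1 \<nu> f (\<lambda>z. 0)" for f
      using bessel_sol_holomorphic [OF that, of UNIV] holomorphic_on_imp_differentiable_at open_UNIV by blast
    define k where "k = (\<lambda>z. f0 z + ((-c) * f1 z + (-d) * f2 z))"
    have "bessel_sol 1 \<nu> k (\<lambda>z. 0 + ((-c) * 0 + (-d) * 0))"
      unfolding k_def by (intro bessel_sol_add bessel_sol_cmult that)
    hence "bessel_sol 1 \<nu> k (\<lambda>z. 0)" by simp
    moreover have "(k has_field_derivative deriv f0 0 + ((-c) * deriv f1 0 + (-d) * deriv f2 0)) (at 0)"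
      unfolding k_def by (intro DERIV_add DERIV_cmult field_differentiable_derivI h that)
    hence "deriv k 0 = 0" using that(5) by (simp add: DERIV_imp_deriv)
    moreover have "k 0 = 0" using that(4) by (simp add: k_def)
    ultimately have "k z = 0" using homogeneous_unique [of \<nu> k z] by blast
    thus ?thesis by (simp add: k_def add_eq_0_iff2)
  qed
  have noeig: "\<not> (\<forall>z. g (z + ?p) = l * g z)" for l
    using homogeneous_eigen_zero [OF sol fg] \<open>g z \<noteq> 0\<close> by blast
  \<comment> \<open>The Wronskian of g and its shift at 0. If it vanishes, g is itself an
    eigenvector.\<close>
  define D where "D = g 0 * deriv (T g) 0 - deriv g 0 * T g 0"
  show False
  proof (cases "D = 0")
    case True
    have "g 0 \<noteq> 0 \<or> deriv g 0 \<noteq> 0" using homogeneous_unique [OF sol] \<open>g z \<noteq> 0\<close> by blast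
    then obtain l where L: "T g 0 = l * g 0" "deriv (T g) 0 = l * deriv g 0"
    proof
      assume "g 0 \<noteq> 0"
      thus thesis using True by (intro that [of "T g 0 / g 0"]) (simp_all add: D_def field_simps)
    next
      assume "deriv g 0 \<noteq> 0"
      thus thesis using True by (intro that [of "deriv (T g) 0 / deriv g 0"]) (simp_all add: D_def field_simps)
    qed
    have "T g z = l * g z + 0 * g z" for z by (rule comb [OF Tsol [OF sol] sol sol]) (simp_all add: L)
    thus False using noeig [of l] by (simp add: T_def)
  next
    case False
    define x y where "x = T (T g) 0" and "y = deriv (T (T g)) 0"
    \<comment> \<open>Coordinates of T (T g) in the basis g, T g, by Cramer's rule.\<close>
    define \<alpha> where "\<alpha> = (x * deriv (T g) 0 - y * T g 0) / D"
    define \<beta> where "\<beta> = (g 0 * y - deriv g 0 * x) / D"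
    have L: "\<alpha> * g 0 + \<beta> * T g 0 = (x * D) / D" "\<alpha> * deriv g 0 + \<beta> * deriv (T g) 0 = (y * D) / D"
      unfolding \<alpha>_def \<beta>_def times_divide_eq_left add_divide_distrib [symmetric]
      by (rule arg_cong2 [where f = "(/)"]; simp add: D_def algebra_simps)+
    have TT: "T (T g) z = \<alpha> * g z + \<beta> * T g z" for z
      by (rule comb [OF Tsol [OF Tsol [OF sol]] sol Tsol [OF sol]])
        (use False in \<open>simp_all only: L x_def y_def nonzero_mult_div_cancel_right not_False_eq_True\<close>)
    \<comment> \<open>l1 and l2 become the roots of X^2 - \<beta> X - \<alpha>, so (T - l2)(T - l1)
      g = 0. Thus (T - l1) g is an eigenvector for l2 or zero; as no eigenvector has finite growth,
      T g = l1 g, which is excluded.\<close>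
    define d where "d = csqrt (\<beta>\<^sup>2 + 4 * \<alpha>)"
    define l1 l2 where "l1 = (\<beta> + d) / 2" and "l2 = (\<beta> - d) / 2"
    have "d\<^sup>2 = \<beta>\<^sup>2 + 4 * \<alpha>" by (simp add: d_def)
    hence l: "\<beta> = l1 + l2" "\<alpha> = - (l1 * l2)"
    proof -
      show "\<beta> = l1 + l2" by (simp add: l1_def l2_def add_divide_distrib diff_divide_distrib)
      have "\<beta>\<^sup>2 - d\<^sup>2 = (\<beta> + d) * (\<beta> - d)" by (simp add: algebra_simps power2_eq_square)
      also have "\<beta> + d = 2 * l1" by (simp add: l1_def)
      also have "\<beta> - d = 2 * l2" by (simp add: l2_def)
      finally have "4 * (l1 * l2) = \<beta>\<^sup>2 - d\<^sup>2" by simp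
      thus "\<alpha> = - (l1 * l2)" using \<open>d\<^sup>2 = \<beta>\<^sup>2 + 4 * \<alpha>\<close> by simp
    qed
    define h where "h = (\<lambda>z. T g z + (- l1) * g z)"
    have "bessel_sol 1 \<nu> h (\<lambda>z. 0 + (- l1) * 0)"
      unfolding h_def by (intro bessel_sol_add bessel_sol_cmult sol Tsol)
    hence "bessel_sol 1 \<nu> h (\<lambda>z. 0)" by simp
    moreover have "fin_growth h"
      unfolding h_def by (intro fin_growth_add fin_growth_mult fin_growth_const fg Tfg)
    moreover have "h (z + ?p) = l2 * h z" for z
      using TT [of z] unfolding h_def l by (simp add: T_def algebra_simps)
    ultimately have "h z = 0" for z by (rule homogeneous_eigen_zero)
    thus False using noeig [of l1] by (simp add: h_def T_def)
  qed
qed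

lemma fin_growth_imp_odd:
  assumes sol: "bessel_sol 1 \<nu> f (\<lambda>z. exp ((\<mu> + 1) * z))" and fg: "fin_growth f"
  shows "\<exists>p::nat. \<mu> + \<nu> = 2 * of_nat p + 1 \<or> \<mu> - \<nu> = 2 * of_nat p + 1"
proof -
  let ?p = "of_real pi * \<i> :: complex"
  define a where "a = \<mu> + 1"
  define \<kappa> where "\<kappa> = exp (a * of_real pi * \<i>)"
  have sol': "bessel_sol 1 \<nu> f (\<lambda>z. 1 * exp (a * z))" using sol by (simp add: a_def)
  \<comment> \<open>The shift multiplies the right-hand side by exactly \<kappa>, so this
    combination solves the homogeneous equation and must vanish.\<close>
  have "bessel_sol 1 \<nu> (\<lambda>z. f (z + ?p) + (- \<kappa>) * f z) (\<lambda>z. 1 * exp (a * (z + ?p)) + (- \<kappa>) * (1 * exp (a * z)))"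
    by (intro bessel_sol_add bessel_sol_cmult bessel_sol_shift_pi [OF sol'] sol')
  moreover have "fin_growth (\<lambda>z. f (z + ?p) + (- \<kappa>) * f z)"
    by (intro fin_growth_add fin_growth_mult fin_growth_const fin_growth_shift fg)
  ultimately have "f (z + ?p) + (- \<kappa>) * f z = 0" for z
    by (intro homogeneous_fin_growth_zero [of \<nu> "\<lambda>z. f (z + ?p) + (- \<kappa>) * f z"]) (simp_all add: exp_mult_pi \<kappa>_def)
  hence per: "f (z + ?p) = exp (a * of_real pi * \<i>) * f z" for z by (simp add: \<kappa>_def)
  define A where "A = (\<lambda>n. vint 0 (\<lambda>z. f z * exp (- a * z) * exp (of_int (- n) * 2 * z)))"
  have rec: "((a + 2 * of_int n)\<^sup>2 - \<nu>\<^sup>2) * A n + A (n - 1) = (if n = 0 then ?p else 0)" for n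
    using vint_recurrence [OF sol' per, of n] unfolding A_def by simp
  have tw: "f (z + ?p) * exp (- a * (z + ?p)) = f z * exp (- a * z)" for z
    by (rule twisted_periodic) (rule per)
  have hol: "(\<lambda>z. f z * exp (- a * z)) holomorphic_on UNIV"
    by (intro holomorphic_intros bessel_sol_holomorphic [OF sol])
  obtain K N where bound: "\<And>n x. x \<ge> 0 \<Longrightarrow> norm (A n) \<le> exp (K * (1 + x) ^ N - 2 * of_int n * x)"
    unfolding A_def
    using fin_growth_vint_bound [OF hol tw fin_growth_mult [OF fg fin_growth_exp]] by blast
  \<comment> \<open>Only the indices n > 0 enter, where there is no source. The equation at n = 0
    then gives A (-1) = \<pi>i.\<close>
  have "A 0 = 0" by (rule recurrence_growth_zero [of 0 a \<nu> A K N]) (use rec bound in auto)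
  hence A1: "A (-1) \<noteq> 0" using rec [of 0] by simp
  have "norm (A n) \<le> exp K" for n using bound [of 0 n] by simp
  then obtain M where M: "M < 0" "A M = 0" using recurrence_bounded_zero [of a \<nu> A "exp K"] rec by auto
  \<comment> \<open>If no factor vanished, A (-1) would propagate as a nonzero value to every lower
    index, contradicting A M = 0.\<close>
  have "\<exists>n<0. (a + 2 * of_int n)\<^sup>2 - \<nu>\<^sup>2 = 0"
  proof (rule ccontr)
    assume *: "\<not> (\<exists>n<0. (a + 2 * of_int n)\<^sup>2 - \<nu>\<^sup>2 = 0)"
    have "A (- 1 - int k) \<noteq> 0" for k
    proof (induction k)
      case (Suc k)
      have "- 1 - int k < 0" by simp
      hence "(a + 2 * of_int (- 1 - int k))\<^sup>2 - \<nu>\<^sup>2 \<noteq> 0" using * by blast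
      hence "A (- 1 - int k - 1) \<noteq> 0" using Suc rec [of "- 1 - int k"] by auto
      thus ?case by (simp add: algebra_simps)
    qed (use A1 in simp)
    from this [of "nat (- 1 - M)"] M show False by simp
  qed
  then obtain n where n: "n < 0" "(a + 2 * of_int n)\<^sup>2 = \<nu>\<^sup>2" by auto
  define p where "p = nat (- 1 - n)"
  have "n = - 1 - int p" using n by (simp add: p_def)
  hence np: "(of_int n :: complex) = - 1 - of_nat p" by simp
  from n(2) have "a + 2 * of_int n = \<nu> \<or> a + 2 * of_int n = - \<nu>" by (simp add: power2_eq_iff)
  hence "\<mu> - \<nu> = 2 * of_nat p + 1 \<or> \<mu> + \<nu> = 2 * of_nat p + 1"
  proof
    assume h: "a + 2 * of_int n = \<nu>"
    show ?thesis unfolding h [symmetric] np a_def by (simp add: algebra_simps)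
  next
    assume "a + 2 * of_int n = - \<nu>"
    hence h: "\<nu> = - (a + 2 * of_int n)" by simp
    show ?thesis unfolding h np a_def by (simp add: algebra_simps)
  qed
  thus ?thesis by blast
qed

section \<open>The order of an entire function\<close>

lemma norm_le_max_modulus:
  assumes "continuous_on UNIV f" "norm z \<le> r"
  shows "norm (f z) \<le> max_modulus f r"
  unfolding max_modulus_def
proof (rule cSup_upper)
  have "compact ((\<lambda>z. norm (f z)) ` cball 0 r)"
    by (intro compact_continuous_image continuous_on_norm continuous_on_subset [OF assms(1)]) auto
  thus "bdd_above ((\<lambda>z. norm (f z)) ` cball 0 r)"
    by (intro bounded_imp_bdd_above compact_imp_bounded)
qed (use assms in auto)

text \<open>The order bounds the maximum modulus by exp (r^N) only for r >= R0. Using it at r = max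
  R |z| covers the remaining z at the price of the constant R^N.\<close>

lemma order_finite_imp_fin_growth:
  assumes "continuous_on UNIV f" "entire_order f < \<infinity>"
  shows "fin_growth f"
proof -
  have "entire_order f \<noteq> \<infinity>" using assms(2) by auto
  then obtain N :: nat where "entire_order f < ereal (real N)"
    unfolding less_PInf_Ex_of_nat by blast
  hence "eventually (\<lambda>r. ereal (ln (ln (max (max_modulus f r) (exp 1))) / ln r) < ereal (real N)) at_top"
    unfolding entire_order_def by (rule Limsup_lessD)
  then obtain R0 where R0: "\<And>r. r \<ge> R0 \<Longrightarrow> ln (ln (max (max_modulus f r) (exp 1))) / ln r < real N"
    unfolding eventually_at_top_linorder by auto
  define R where "R = max R0 2"
  have R: "R \<ge> R0" "R \<ge> 2" by (auto simp: R_def)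
  have "norm (f z) \<le> exp (R ^ N * (1 + norm z) ^ N)" for z
  proof -
    define r where "r = max R (norm z)"
    define M where "M = max (max_modulus f r) (exp 1)"
    have r: "r \<ge> R0" "r \<ge> 2" using R by (auto simp: r_def)
    have M: "exp 1 \<le> M" by (simp add: M_def)
    hence "ln (exp 1) \<le> ln M" by (subst ln_le_cancel_iff) (auto intro: less_le_trans [OF exp_gt_zero])
    hence lM: "ln M \<ge> 1" by simp
    have "ln r > 0" using r by simp
    hence "ln (ln M) < real N * ln r" using R0 [OF r(1)] by (simp add: M_def field_simps)
    also have "\<dots> = ln (r ^ N)" using r by (simp add: ln_realpow)
    finally have "ln M < r ^ N" using lM r by (subst (asm) ln_less_cancel_iff) auto
    hence "M < exp (r ^ N)" using M
      by (metis exp_gt_zero exp_less_mono exp_ln less_le_trans)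
    moreover have "norm (f z) \<le> M"
      using norm_le_max_modulus [OF assms(1), of z r] by (simp add: M_def r_def)
    moreover have "r ^ N \<le> R ^ N * (1 + norm z) ^ N"
    proof -
      have "norm z * 1 \<le> norm z * R" using R by (intro mult_left_mono) auto
      hence "r \<le> R * (1 + norm z)" using R norm_ge_zero [of z]
        unfolding r_def distrib_left by (auto simp: mult.commute)
      thus ?thesis unfolding power_mult_distrib [symmetric] using r by (intro power_mono) auto
    qed
    ultimately show ?thesis by (meson exp_le_cancel_iff less_imp_le order_trans)
  qed
  thus ?thesis using R by (intro fin_growthI [of "R ^ N"]) auto
qed

lemma fin_growth_imp_order_finite:
  assumes "fin_growth f"
  shows "entire_order f < \<infinity>"
proof -
  obtain K N where K: "K \<ge> 0" "\<And>z. norm (f z) \<le> exp (K * (1 + norm z) ^ N)"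
    using assms unfolding fin_growth_def by blast
  have "eventually (\<lambda>r. ereal (ln (ln (max (max_modulus f r) (exp 1))) / ln r) \<le> ereal (real (2 * N + 1))) at_top"
    using eventually_ge_at_top [of "max 2 (K + 1)"]
  proof eventually_elim
    case (elim r)
    hence r: "r \<ge> 2" "K + 1 \<le> r" by auto
    define M where "M = max (max_modulus f r) (exp 1)"
    \<comment> \<open>For r >= 2 one has 1 + r <= r^2, and K <= r accounts for the extra
      power.\<close>
    have 1: "K * (1 + r) ^ N \<le> r ^ (2 * N + 1)"
    proof -
      have "2 * r \<le> r * r" using r by (intro mult_right_mono) auto
      hence "1 + r \<le> r\<^sup>2" using r unfolding power2_eq_square by linarith
      hence "(1 + r) ^ N \<le> (r\<^sup>2) ^ N" using r by (intro power_mono) auto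
      hence "K * (1 + r) ^ N \<le> r * (r\<^sup>2) ^ N" using r K(1) by (intro mult_mono) auto
      thus ?thesis by (simp add: power_mult)
    qed
    have "max_modulus f r \<le> exp (r ^ (2 * N + 1))"
      unfolding max_modulus_def
    proof (rule cSup_least)
      fix y assume "y \<in> (\<lambda>z. norm (f z)) ` cball 0 r"
      then obtain z where z: "norm z \<le> r" "y = norm (f z)" by auto
      have "K * (1 + norm z) ^ N \<le> K * (1 + r) ^ N"
        using z K(1) by (intro mult_left_mono power_mono) auto
      with 1 have "K * (1 + norm z) ^ N \<le> r ^ (2 * N + 1)" by linarith
      thus "y \<le> exp (r ^ (2 * N + 1))" using K(2) [of z] z(2) by (meson exp_le_cancel_iff order_trans)
    qed (use r in auto)
    moreover have "1 \<le> r ^ (2 * N + 1)" using r by (intro one_le_power) auto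
    ultimately have "M \<le> exp (r ^ (2 * N + 1))" by (simp add: M_def)
    moreover have M: "exp 1 \<le> M" by (simp add: M_def)
    moreover have M0: "0 < M" using M by (rule less_le_trans [OF exp_gt_zero])
    ultimately have "ln M \<le> r ^ (2 * N + 1)" by (metis exp_gt_zero ln_exp ln_le_cancel_iff)
    moreover have "ln M \<ge> 1" using M M0 by (metis exp_gt_zero ln_exp ln_le_cancel_iff)
    ultimately have "ln (ln M) \<le> ln (r ^ (2 * N + 1))" using r by (subst ln_le_cancel_iff) auto
    also have "\<dots> = real (2 * N + 1) * ln r" by (rule ln_realpow)
    finally have "ln (ln M) / ln r \<le> real (2 * N + 1)" using r by (simp add: divide_le_eq)
    thus ?case by (simp add: M_def)
  qed
  hence "entire_order f \<le> ereal (real (2 * N + 1))"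
    unfolding entire_order_def by (rule Limsup_bounded)
  thus ?thesis by (rule le_less_trans) simp
qed

lemma fin_growth_sum:
  "finite I \<Longrightarrow> (\<And>i. i \<in> I \<Longrightarrow> fin_growth (f i)) \<Longrightarrow> fin_growth (\<lambda>z. \<Sum>i\<in>I. f i z)"
  by (induction I rule: finite_induct) (simp_all add: fin_growth_const fin_growth_add)

section \<open>The terminating case\<close>

text \<open>When \<open>\<mu> - \<nu> = 2p + 1\<close>, the terms of the series for \<open>J\<^sub>\<nu>\<close> from index \<open>p + 1\<close> on cancel
  the series \<open>s\<^sub>\<mu>\<^sub>,\<^sub>\<nu>\<close>, and the first \<open>p + 1\<close> terms form the terminating sum.\<close>
lemma lommel_i_closed_minus:
  assumes i: "\<not> odd_neg_int (\<mu> + \<nu>)" "\<not> odd_neg_int (\<mu> - \<nu>)" and \<mu>: "\<mu> - \<nu> = 2 * of_nat p + 1"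
  shows "lommel_i \<mu> \<nu> z = lommel_sum \<mu> \<nu> p z"
proof -
  have \<mu>': "\<mu> = \<nu> + 2 * of_nat p + 1" using \<mu> by (simp add: algebra_simps)
  define K where "K = (2::complex) powr (\<mu> - 1) * Gamma ((\<mu> - \<nu> + 1) / 2) * Gamma ((\<mu> + \<nu> + 1) / 2)"
  \<comment> \<open>Coefficient of \<zeta>^(\<nu> + 2k) in the Bessel part of S, the powers of 2
    moved out of the exponential. Index p belongs to the exponent \<mu> - 1.\<close>
  define \<beta> where "\<beta> = (\<lambda>k. K * (-1) ^ p * bessel_coeff \<nu> k * exp (- (\<nu> + 2 * of_nat k) * ln2c))"
  have ang: "(\<mu> - \<nu>) * of_real pi / 2 = of_nat p * of_real pi + of_real pi / 2"
    unfolding \<mu> by (simp add: algebra_simps add_divide_distrib)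
  have cs: "cos ((\<mu> - \<nu>) * of_real pi / 2) = 0" "sin ((\<mu> - \<nu>) * of_real pi / 2) = (-1) ^ p"
  proof -
    have r: "of_nat p * of_real pi = (of_real (real p * pi) :: complex)" "of_real pi / 2 = (of_real (pi / 2) :: complex)"
      by simp_all
    have "sin (of_nat p * of_real pi) = (0 :: complex)" "cos (of_nat p * of_real pi) = ((-1) ^ p :: complex)"
      unfolding r sin_of_real cos_of_real by (simp_all add: sin_npi cos_npi)
    moreover have "sin (of_real pi / 2) = (1 :: complex)" "cos (of_real pi / 2) = (0 :: complex)"
      unfolding r sin_of_real cos_of_real by simp_all
    ultimately show "cos ((\<mu> - \<nu>) * of_real pi / 2) = 0" "sin ((\<mu> - \<nu>) * of_real pi / 2) = (-1) ^ p"
      unfolding ang sin_add cos_add by simp_all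
  qed
  have \<beta>S: "4 * of_nat (Suc k) * (\<nu> + of_nat (Suc k)) * \<beta> (Suc k) = - \<beta> k" for k
  proof -
    have "exp (- (\<nu> + 2 * of_nat k) * ln2c) = exp (2 * ln2c + - (\<nu> + 2 * of_nat (Suc k)) * ln2c)"
      by (simp add: algebra_simps)
    also have "\<dots> = 4 * exp (- (\<nu> + 2 * of_nat (Suc k)) * ln2c)"
      unfolding exp_add exp_ln2c ..
    finally have e: "exp (- (\<nu> + 2 * of_nat k) * ln2c) = \<dots>" .
    have b: "bessel_coeff \<nu> k = - (of_nat (Suc k) * (\<nu> + of_nat (Suc k)) * bessel_coeff \<nu> (Suc k))"
      unfolding bessel_coeff_Suc by simp
    show ?thesis unfolding \<beta>_def e b by (simp del: of_nat_Suc)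
  qed
  have nz: "\<nu> + of_nat (p + k + 1) \<noteq> 0" for k
  proof
    assume h: "\<nu> + of_nat (p + k + 1) = 0"
    have "\<mu> + \<nu> = 2 * (\<nu> + of_nat (p + k + 1)) - (2 * of_nat k + 1)"
      unfolding \<mu>' by (simp add: algebra_simps)
    hence "\<mu> + \<nu> = - (2 * of_nat k + 1)" unfolding h by simp
    thus False using i(1) unfolding odd_neg_int_def by blast
  qed
  \<comment> \<open>The constant K is the normalisation that makes this leading coefficient 1; its
    Gamma factors are finite by \<open>nz\<close>.\<close>
  have \<beta>p: "\<beta> p = 1"
  proof -
    have G1: "Gamma ((\<mu> - \<nu> + 1) / 2) = Gamma (of_nat p + 1)" unfolding \<mu> by (simp add: add_divide_distrib add.commute)
    have "(\<mu> + \<nu> + 1) / 2 = \<nu> + of_nat p + 1" unfolding \<mu>' by (simp add: field_simps)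
    hence G2: "Gamma ((\<mu> + \<nu> + 1) / 2) = Gamma (\<nu> + of_nat p + 1)" by (rule arg_cong)
    have e: "2 powr (\<mu> - 1) * exp (- (\<nu> + 2 * of_nat p) * ln2c) = 1"
      unfolding complex_powr_2 \<mu>' exp_add [symmetric] by (simp add: algebra_simps)
    have "Gamma (of_nat p + 1) * rGamma (of_nat p + 1 :: complex) = 1"
      using Gamma_fact [of p, where ?'a = complex] rGamma_of_nat_Suc [of p] by (simp add: add_ac)
    moreover have "Gamma (\<nu> + of_nat p + 1) * rGamma (\<nu> + of_nat p + 1) = 1"
    proof -
      have "\<nu> + of_nat p + 1 \<notin> \<int>\<^sub>\<le>\<^sub>0"
      proof
        assume "\<nu> + of_nat p + 1 \<in> \<int>\<^sub>\<le>\<^sub>0"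
        then obtain k where k: "\<nu> + of_nat p + 1 = - of_nat k" by (auto elim: nonpos_Ints_cases')
        have "\<nu> + of_nat (p + k + 1) = (\<nu> + of_nat p + 1) + of_nat k" by simp
        also have "\<dots> = 0" unfolding k by simp
        finally have "\<nu> + of_nat (p + k + 1) = 0" .
        thus False using nz by blast
      qed
      thus ?thesis by (simp add: rGamma_inverse_Gamma Gamma_eq_zero_iff)
    qed
    moreover have "(-1) ^ p * (-1) ^ p = (1 :: complex)" by (simp add: power_mult_distrib [symmetric])
    moreover have "\<beta> p = (2 powr (\<mu> - 1) * exp (- (\<nu> + 2 * of_nat p) * ln2c)) * (Gamma (of_nat p + 1) * rGamma (of_nat p + 1))
       * (Gamma (\<nu> + of_nat p + 1) * rGamma (\<nu> + of_nat p + 1)) * ((-1) ^ p * (-1) ^ p)"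
      unfolding \<beta>_def K_def G1 G2 bessel_coeff_def by (simp only: mult_ac)
    ultimately show ?thesis using e by simp
  qed
  \<comment> \<open>Upwards from index p + 1 both sequences obey one recurrence, and the step from
    \<beta> p = 1 fixes the opposite sign.\<close>
  have tail: "\<beta> (m + Suc p) = - lommel_coeff \<mu> \<nu> m" for m
  proof (induction m)
    case 0
    define D where "D = (\<mu> + 1)^2 - \<nu>^2"
    have D: "D = 4 * of_nat (Suc p) * (\<nu> + of_nat (Suc p))"
      unfolding D_def \<mu>' by (simp add: algebra_simps power2_eq_square)
    have D0: "D \<noteq> 0" using lommel_factor_nonzero [OF i, of 0] by (simp add: D_def)
    have "D * \<beta> (Suc p) = - 1" unfolding D \<beta>S \<beta>p ..
    moreover have "lommel_coeff \<mu> \<nu> 0 = 1 / D" by (simp add: lommel_coeff_def D_def)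
    ultimately have "D * \<beta> (0 + Suc p) = D * (- lommel_coeff \<mu> \<nu> 0)" using D0 by simp
    thus ?case by (rule mult_left_cancel [OF D0, THEN iffD1])
  next
    case (Suc m)
    define D where "D = (\<mu> + 2 * of_nat (Suc m) + 1)^2 - \<nu>^2"
    have D: "D = 4 * of_nat (Suc (m + Suc p)) * (\<nu> + of_nat (Suc (m + Suc p)))"
      unfolding D_def \<mu>' by (simp add: algebra_simps power2_eq_square)
    have D0: "D \<noteq> 0" unfolding D_def by (rule lommel_factor_nonzero [OF i])
    have "D * \<beta> (Suc (m + Suc p)) = lommel_coeff \<mu> \<nu> m"
      unfolding D \<beta>S Suc by simp
    moreover have "lommel_coeff \<mu> \<nu> (Suc m) = - lommel_coeff \<mu> \<nu> m / D"
      by (simp add: lommel_coeff_def D_def)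
    ultimately have "D * \<beta> (Suc m + Suc p) = D * (- lommel_coeff \<mu> \<nu> (Suc m))" using D0 by simp
    thus ?case by (rule mult_left_cancel [OF D0, THEN iffD1])
  qed
  \<comment> \<open>Read downwards from index p, each step of the same recurrence multiplies by
    minus the next factor of the product.\<close>
  have head: "j \<le> p \<Longrightarrow> \<beta> (p - j) = (-1) ^ j * lommel_prod \<mu> \<nu> j" for j
  proof (induction j)
    case 0
    thus ?case by (simp add: \<beta>p lommel_prod_def)
  next
    case (Suc j)
    then obtain l where l: "p = Suc (j + l)" using less_imp_Suc_add [of j p] by auto
    have pj: "p - j = Suc l" "p - Suc j = l" using l by auto
    have "(\<mu> - 2 * of_nat (Suc j) + 1)^2 - \<nu>^2 = 4 * of_nat (Suc l) * (\<nu> + of_nat (Suc l))"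
      unfolding \<mu>' l by (simp add: algebra_simps power2_eq_square)
    moreover have "\<beta> l = - (4 * of_nat (Suc l) * (\<nu> + of_nat (Suc l)) * \<beta> (Suc l))"
      unfolding \<beta>S by simp
    moreover have "\<beta> (Suc l) = (-1) ^ j * lommel_prod \<mu> \<nu> j" using Suc pj by simp
    ultimately show ?case unfolding pj lommel_prod_Suc by (simp del: of_nat_Suc)
  qed
  define t where "t = (\<lambda>k. \<beta> k * exp ((\<nu> + 2 * of_nat k) * z))"
  have tJ: "t k = K * (-1) ^ p * (bessel_coeff \<nu> k * exp ((\<nu> + 2 * of_nat k) * (z - ln2c)))" for k
  proof -
    have "exp ((\<nu> + 2 * of_nat k) * (z - ln2c)) = exp (- (\<nu> + 2 * of_nat k) * ln2c) * exp ((\<nu> + 2 * of_nat k) * z)"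
      unfolding exp_add [symmetric] by (simp add: algebra_simps)
    thus ?thesis by (simp add: t_def \<beta>_def)
  qed
  have sJ: "summable (\<lambda>k. bessel_coeff \<nu> k * exp ((\<nu> + 2 * of_nat k) * (z - ln2c)))"
    by (rule summable_exp_series [OF entire_bessel_coeff])
  have st: "summable t" unfolding tJ [abs_def] by (rule summable_mult [OF sJ])
  have "K * (-1) ^ p * besselJ_exp \<nu> z = suminf t"
    unfolding besselJ_exp_eq exp_series_def tJ [abs_def] by (rule suminf_mult [OF sJ, symmetric])
  also have "\<dots> = (\<Sum>m. t (m + Suc p)) + (\<Sum>k<Suc p. t k)"
    by (rule suminf_split_initial_segment [OF st])
  also have "(\<Sum>m. t (m + Suc p)) = (\<Sum>m. - (lommel_coeff \<mu> \<nu> m * exp ((\<mu> + 1 + 2 * of_nat m) * z)))"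
  proof (intro suminf_cong)
    fix m
    have e: "\<nu> + 2 * of_nat (m + Suc p) = \<mu> + 1 + 2 * of_nat m" unfolding \<mu>' by simp
    show "t (m + Suc p) = - (lommel_coeff \<mu> \<nu> m * exp ((\<mu> + 1 + 2 * of_nat m) * z))"
      unfolding t_def tail e by simp
  qed
  also have "\<dots> = - exp_series (\<mu> + 1) (lommel_coeff \<mu> \<nu>) z"
    unfolding exp_series_def by (rule suminf_minus [OF summable_exp_series [OF entire_lommel_coeff [OF i]]])
  also have "(\<Sum>k<Suc p. t k) = (\<Sum>j<Suc p. t (Suc p - Suc j))"
    by (rule sum.nat_diff_reindex [symmetric])
  also have "\<dots> = lommel_sum \<mu> \<nu> p z"
    unfolding lommel_sum_eq lessThan_Suc_atMost
  proof (intro sum.cong refl)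
    fix j assume "j \<in> {..p}"
    hence j: "j \<le> p" by simp
    have e: "\<nu> + 2 * of_nat (p - j) = \<mu> - 1 - 2 * of_nat j" unfolding \<mu>' using j by (simp add: of_nat_diff)
    show "t (Suc p - Suc j) = (-1) ^ j * lommel_prod \<mu> \<nu> j * exp ((\<mu> - 1 - 2 * of_nat j) * z)"
      unfolding t_def diff_Suc_Suc e head [OF j] ..
  qed
  finally have main: "K * (-1) ^ p * besselJ_exp \<nu> z = - exp_series (\<mu> + 1) (lommel_coeff \<mu> \<nu>) z + lommel_sum \<mu> \<nu> p z" .
  have s: "exp_series (\<mu> + 1) (lommel_coeff \<mu> \<nu>) z = (\<Sum>m. (-1)^m * exp ((\<mu> + 1 + 2 * of_nat m) * z)
            / (\<Prod>k\<in>{0..m}. (\<mu> + 2 * of_nat k + 1)^2 - \<nu>^2))"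
    by (simp add: exp_series_def lommel_coeff_def)
  show ?thesis unfolding lommel_i_def s [symmetric] K_def [symmetric] cs
    using main by (simp add: algebra_simps)
qed

text \<open>For \<nu> not an integer, J_\<nu> cos \<nu>\<pi> - Y_\<nu> sin \<nu>\<pi> = J_{-\<nu>}
  shows that S is unchanged under \<nu> -> -\<nu>, which reduces to
  \<open>lommel_i_closed_minus\<close>. For an integer \<nu>, \<mu> - \<nu> is odd as well, and
  positive because negative odd values are excluded in case (i).\<close>

lemma lommel_i_closed_plus:
  assumes i: "\<not> odd_neg_int (\<mu> + \<nu>)" "\<not> odd_neg_int (\<mu> - \<nu>)" and \<mu>: "\<mu> + \<nu> = 2 * of_nat p + 1"
  shows "lommel_i \<mu> \<nu> z = lommel_sum \<mu> \<nu> p z"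
proof (cases "\<nu> \<in> \<int>")
  case True
  then obtain n where n: "\<nu> = of_int n" by (auto elim: Ints_cases)
  define q where "q = int p - n"
  have q: "\<mu> - \<nu> = 2 * of_int q + 1" using \<mu> by (simp add: q_def n algebra_simps)
  have "q \<ge> 0"
  proof (rule ccontr)
    assume "\<not> q \<ge> 0"
    then obtain k where "q = - 1 - int k" by (intro that [of "nat (- 1 - q)"]) simp
    hence "\<mu> - \<nu> = - (2 * of_nat k + 1)" unfolding q by simp
    thus False using i(2) unfolding odd_neg_int_def by blast
  qed
  then obtain p' where "q = int p'" by (metis nonneg_int_cases)
  hence p': "\<mu> - \<nu> = 2 * of_nat p' + 1" using q by simp
  show ?thesis
    using lommel_i_closed_minus [OF i p'] lommel_sum_unique [of \<mu> \<nu> p p' z] \<mu> p' by simp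
next
  case False
  let ?c = "\<nu> * of_real pi"
  have ang: "(\<mu> - \<nu>) * of_real pi / 2 = (\<mu> + \<nu>) * of_real pi / 2 - ?c"
    by (simp add: algebra_simps add_divide_distrib diff_divide_distrib)
  have ang2: "(\<mu> + \<nu>) * of_real pi / 2 = of_nat p * of_real pi + of_real pi / 2"
    unfolding \<mu> by (simp add: algebra_simps add_divide_distrib)
  have r: "of_nat p * of_real pi = (of_real (real p * pi) :: complex)" "of_real pi / 2 = (of_real (pi / 2) :: complex)"
    by simp_all
  have "sin (of_nat p * of_real pi) = (0 :: complex)" "cos (of_nat p * of_real pi) = ((-1) ^ p :: complex)"
    unfolding r sin_of_real cos_of_real by (simp_all add: sin_npi cos_npi)
  moreover have "sin (of_real pi / 2) = (1 :: complex)" "cos (of_real pi / 2) = (0 :: complex)"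
    unfolding r sin_of_real cos_of_real by simp_all
  ultimately have cs: "cos ((\<mu> + \<nu>) * of_real pi / 2) = 0" "sin ((\<mu> + \<nu>) * of_real pi / 2) = (-1) ^ p"
    unfolding ang2 sin_add cos_add by simp_all
  have s0: "sin ?c \<noteq> 0"
  proof
    assume "sin ?c = 0"
    then obtain n :: int where "?c = of_real (of_int n * pi)" unfolding sin_eq_0 by blast
    hence "\<nu> = of_int n" by simp
    thus False using False by simp
  qed
  have Y: "besselY_exp \<nu> z * sin ?c = besselJ_exp \<nu> z * cos ?c - besselJ_exp (- \<nu>) z"
    using False s0 by (simp add: besselY_exp_def)
  have 1: "besselJ_exp \<nu> z * sin ((\<mu> - \<nu>) * of_real pi / 2) - besselY_exp \<nu> z * cos ((\<mu> - \<nu>) * of_real pi / 2)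
     = (-1) ^ p * besselJ_exp (- \<nu>) z"
  proof -
    have "besselJ_exp \<nu> z * sin ((\<mu> - \<nu>) * of_real pi / 2) - besselY_exp \<nu> z * cos ((\<mu> - \<nu>) * of_real pi / 2)
      = (-1) ^ p * (besselJ_exp \<nu> z * cos ?c - besselY_exp \<nu> z * sin ?c)"
      unfolding ang sin_diff cos_diff cs by (simp add: algebra_simps)
    thus ?thesis unfolding Y by simp
  qed
  have 2: "besselJ_exp (- \<nu>) z * sin ((\<mu> - - \<nu>) * of_real pi / 2) - besselY_exp (- \<nu>) z * cos ((\<mu> - - \<nu>) * of_real pi / 2)
     = (-1) ^ p * besselJ_exp (- \<nu>) z"
    by (simp add: cs)
  have "lommel_i \<mu> \<nu> z = lommel_i \<mu> (- \<nu>) z"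
    unfolding lommel_i_def 1 2 by (simp add: mult_ac)
  also have "\<dots> = lommel_sum \<mu> (- \<nu>) p z"
    by (rule lommel_i_closed_minus) (use i \<mu> in auto)
  finally show ?thesis by (simp add: lommel_sum_minus)
qed

section \<open>The case distinction in the definition of S\<close>

lemma case_ii_The: "case_ii \<mu> \<nu> p \<Longrightarrow> (THE p. case_ii \<mu> \<nu> p) = p"
  by (rule the_equality) (auto simp: case_ii_def)

text \<open>Subtract \<mu> - \<nu> = -(2p + 1) from \<mu> + \<nu> = 2q + 1; this is the situation of
  \<open>lommel_ii_closed\<close>.\<close>

lemma case_ii_nat:
  assumes "case_ii \<mu> \<nu> p" "\<mu> + \<nu> = 2 * of_nat q + 1"
  shows "\<nu> = of_nat (p + q + 1)" "\<mu> = of_nat (p + q + 1) - 2 * of_nat p - 1"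
proof -
  have m: "\<mu> = \<nu> - 2 * of_nat p - 1" using assms(1) by (simp add: case_ii_def)
  have "2 * \<nu> = (\<mu> + \<nu>) + 2 * of_nat p + 1" unfolding m by simp
  also have "\<dots> = 2 * of_nat (p + q + 1)" unfolding assms(2) by simp
  finally have "2 * \<nu> = 2 * of_nat (p + q + 1)" .
  thus "\<nu> = of_nat (p + q + 1)" by (metis mult_left_cancel zero_neq_numeral)
  thus "\<mu> = of_nat (p + q + 1) - 2 * of_nat p - 1" using m by simp
qed

lemma case_ii_closed:
  assumes "case_ii \<mu> \<nu> p" "\<mu> + \<nu> = 2 * of_nat q + 1"
  shows "lommel_ii \<nu> p z = lommel_sum \<mu> \<nu> q z"
  using lommel_ii_closed [of p q z] case_ii_nat [OF assms] by simp

lemma case_ii_sol: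
  assumes c: "case_ii \<mu> \<nu> p" and no: "\<And>q::nat. \<mu> + \<nu> \<noteq> 2 * of_nat q + 1"
  shows "bessel_sol 1 \<nu> (lommel_ii \<nu> p) (\<lambda>z. exp ((\<mu> + 1) * z))"
proof -
  have m: "\<mu> + 1 = \<nu> - 2 * of_nat p" using c by (simp add: case_ii_def)
  have "bessel_sol 1 \<nu> (lommel_nu_m1 \<nu>) (\<lambda>z. exp (\<nu> * z))"
  proof (cases "\<exists>n::nat. \<nu> = - of_nat n")
    case True
    thus ?thesis using bessel_sol_lommel_nu_m1_neg by auto
  qed (use bessel_sol_lommel_nu_m1_generic in blast)
  moreover have "\<nu> \<noteq> of_nat j" if "1 \<le> j" "j \<le> p" for j
    using c that unfolding case_ii_def by auto
  ultimately show ?thesis unfolding m by (rule bessel_sol_lommel_ii)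
qed

text \<open>Justifies the last branch of \<open>lommelS_exp\<close>. If \<mu> - \<nu> is negative
  odd and (ii) fails, then \<nu> = j with 1 <= j <= p, so \<mu> + \<nu> is negative odd too. If (ii)
  then failed for -\<nu> as well, \<nu> = -j would satisfy it with p - j in place of p.\<close>

lemma odd_neg_cases:
  assumes "odd_neg_int (\<mu> + \<nu>) \<or> odd_neg_int (\<mu> - \<nu>)" "\<not> (\<exists>p. case_ii \<mu> \<nu> p)"
  shows "\<exists>p. case_ii \<mu> (- \<nu>) p"
proof -
  have "odd_neg_int (\<mu> + \<nu>)"
  proof (rule ccontr)
    assume h: "\<not> odd_neg_int (\<mu> + \<nu>)"
    then obtain p where p: "\<mu> - \<nu> = - (2 * of_nat p + 1)" using assms(1) unfolding odd_neg_int_def by blast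
    hence m: "\<mu> = \<nu> - 2 * of_nat p - 1" by (simp add: algebra_simps)
    then obtain j where j: "1 \<le> j" "j \<le> p" "\<nu> = of_nat j" using assms(2) unfolding case_ii_def by blast
    have "\<mu> + \<nu> = - (2 * of_nat (p - j) + 1)" unfolding m using j by (simp add: of_nat_diff algebra_simps)
    thus False using h unfolding odd_neg_int_def by blast
  qed
  then obtain p where p: "\<mu> + \<nu> = - (2 * of_nat p + 1)" unfolding odd_neg_int_def by blast
  have "\<mu> = (\<mu> + \<nu>) - \<nu>" by simp
  also have "\<dots> = - \<nu> - 2 * of_nat p - 1" unfolding p by simp
  finally have m: "\<mu> = - \<nu> - 2 * of_nat p - 1" .
  show ?thesis
  proof (cases "\<exists>j. 1 \<le> j \<and> j \<le> p \<and> - \<nu> = of_nat j")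
    case True
    then obtain j where j: "1 \<le> j" "j \<le> p" "- \<nu> = of_nat j" by blast
    have n: "\<nu> = - of_nat j" using j(3) by (metis minus_minus)
    have "\<mu> = \<nu> - 2 * of_nat (p - j) - 1"
      unfolding m n using j by (simp add: of_nat_diff algebra_simps)
    moreover have "\<nu> \<notin> {of_nat i |i. 1 \<le> i \<and> i \<le> p - j}"
    proof
      assume "\<nu> \<in> {of_nat i |i. 1 \<le> i \<and> i \<le> p - j}"
      then obtain i where "- of_nat j = (of_nat i :: complex)" unfolding n by blast
      hence "of_nat (i + j) = (0 :: complex)" by (simp add: add_eq_0_iff2)
      thus False unfolding of_nat_eq_0_iff using j(1) by simp
    qed
    ultimately have "case_ii \<mu> \<nu> (p - j)" unfolding case_ii_def by blast
    thus ?thesis using assms(2) by blast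
  next
    case False
    hence "case_ii \<mu> (- \<nu>) p" using m unfolding case_ii_def by blast
    thus ?thesis by blast
  qed
qed

lemma lommelS_exp_cases:
  obtains (i) "\<not> odd_neg_int (\<mu> + \<nu>)" "\<not> odd_neg_int (\<mu> - \<nu>)" "lommelS_exp \<mu> \<nu> = lommel_i \<mu> \<nu>"
  | (ii) p where "case_ii \<mu> \<nu> p" "lommelS_exp \<mu> \<nu> = lommel_ii \<nu> p"
  | (iii) p where "case_ii \<mu> (- \<nu>) p" "lommelS_exp \<mu> \<nu> = lommel_ii (- \<nu>) p"
proof (cases "\<not> odd_neg_int (\<mu> + \<nu>) \<and> \<not> odd_neg_int (\<mu> - \<nu>)")
  case True
  thus thesis by (intro i) (auto simp: lommelS_exp_def fun_eq_iff)
next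
  case F: False
  show thesis
  proof (cases "\<exists>p. case_ii \<mu> \<nu> p")
    case True
    then obtain p where p: "case_ii \<mu> \<nu> p" by blast
    show thesis using p F case_ii_The [OF p] by (intro ii [OF p]) (auto simp: lommelS_exp_def fun_eq_iff)
  next
    case False
    then obtain p where p: "case_ii \<mu> (- \<nu>) p" using odd_neg_cases F by blast
    show thesis using p F False case_ii_The [OF p] by (intro iii [OF p]) (auto simp: lommelS_exp_def fun_eq_iff)
  qed
qed

lemma case_ii_not_odd: "case_ii \<mu> \<nu> p \<Longrightarrow> \<mu> - \<nu> \<noteq> 2 * of_nat q + 1"
proof
  assume "case_ii \<mu> \<nu> p" "\<mu> - \<nu> = 2 * of_nat q + 1"
  hence "2 * of_nat q + 1 = (- 2 * of_nat p - 1 :: complex)" by (simp add: case_ii_def)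
  moreover have "of_nat (2 * q + 2 * p + 2) = (2 * of_nat q + 1) - (- 2 * of_nat p - 1 :: complex)"
    by simp
  ultimately have "of_nat (2 * q + 2 * p + 2) = (0 :: complex)" by (simp only: diff_self)
  thus False unfolding of_nat_eq_0_iff by simp
qed

lemma lommelS_exp_closed:
  assumes "\<mu> + \<nu> = 2 * of_nat q + 1 \<or> \<mu> - \<nu> = 2 * of_nat q + 1"
  shows "lommelS_exp \<mu> \<nu> z = lommel_sum \<mu> \<nu> q z"
proof (cases rule: lommelS_exp_cases [of \<mu> \<nu>])
  case i
  thus ?thesis using assms lommel_i_closed_plus lommel_i_closed_minus by auto
next
  case (ii p)
  thus ?thesis using assms case_ii_closed case_ii_not_odd by fastforce
next
  case (iii p)
  have "\<mu> + \<nu> \<noteq> 2 * of_nat q + 1" using case_ii_not_odd [OF iii(1), of q] by simp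
  hence "\<mu> + - \<nu> = 2 * of_nat q + 1" using assms by simp
  thus ?thesis using iii case_ii_closed [OF iii(1)] by (simp add: lommel_sum_minus)
qed

lemma lommelS_exp_sol:
  assumes "\<not> (\<exists>p::nat. \<mu> + \<nu> = 2 * of_nat p + 1 \<or> \<mu> - \<nu> = 2 * of_nat p + 1)"
  shows "bessel_sol 1 \<nu> (lommelS_exp \<mu> \<nu>) (\<lambda>z. exp ((\<mu> + 1) * z))"
proof (cases rule: lommelS_exp_cases [of \<mu> \<nu>])
  case i
  thus ?thesis using bessel_sol_lommel_i by simp
next
  case (ii p)
  thus ?thesis using assms case_ii_sol by auto
next
  case (iii p)
  have "bessel_sol 1 (- \<nu>) (lommel_ii (- \<nu>) p) (\<lambda>z. exp ((\<mu> + 1) * z))"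
    by (rule case_ii_sol [OF iii(1)]) (use assms in auto)
  \<comment> \<open>The equation involves \<nu> only through its square.\<close>
  thus ?thesis unfolding iii(2) bessel_sol_minus .
qed

lemma fin_growth_lommel_sum: "fin_growth (lommel_sum \<mu> \<nu> p)"
proof -
  have "fin_growth (\<lambda>z. \<Sum>j\<le>p. (-1)^j * lommel_prod \<mu> \<nu> j * exp ((\<mu> - 1 - 2 * of_nat j) * z))"
    by (intro fin_growth_sum fin_growth_mult fin_growth_const fin_growth_exp) auto
  thus ?thesis by (simp add: lommel_sum_eq [abs_def])
qed

theorem theorem1p7:
  fixes \<mu> \<nu> :: complex and k :: int
  defines "F \<equiv> (\<lambda>z. lommelS_exp \<mu> \<nu> (z + 2 * of_real pi * \<i> * of_int k))"
  shows "(entire_order F < \<infinity> \<longleftrightarrow>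
            (\<exists>p::nat. \<mu> + \<nu> = 2 * of_nat p + 1 \<or> \<mu> - \<nu> = 2 * of_nat p + 1))
       \<and> (\<forall>p::nat. (\<mu> + \<nu> = 2 * of_nat p + 1 \<or> \<mu> - \<nu> = 2 * of_nat p + 1) \<longrightarrow>
            (\<forall>z. F z = exp ((\<mu> - 1) * (z + 2 * of_real pi * \<i> * of_int k)) *
                 (\<Sum>j\<le>p. (-1)^j * (\<Prod>m\<in>{1..j}. (\<mu> - 2 * of_nat m + 1)^2 - \<nu>^2)
                          / exp (2 * of_nat j * (z + 2 * of_real pi * \<i> * of_int k)))))"
proof (intro conjI iffI allI impI)
  let ?c = "2 * of_real pi * \<i> * of_int k :: complex"
  have closed: "F z = lommel_sum \<mu> \<nu> p (z + ?c)"
    if "\<mu> + \<nu> = 2 * of_nat p + 1 \<or> \<mu> - \<nu> = 2 * of_nat p + 1" for p z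
    unfolding F_def by (rule lommelS_exp_closed [OF that])
  show "F z = exp ((\<mu> - 1) * (z + ?c)) *
      (\<Sum>j\<le>p. (-1)^j * (\<Prod>m\<in>{1..j}. (\<mu> - 2 * of_nat m + 1)^2 - \<nu>^2) / exp (2 * of_nat j * (z + ?c)))"
    if "\<mu> + \<nu> = 2 * of_nat p + 1 \<or> \<mu> - \<nu> = 2 * of_nat p + 1" for p z
    unfolding closed [OF that] lommel_sum_def lommel_prod_def ..
  show "entire_order F < \<infinity>" if ex: "\<exists>p::nat. \<mu> + \<nu> = 2 * of_nat p + 1 \<or> \<mu> - \<nu> = 2 * of_nat p + 1"
  proof -
    obtain p :: nat where "\<mu> + \<nu> = 2 * of_nat p + 1 \<or> \<mu> - \<nu> = 2 * of_nat p + 1" using ex by blast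
    hence "F = (\<lambda>z. lommel_sum \<mu> \<nu> p (z + ?c))" using closed by (intro ext)
    hence "fin_growth F" by (simp only: fin_growth_shift [OF fin_growth_lommel_sum])
    thus ?thesis by (rule fin_growth_imp_order_finite)
  qed
  show "\<exists>p::nat. \<mu> + \<nu> = 2 * of_nat p + 1 \<or> \<mu> - \<nu> = 2 * of_nat p + 1" if ord: "entire_order F < \<infinity>"
  proof (rule ccontr)
    assume no: "\<not> ?thesis"
    have sol: "bessel_sol 1 \<nu> (lommelS_exp \<mu> \<nu>) (\<lambda>z. exp ((\<mu> + 1) * z))"
      by (rule lommelS_exp_sol [OF no])
    have "bessel_sol (1 * exp (2 * ?c)) \<nu> F (\<lambda>z. exp ((\<mu> + 1) * (z + ?c)))"
      unfolding F_def by (rule bessel_sol_shift [OF sol])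
    hence "continuous_on UNIV F" by (intro holomorphic_on_imp_continuous_on bessel_sol_holomorphic)
    hence "fin_growth F" using ord by (rule order_finite_imp_fin_growth)
    \<comment> \<open>Finite growth is invariant under translation, so the contradiction is derived
      on the branch with k = 0.\<close>
    hence "fin_growth (\<lambda>z. F (z + - ?c))" by (rule fin_growth_shift)
    hence "fin_growth (lommelS_exp \<mu> \<nu>)" by (simp add: F_def)
    thus False using fin_growth_imp_odd [OF sol] no by blast
  qed
qed

end
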